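(* Let $H$ be a subgroup of $\mathcal D_q=\mathrm{Diff}(\mathbb K^q,0)$ with Lie algebra $LH$. Let $X$ be the germ of a smooth vector field on $(\mathbb K^q,0)$ which is locally diffeomorphic to a generalized Euler vector field with non-negative weights and positive total weight, i.e. to $\sum_{i=1}^q w_ix_i\,\partial/\partial x_i$ with $w_i\in\mathbb Z$, $w_i\ge 0$ for all $i$ and $\sum_i w_i>0$. If $X$ generates a $C_q$-module in $LH$ (i.e. $C_q\cdot X\subset LH$), then any two germs of volume forms on $(\mathbb K^q,0)$ (which over $\mathbb K=\mathbb R$ define the same orientation) are $H$-isotopic.
   Context: $\mathbb K=\mathbb C$ or $\mathbb R$; "smooth" means complex-analytic if $\mathbb K=\mathbb C$ and $C^\infty$ or real-analytic if $\mathbb K=\mathbb R$. $C_q$ is the ring of smooth function germs on $(\mathbb K^q,0)$, and $\mathcal D_q$ is the group of origin-preserving diffeomorphism germs of $(\mathbb K^q,0)$. $LH$ is the Lie algebra of $H$, consisting of vector fields vanishing at $0$; it is understood in the usual sense that smooth families $\Phi_t\in H$ ($t\in[0,1]$, $\Phi_0=\mathrm{Id}$) are exactly the solutions of $\frac{d}{dt}\Phi_t=X_t\circ\Phi_t$, $\Phi_0=\mathrm{Id}$, with $X_t\in LH$ a smooth family. Two volume forms $\Omega_0,\Omega_1$ are $H$-isotopic if there is a smooth family $\Phi_t\in H$, $t\in[0,1]$, with $\Phi_0=\mathrm{Id}$ and $\Phi_1^*\Omega_1=\Omega_0$. *)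

theory Defs
  imports "HOL-Analysis.Analysis" "HOL-Algebra.Group"
begin

text \<open>
  Throughout, the ground field is a type \<open>'k\<close> (instantiated to \<open>real\<close> or \<open>complex\<close>), the space
  \<open>K\<^sup>q\<close> is \<open>'k ^ 'n\<close> with \<open>q = CARD('n)\<close>, and all germs are germs at the origin.
\<close>

subsection \<open>Smooth functions and maps\<close>

datatype regularity = C_infinity | Analytic

text \<open>\<open>k\<close> times continuously (real) differentiable, on an open set \<open>U\<close>.\<close>

primrec Ck_on :: "nat \<Rightarrow> ('a::real_normed_vector \<Rightarrow> 'b::real_normed_vector) \<Rightarrow> 'a set \<Rightarrow> bool" where
  "Ck_on 0 f U \<longleftrightarrow> continuous_on U f"
| "Ck_on (Suc k) f U \<longleftrightarrow>
     (\<forall>x\<in>U. f differentiable (at x)) \<and> (\<forall>v. Ck_on k (\<lambda>x. frechet_derivative f (at x) v) U)"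

text \<open>
  Local expansion in a convergent power series in several variables over \<open>'k\<close>; the functions
  \<open>\<alpha> :: 'm \<Rightarrow> nat\<close> are the multi-indices. For \<open>'k = real\<close> this is real-analyticity,
  for \<open>'k = complex\<close> complex-analyticity.
\<close>

definition has_power_series_at :: "('k::real_normed_field ^ 'm \<Rightarrow> 'k) \<Rightarrow> 'k ^ 'm \<Rightarrow> bool" where
  "has_power_series_at f a \<longleftrightarrow>
     (\<exists>(c :: ('m \<Rightarrow> nat) \<Rightarrow> 'k) r. 0 < r \<and>
        (\<forall>x\<in>ball a r. ((\<lambda>\<alpha>. c \<alpha> * (\<Prod>i\<in>UNIV. (x $ i - a $ i) ^ \<alpha> i)) has_sum f x) UNIV))"

text \<open>
  \<open>C_infinity\<close> refers to the underlying real structure and is only meant to be used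
  for \<open>'k = real\<close>.
\<close>

definition smooth_on :: "regularity \<Rightarrow> ('k::real_normed_field ^ 'm \<Rightarrow> 'k) \<Rightarrow> ('k ^ 'm) set \<Rightarrow> bool" where
  "smooth_on reg f U \<longleftrightarrow>
     (case reg of C_infinity \<Rightarrow> \<forall>k. Ck_on k f U | Analytic \<Rightarrow> \<forall>a\<in>U. has_power_series_at f a)"

definition smooth_map_on ::
  "regularity \<Rightarrow> ('k::real_normed_field ^ 'm \<Rightarrow> 'k ^ 'p) \<Rightarrow> ('k ^ 'm) set \<Rightarrow> bool" where
  "smooth_map_on reg F U \<longleftrightarrow> (\<forall>i. smooth_on reg (\<lambda>x. F x $ i) U)"

subsection \<open>Germs at the origin\<close>

text \<open>The germ of \<open>f\<close>, as an equivalence class of representatives.\<close>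

definition germ :: "('a::{topological_space,zero} \<Rightarrow> 'b) \<Rightarrow> ('a \<Rightarrow> 'b) set" where
  "germ f = {g. \<forall>\<^sub>F x in nhds 0. g x = f x}"

lemma germ_eq_iff: "germ f = germ g \<longleftrightarrow> (\<forall>\<^sub>F x in nhds 0. f x = g x)"
proof
  assume "germ f = germ g"
  moreover have "f \<in> germ f" by (simp add: germ_def)
  ultimately show "\<forall>\<^sub>F x in nhds 0. f x = g x" by (simp add: germ_def)
next
  assume a: "\<forall>\<^sub>F x in nhds 0. f x = g x"
  show "germ f = germ g"
    unfolding germ_def using a by (auto elim: eventually_elim2)
qed

definition smooth_germ :: "regularity \<Rightarrow> ('k::real_normed_field ^ 'm \<Rightarrow> 'k) \<Rightarrow> bool" where
  "smooth_germ reg f \<longleftrightarrow> (\<exists>U. open U \<and> 0 \<in> U \<and> smooth_on reg f U)"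

definition smooth_map_germ :: "regularity \<Rightarrow> ('k::real_normed_field ^ 'm \<Rightarrow> 'k ^ 'p) \<Rightarrow> bool" where
  "smooth_map_germ reg F \<longleftrightarrow> (\<exists>U. open U \<and> 0 \<in> U \<and> smooth_map_on reg F U)"

subsection \<open>The group of diffeomorphism germs\<close>

definition diffeo_germ :: "regularity \<Rightarrow> ('k::real_normed_field ^ 'n \<Rightarrow> 'k ^ 'n) \<Rightarrow> bool" where
  "diffeo_germ reg \<phi> \<longleftrightarrow>
     smooth_map_germ reg \<phi> \<and> \<phi> 0 = 0 \<and>
     (\<exists>\<psi>. smooth_map_germ reg \<psi> \<and> \<psi> 0 = 0 \<and>
          (\<forall>\<^sub>F x in nhds 0. \<psi> (\<phi> x) = x) \<and> (\<forall>\<^sub>F x in nhds 0. \<phi> (\<psi> x) = x))"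

text \<open>
  On origin-preserving continuous germs all representatives yield the same composite germ,
  so the union below is the union of one equivalence class (see \<open>germ_comp_germ\<close>).
\<close>

definition germ_comp :: "('a::{topological_space,zero} \<Rightarrow> 'a) set \<Rightarrow> ('a \<Rightarrow> 'a) set \<Rightarrow> ('a \<Rightarrow> 'a) set" where
  "germ_comp A B = (\<Union>f\<in>A. \<Union>g\<in>B. germ (f \<circ> g))"

lemma germ_comp_germ:
  assumes "isCont g 0" "g 0 = 0"
  shows "germ_comp (germ f) (germ g) = germ (f \<circ> g)"
proof -
  have "germ (f' \<circ> g') = germ (f \<circ> g)" if f': "f' \<in> germ f" and g': "g' \<in> germ g" for f' g'
  proof -
    have "filterlim g (nhds 0) (nhds 0)"
      using assms tendsto_at_iff_tendsto_nhds[of g 0] by (simp add: isCont_def)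
    then have "\<forall>\<^sub>F x in nhds 0. f' (g x) = f (g x)"
      using f' by (auto simp: germ_def filterlim_iff)
    moreover have "\<forall>\<^sub>F x in nhds 0. g' x = g x"
      using g' by (simp add: germ_def)
    ultimately show ?thesis
      unfolding germ_eq_iff by eventually_elim simp
  qed
  moreover have "f \<in> germ f" "g \<in> germ g"
    by (simp_all add: germ_def)
  ultimately show ?thesis
    unfolding germ_comp_def by blast
qed

definition diffeo_group :: "regularity \<Rightarrow> ('k::real_normed_field ^ 'n \<Rightarrow> 'k ^ 'n) set monoid" where
  "diffeo_group reg =
     \<lparr>carrier = germ ` {\<phi>. diffeo_germ reg \<phi>}, mult = germ_comp, one = germ (\<lambda>x. x)\<rparr>"

subsection \<open>Smooth families parametrised by the unit interval\<close>

text \<open>The point \<open>(t, x)\<close> of \<open>K \<times> K\<^sup>q = K\<^sup>q\<^sup>+\<^sup>1\<close>; the coordinate \<open>None\<close> is the parameter.\<close>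

definition time_space :: "'k \<Rightarrow> 'k ^ 'n \<Rightarrow> 'k ^ ('n option)" where
  "time_space t x = (\<chi> i. case i of None \<Rightarrow> t | Some j \<Rightarrow> x $ j)"

text \<open>
  A smooth family of map germs at the origin, indexed by \<open>t \<in> [0,1]\<close>: it is the restriction of a
  map which is smooth, jointly in \<open>(t, x)\<close>, on a neighbourhood of \<open>[0,1] \<times> {0}\<close> in
  \<open>K \<times> K\<^sup>q\<close>.
\<close>

definition smooth_family :: "regularity \<Rightarrow> (real \<Rightarrow> 'k::real_normed_field ^ 'n \<Rightarrow> 'k ^ 'p) \<Rightarrow> bool" where
  "smooth_family reg \<Phi> \<longleftrightarrow>
     (\<exists>W F. open W \<and> (\<forall>t\<in>{0..1}. time_space (of_real t) 0 \<in> W) \<and> smooth_map_on reg F W \<and>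
        (\<forall>t\<in>{0..1}. \<forall>x. time_space (of_real t) x \<in> W \<longrightarrow> \<Phi> t x = F (time_space (of_real t) x)))"

text \<open>
  The equation \<open>d/dt \<Phi>\<^sub>t = X\<^sub>t \<circ> \<Phi>\<^sub>t\<close> for germs along \<open>[0,1] \<times> {0}\<close>. The neighbourhood of the origin is
  uniform in \<open>t\<close>; if it were allowed to depend on \<open>t\<close>, solutions would not be determined by
  \<open>\<Phi>\<^sub>0\<close> in the \<open>C_infinity\<close> case.
\<close>

definition flow_equation ::
  "(real \<Rightarrow> 'k::real_normed_field ^ 'n \<Rightarrow> 'k ^ 'n) \<Rightarrow> (real \<Rightarrow> 'k ^ 'n \<Rightarrow> 'k ^ 'n) \<Rightarrow> bool" where
  "flow_equation X \<Phi> \<longleftrightarrow>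
     (\<forall>\<^sub>F x in nhds 0. \<forall>t\<in>{0..1}.
        ((\<lambda>s. \<Phi> s x) has_vector_derivative X t (\<Phi> t x)) (at t within {0..1}))"

subsection \<open>Vector fields and the Lie algebra of a group of diffeomorphism germs\<close>

definition lie_bracket ::
  "('a::real_normed_vector \<Rightarrow> 'a) \<Rightarrow> ('a \<Rightarrow> 'a) \<Rightarrow> 'a \<Rightarrow> 'a" where
  "lie_bracket X Y x = frechet_derivative Y (at x) (X x) - frechet_derivative X (at x) (Y x)"

text \<open>
  \<open>L\<close> is a set of germs. Since the families are parametrised by a real interval, \<open>L\<close> is only
  required to be a Lie algebra over the reals; this includes the Lie algebras over \<open>'k\<close>.
\<close>

definition lie_algebra_of_vector_fields ::
  "regularity \<Rightarrow> ('k::real_normed_field ^ 'n \<Rightarrow> 'k ^ 'n) set set \<Rightarrow> bool" where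
  "lie_algebra_of_vector_fields reg L \<longleftrightarrow>
     (\<forall>A\<in>L. \<exists>X. A = germ X \<and> smooth_map_germ reg X \<and> X 0 = 0) \<and>
     germ (\<lambda>x. 0) \<in> L \<and>
     (\<forall>X Y. germ X \<in> L \<longrightarrow> germ Y \<in> L \<longrightarrow> germ (\<lambda>x. X x + Y x) \<in> L) \<and>
     (\<forall>(c::real) X. germ X \<in> L \<longrightarrow> germ (\<lambda>x. c *\<^sub>R X x) \<in> L) \<and>
     (\<forall>X Y. germ X \<in> L \<longrightarrow> germ Y \<in> L \<longrightarrow> germ (lie_bracket X Y) \<in> L)"

text \<open>
  \<open>L\<close> is the Lie algebra of \<open>H\<close>: the smooth families in \<open>H\<close> starting at the identity are exactly
  the solutions of \<open>d/dt \<Phi>\<^sub>t = X\<^sub>t \<circ> \<Phi>\<^sub>t\<close>, \<open>\<Phi>\<^sub>0 = Id\<close>, for smooth families \<open>X\<^sub>t\<close> in \<open>L\<close>.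
\<close>

definition is_lie_algebra_of ::
  "regularity \<Rightarrow> ('k::real_normed_field ^ 'n \<Rightarrow> 'k ^ 'n) set set \<Rightarrow> ('k ^ 'n \<Rightarrow> 'k ^ 'n) set set \<Rightarrow> bool" where
  "is_lie_algebra_of reg L H \<longleftrightarrow>
     lie_algebra_of_vector_fields reg L \<and>
     (\<forall>\<Phi>. smooth_family reg \<Phi> \<longrightarrow> germ (\<Phi> 0) = germ (\<lambda>x. x) \<longrightarrow>
        ((\<forall>t\<in>{0..1}. germ (\<Phi> t) \<in> H) \<longleftrightarrow>
         (\<exists>X. smooth_family reg X \<and> (\<forall>t\<in>{0..1}. germ (X t) \<in> L) \<and> flow_equation X \<Phi>)))"

definition euler_field :: "('n \<Rightarrow> int) \<Rightarrow> 'k::real_normed_field ^ 'n \<Rightarrow> 'k ^ 'n" where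
  "euler_field w x = (\<chi> i. of_int (w i) * x $ i)"

text \<open>\<open>\<psi>\<^sub>* X = Y\<close> near the origin for some diffeomorphism germ \<open>\<psi>\<close>.\<close>

definition locally_diffeomorphic ::
  "regularity \<Rightarrow> ('k::real_normed_field ^ 'n \<Rightarrow> 'k ^ 'n) \<Rightarrow> ('k ^ 'n \<Rightarrow> 'k ^ 'n) \<Rightarrow> bool" where
  "locally_diffeomorphic reg X Y \<longleftrightarrow>
     (\<exists>\<psi>. diffeo_germ reg \<psi> \<and> (\<forall>\<^sub>F x in nhds 0. frechet_derivative \<psi> (at x) (X x) = Y (\<psi> x)))"

subsection \<open>Volume forms\<close>

text \<open>
  A form of top degree at a point takes \<open>q\<close> tangent vectors, given as a family indexed by \<open>'n\<close>.
\<close>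

definition alternating_multilinear :: "(('n \<Rightarrow> 'k::field ^ 'n) \<Rightarrow> 'k) \<Rightarrow> bool" where
  "alternating_multilinear \<alpha> \<longleftrightarrow>
     (\<forall>v i. Vector_Spaces.linear (*s) (*) (\<lambda>u. \<alpha> (v(i := u)))) \<and>
     (\<forall>v i j. i \<noteq> j \<longrightarrow> v i = v j \<longrightarrow> \<alpha> v = 0)"

definition volume_form_germ ::
  "regularity \<Rightarrow> ('k::real_normed_field ^ 'n \<Rightarrow> ('n \<Rightarrow> 'k ^ 'n) \<Rightarrow> 'k) \<Rightarrow> bool" where
  "volume_form_germ reg \<Omega> \<longleftrightarrow>
     (\<forall>\<^sub>F x in nhds 0. alternating_multilinear (\<Omega> x) \<and> (\<exists>v. \<Omega> x v \<noteq> 0)) \<and>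
     (\<forall>v. smooth_germ reg (\<lambda>x. \<Omega> x v))"

definition pullback_form ::
  "('k::real_normed_field ^ 'n \<Rightarrow> 'k ^ 'n) \<Rightarrow>
   ('k ^ 'n \<Rightarrow> ('n \<Rightarrow> 'k ^ 'n) \<Rightarrow> 'k) \<Rightarrow> ('k ^ 'n \<Rightarrow> ('n \<Rightarrow> 'k ^ 'n) \<Rightarrow> 'k)" where
  "pullback_form \<phi> \<Omega> x v = \<Omega> (\<phi> x) (\<lambda>i. frechet_derivative \<phi> (at x) (v i))"

text \<open>The same frames are positively oriented.\<close>

definition same_orientation ::
  "(real ^ 'n \<Rightarrow> ('n \<Rightarrow> real ^ 'n) \<Rightarrow> real) \<Rightarrow> (real ^ 'n \<Rightarrow> ('n \<Rightarrow> real ^ 'n) \<Rightarrow> real) \<Rightarrow> bool" where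
  "same_orientation \<Omega>\<^sub>0 \<Omega>\<^sub>1 \<longleftrightarrow> (\<forall>\<^sub>F x in nhds 0. \<forall>v. 0 < \<Omega>\<^sub>0 x v \<longleftrightarrow> 0 < \<Omega>\<^sub>1 x v)"

definition isotopic ::
  "regularity \<Rightarrow> ('k::real_normed_field ^ 'n \<Rightarrow> 'k ^ 'n) set set \<Rightarrow>
   ('k ^ 'n \<Rightarrow> ('n \<Rightarrow> 'k ^ 'n) \<Rightarrow> 'k) \<Rightarrow> ('k ^ 'n \<Rightarrow> ('n \<Rightarrow> 'k ^ 'n) \<Rightarrow> 'k) \<Rightarrow> bool" where
  "isotopic reg H \<Omega>\<^sub>0 \<Omega>\<^sub>1 \<longleftrightarrow>
     (\<exists>\<Phi>. smooth_family reg \<Phi> \<and> (\<forall>t\<in>{0..1}. germ (\<Phi> t) \<in> H) \<and>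
          germ (\<Phi> 0) = germ (\<lambda>x. x) \<and> germ (pullback_form (\<Phi> 1) \<Omega>\<^sub>1) = germ \<Omega>\<^sub>0)"

end

theory Submission
  imports Defs "HOL-Complex_Analysis.Cauchy_Integral_Formula"
begin

text \<open>
  The isotopy is found without integrating a time-dependent vector field. In coordinates in which
  \<open>X\<close> is the Euler field \<open>E = \<Sum>\<^sub>i w\<^sub>i y\<^sub>i \<partial>/\<partial>y\<^sub>i\<close>, the flow of \<open>X\<close> is explicit,
  \<open>y \<mapsto> (e\<^bsup>w\<^sub>i \<tau>\<^esup> y\<^sub>i)\<^sub>i\<close>, and every isotopy that moves points along the orbits of \<open>X\<close> arises by
  letting the time \<open>\<tau>\<close> depend on the point. So one looks for a single function \<open>h\<close> and takes
  \<open>\<Phi>\<^sub>t(y) = (e\<^bsup>w\<^sub>i t h(y)\<^esup> y\<^sub>i)\<^sub>i\<close>. It runs along \<open>X\<close> with speed \<open>h(y)\<close>, which must be rewritten as a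
  function \<open>f\<^sub>t\<close> of the point that has been reached; then \<open>X\<^sub>t = f\<^sub>t X\<close> lies in \<open>C\<^sub>q \<cdot> X \<subseteq> LH\<close>, and the
  description of \<open>LH\<close> puts \<open>\<Phi>\<^sub>t\<close> into \<open>H\<close>.

  The condition \<open>\<Phi>\<^sub>1\<^sup>*\<Omega>\<^sub>1 = \<Omega>\<^sub>0\<close> is a first order differential equation for \<open>h\<close>, but it can be
  integrated. Let \<open>W = \<Sum>\<^sub>i w\<^sub>i > 0\<close> and let \<open>\<Omega>\<^sub>k = g\<^sub>k dy\<close>. The form \<open>g\<^sub>k dy\<close> has the primitive
  \<open>G\<^sub>k \<iota>\<^sub>E dy\<close> as soon as \<open>W G\<^sub>k + E G\<^sub>k = g\<^sub>k\<close>, an equation solved by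
  \<open>G\<^sub>k(y) = \<integral>\<^sub>0\<^sup>1 s\<^bsup>W-1\<^esup> g\<^sub>k(s\<^bsup>w\<^sub>i\<^esup> y\<^sub>i) ds\<close> (\<open>weighted_primitive\<close>). Since \<open>\<iota>\<^sub>E dy\<close> is multiplied by
  \<open>e\<^bsup>W h\<^esup>\<close> under \<open>\<Phi>\<^sub>1\<close>, it suffices to solve the equation \<open>e\<^bsup>W h\<^esup> G\<^sub>1(e\<^bsup>w\<^sub>i h\<^esup> y\<^sub>i) = G\<^sub>0(y)\<close>, which
  contains no derivatives of \<open>h\<close>. Its derivative with respect to \<open>h\<close> at the origin is
  \<open>W e\<^bsup>W h\<^esup> G\<^sub>1(0) \<noteq> 0\<close>, so the implicit function theorem applies (\<open>volume_equation_solution\<close>), provided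
  that \<open>g\<^sub>0(0)/g\<^sub>1(0)\<close> is an exponential: over \<open>\<real>\<close> this is the hypothesis on orientations.
  Applying \<open>W + E\<close> to both sides recovers the condition on the forms
  (\<open>linearised_volume_equation\<close>). The function \<open>f\<^sub>t\<close> is given by another implicit equation,
  \<open>f = h(e\<^bsup>-w\<^sub>i t f\<^esup> y\<^sub>i)\<close>, which at \<open>y = 0\<close> is solved by \<open>f = h(0)\<close> for all \<open>t\<close> at once
  (\<open>flow_time_in_target_coordinates\<close>).

  What is needed of smooth germs is thus closure under composition, differentiation, solution of
  scalar implicit equations and the weighted primitive. The locale \<open>scalar_regularity\<close> proves
  this simultaneously for the three cases. In the \<open>C_infinity\<close> case it is calculus of \<open>Ck_on\<close>. In the
  two analytic cases a function has power series expansions if and only if it extends to a function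
  that is complex differentiable on a neighbourhood in complex space, and for complex differentiable functions
  the closure properties follow from the rules of calculus. That equivalence is the content of
  \<open>sep_hol_on_imp_power_series\<close> (a lemma of Osgood) and \<open>power_series_has_derivative\<close>.
\<close>

section \<open>Separately holomorphic functions\<close>

definition set_coord :: "'a ^ 'm \<Rightarrow> 'm \<Rightarrow> 'a \<Rightarrow> 'a ^ 'm" where
  "set_coord x j z = (\<chi> i. if i = j then z else x $ i)"

lemma set_coord_nth: "set_coord x j z $ i = (if i = j then z else x $ i)"
  by (simp add: set_coord_def)

lemma set_coord_same [simp]: "set_coord x j (x $ j) = x"
  by (simp add: vec_eq_iff set_coord_nth)

lemma set_coord_set_coord [simp]: "set_coord (set_coord x j z) j z' = set_coord x j z'"
  by (simp add: vec_eq_iff set_coord_nth)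

lemma set_coord_commute: "i \<noteq> j \<Longrightarrow> set_coord (set_coord x j z) i z' = set_coord (set_coord x i z') j z"
  by (auto simp add: vec_eq_iff set_coord_nth)

lemma set_coord_eq_add_axis: "set_coord x j (z :: 'a::ab_group_add) = x + axis j (z - x $ j)"
  by (auto simp add: vec_eq_iff set_coord_nth axis_def)

lemma norm_axis_eq: "norm (axis j (z :: 'a::real_normed_vector)) = norm z"
proof -
  have "norm (axis j z :: 'a ^ 'b) \<le> norm z"
    by (simp add: norm_vec_def axis_def L2_set_def if_distrib[of norm] if_distrib[of "\<lambda>x. x ^ 2"] sum.delta cong: if_cong)
  moreover have "norm z \<le> norm (axis j z :: 'a ^ 'b)"
    using Finite_Cartesian_Product.norm_nth_le[of "axis j z :: 'a ^ 'b" j] by simp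
  ultimately show ?thesis by simp
qed

lemma dist_set_coord: "dist (set_coord x j (z :: 'a::real_normed_vector)) x = norm (z - x $ j)"
  by (simp add: set_coord_eq_add_axis dist_norm norm_axis_eq)

lemma axis_add: "axis j (a + b) = axis j a + axis j (b::'a::monoid_add)"
  by (auto simp: axis_def vec_eq_iff)

lemma axis_scaleR: "axis j (c *\<^sub>R b) = c *\<^sub>R axis j (b::'a::real_vector)"
  by (auto simp: axis_def vec_eq_iff)

lemma axis_smult: "axis j (c * b) = c *s axis j (b::'a::semiring_1)"
  by (auto simp: axis_def vec_eq_iff)

lemma bounded_linear_axis: "bounded_linear (axis j :: 'a::real_normed_vector \<Rightarrow> 'a ^ 'm)"
  by (rule bounded_linear_intro[where K = 1]) (auto simp: axis_add axis_scaleR norm_axis_eq)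

lemma continuous_on_set_coord [continuous_intros]:
  fixes f :: "'c::topological_space \<Rightarrow> 'a::real_normed_vector ^ 'm"
  shows "continuous_on S f \<Longrightarrow> continuous_on S g \<Longrightarrow> continuous_on S (\<lambda>x. set_coord (f x) j (g x))"
  unfolding set_coord_def
proof (intro continuous_on_vec_lambda)
  fix i assume "continuous_on S f" "continuous_on S g"
  then show "continuous_on S (\<lambda>x. if i = j then g x else f x $ i)"
    by (cases "i = j") (auto intro!: continuous_intros)
qed

lemma vec_eq_sum_axis: "(v :: 'k::semiring_1 ^ 'm) = (\<Sum>j\<in>UNIV. v $ j *s axis j 1)"
  by (auto simp: vec_eq_iff sum_component axis_def if_distrib cong: if_cong)

text \<open>
  Complex differentiability in all variables jointly. The real derivative is asked to be
  homogeneous over the complex numbers, which makes chain rules and real differentiability directly usable.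
\<close>

definition hol_on :: "(complex ^ 'm \<Rightarrow> complex) \<Rightarrow> (complex ^ 'm) set \<Rightarrow> bool" where
  "hol_on F U \<longleftrightarrow> (\<forall>x\<in>U. \<exists>D. (F has_derivative D) (at x) \<and> (\<forall>c v. D (c *s v) = c * D v))"

text \<open>
  The notion for which limits are easy: holomorphy in each variable survives locally uniform
  convergence by the one-variable theorem.
\<close>

definition sep_hol_on :: "(complex ^ 'm \<Rightarrow> complex) \<Rightarrow> (complex ^ 'm) set \<Rightarrow> bool" where
  "sep_hol_on F U \<longleftrightarrow> continuous_on U F \<and>
     (\<forall>x\<in>U. \<forall>j. (\<lambda>z. F (set_coord x j z)) field_differentiable at (x $ j))"

definition partial :: "'m \<Rightarrow> (complex ^ 'm \<Rightarrow> complex) \<Rightarrow> complex ^ 'm \<Rightarrow> complex" where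
  "partial j F x = deriv (\<lambda>z. F (set_coord x j z)) (x $ j)"

lemma slice_has_field_derivative:
  assumes D: "(F has_derivative D) (at x)" "\<And>c v. D (c *s v) = c * D v"
  shows "((\<lambda>z. F (set_coord x j z)) has_field_derivative D (axis j 1)) (at (x $ j))"
proof -
  have "((\<lambda>z. set_coord x j z) has_derivative (\<lambda>h. axis j h)) (at (x $ j))"
    unfolding set_coord_eq_add_axis
    by (rule derivative_eq_intros bounded_linear.has_derivative[OF bounded_linear_axis] refl)+ auto
  moreover have "(F has_derivative D) (at (set_coord x j (x $ j)))"
    using D by simp
  ultimately have "((\<lambda>z. F (set_coord x j z)) has_derivative (\<lambda>h. D (axis j h))) (at (x $ j))"
    by (rule has_derivative_compose)
  moreover have "(\<lambda>h. D (axis j h)) = (*) (D (axis j 1))"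
  proof
    show "D (axis j h) = D (axis j 1) * h" for h
      using D(2)[of h "axis j 1"] axis_smult[of j h 1] by (metis mult.commute mult.right_neutral)
  qed
  ultimately show ?thesis
    unfolding has_field_derivative_def by (simp only:)
qed

lemma hol_on_imp_sep_hol_on:
  assumes "hol_on F U"
  shows "sep_hol_on F U"
  unfolding sep_hol_on_def
proof (intro conjI ballI allI)
  show "continuous_on U F"
    using assms unfolding hol_on_def
    by (meson continuous_at_imp_continuous_on has_derivative_continuous)
  fix x j assume "x \<in> U"
  then obtain D where "(F has_derivative D) (at x)" "\<And>c v. D (c *s v) = c * D v"
    using assms unfolding hol_on_def by blast
  then show "(\<lambda>z. F (set_coord x j z)) field_differentiable at (x $ j)"
    using slice_has_field_derivative field_differentiable_def by blast
qed

lemma hol_on_derivative_eq_partial: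
  fixes v :: "complex ^ 'm"
  assumes D: "(F has_derivative D) (at x)" "\<And>c v. D (c *s v) = c * D v"
  shows "D v = (\<Sum>j\<in>UNIV. v $ j * partial j F x)"
proof -
  have "partial j F x = D (axis j 1)" for j
    unfolding partial_def by (rule DERIV_imp_deriv slice_has_field_derivative[OF D])+
  moreover have "D v = (\<Sum>j\<in>UNIV. D (v $ j *s axis j 1))"
    using vec_eq_sum_axis[of v] linear_sum[OF has_derivative_linear[OF D(1)]] by metis
  ultimately show ?thesis by (simp add: D(2))
qed

lemma sep_hol_on_slice:
  assumes "sep_hol_on F U" "\<And>z. z \<in> S \<Longrightarrow> set_coord y i z \<in> U"
  shows "(\<lambda>z. F (set_coord y i z)) holomorphic_on S"
  unfolding holomorphic_on_def
proof
  fix z assume "z \<in> S"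
  then have "(\<lambda>z'. F (set_coord (set_coord y i z) i z')) field_differentiable at (set_coord y i z $ i)"
    using assms unfolding sep_hol_on_def by blast
  then show "(\<lambda>z. F (set_coord y i z)) field_differentiable at z within S"
    by (simp add: set_coord_nth field_differentiable_at_within)
qed

text \<open>
  Second derivatives along a coordinate are bounded on a small ball, by Cauchy's inequality on
  discs inside a larger ball; hence the error in the first order Taylor formula is uniform.
\<close>

lemma difference_quotient_uniform_limit:
  fixes F :: "complex ^ 'm \<Rightarrow> complex"
  assumes F: "sep_hol_on F U" and U: "open U" "x0 \<in> U"
  obtains r where "0 < r" "cball x0 (2 * r) \<subseteq> U"
    "uniform_limit (cball x0 r)
       (\<lambda>n x. (F (x + axis j (1 / of_nat (Suc n))) - F x) * of_nat (Suc n)) (partial j F) sequentially"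
proof -
  obtain R where R: "0 < R" "cball x0 R \<subseteq> U"
    using U open_contains_cball_eq by blast
  \<comment> \<open>A ball of radius \<open>r\<close> for the base points, and room \<open>2 r\<close> for discs around their coordinates.\<close>
  define r where "r = R / 3"
  have r: "0 < r" "R = 3 * r" using R by (auto simp: r_def)
  have "compact (F ` cball x0 R)"
    using F R unfolding sep_hol_on_def
    by (meson compact_cball compact_continuous_image continuous_on_subset)
  then obtain M where M: "\<And>x. x \<in> cball x0 R \<Longrightarrow> norm (F x) \<le> M"
    using compact_imp_bounded bounded_iff by (metis imageI)
  define B where "B = fact 2 * M / r ^ 2"
  have B0: "0 \<le> B"
    using order_trans[OF norm_ge_zero M[of x0]] R by (simp add: B_def)
  have bound: "norm ((F (x + axis j h) - F x) / h - partial j F x) \<le> B * norm h"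
    if x: "x \<in> cball x0 r" and h: "h \<noteq> 0" "norm h \<le> r" for x h
  proof -
    let ?\<phi> = "\<lambda>z. F (set_coord x j z)"
    have mem: "set_coord x j z \<in> cball x0 R" if "z \<in> cball (x $ j) (2 * r)" for z
    proof -
      have "dist (set_coord x j z) x0 \<le> dist (set_coord x j z) x + dist x x0" by (rule dist_triangle)
      also have "\<dots> \<le> 2 * r + r"
        using that x by (intro add_mono) (metis dist_set_coord dist_norm dist_commute mem_cball)+
      finally show ?thesis by (simp add: r dist_commute)
    qed
    have hol: "?\<phi> holomorphic_on cball (x $ j) (2 * r)"
      using mem R by (intro sep_hol_on_slice[OF F]) auto
    have holb: "?\<phi> holomorphic_on ball (x $ j) (2 * r)"
      by (rule holomorphic_on_subset[OF hol]) auto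
    have sub: "z \<in> cball (x $ j) (2 * r)" if "dist y z \<le> r" "y \<in> cball (x $ j) r" for y z
      using that dist_triangle[of "x $ j" z y] by auto
    have sub': "y \<in> ball (x $ j) (2 * r)" if "y \<in> cball (x $ j) r" for y
      using that r by auto
    have d2: "norm ((deriv ^^ 2) ?\<phi> y) \<le> B" if y: "y \<in> cball (x $ j) r" for y
      unfolding B_def
    proof (rule Cauchy_inequality)
      show "?\<phi> holomorphic_on ball y r"
        by (rule holomorphic_on_subset[OF hol]) (use sub[OF less_imp_le] sub y in force)
      show "continuous_on (cball y r) ?\<phi>"
        by (rule continuous_on_subset[OF holomorphic_on_imp_continuous_on[OF hol]]) (use sub[OF less_imp_le] sub y in force)
      show "norm (?\<phi> z) \<le> M" if "norm (y - z) = r" for z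
        by (rule M[OF mem]) (use that y sub[of y z] in \<open>auto simp: dist_norm\<close>)
    qed (use r in auto)
    have "cmod ((deriv ^^ 0) ?\<phi> (x $ j + h) - (\<Sum>i\<le>1. (deriv ^^ i) ?\<phi> (x $ j) * (x $ j + h - x $ j) ^ i / fact i))
        \<le> B * cmod (x $ j + h - x $ j) ^ Suc 1 / fact 1"
    proof (rule complex_Taylor[of "cball (x $ j) r"])
      show "((deriv ^^ i) ?\<phi> has_field_derivative (deriv ^^ Suc i) ?\<phi> z) (at z within cball (x $ j) r)"
        if "z \<in> cball (x $ j) r" for i z
        using has_field_derivative_higher_deriv[OF holb open_ball sub'[OF that]]
        by (rule has_field_derivative_at_within)
    qed (use h r d2 in \<open>auto simp: dist_norm numeral_2_eq_2\<close>)
    then have "norm (?\<phi> (x $ j + h) - F x - partial j F x * h) \<le> B * norm h ^ 2"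
      by (simp add: partial_def power2_eq_square algebra_simps)
    moreover have "?\<phi> (x $ j + h) = F (x + axis j h)"
      by (simp add: set_coord_eq_add_axis)
    moreover have "(F (x + axis j h) - F x) / h - partial j F x = (F (x + axis j h) - F x - partial j F x * h) / h"
      using h by (simp add: field_simps)
    ultimately show ?thesis
      using h by (simp add: norm_divide divide_le_eq power2_eq_square)
  qed
  have "uniform_limit (cball x0 r)
       (\<lambda>n x. (F (x + axis j (1 / of_nat (Suc n))) - F x) * of_nat (Suc n)) (partial j F) sequentially"
  proof (rule uniform_limitI)
    fix e :: real assume e: "0 < e"
    have "(\<lambda>n. B * inverse (real (Suc n))) \<longlonglongrightarrow> B * 0"
      by (intro tendsto_intros LIMSEQ_inverse_real_of_nat)
    then have "\<forall>\<^sub>F n in sequentially. B * inverse (real (Suc n)) < e"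
      using e by (intro order_tendstoD(2)) auto
    moreover have "\<forall>\<^sub>F n in sequentially. inverse (real (Suc n)) < r"
      using r LIMSEQ_inverse_real_of_nat by (intro order_tendstoD(2)) auto
    ultimately show "\<forall>\<^sub>F n in sequentially. \<forall>x\<in>cball x0 r.
        dist ((F (x + axis j (1 / of_nat (Suc n))) - F x) * of_nat (Suc n)) (partial j F x) < e"
    proof eventually_elim
      case (elim n)
      show ?case
      proof
        fix x assume x: "x \<in> cball x0 r"
        have n: "norm (1 / of_nat (Suc n) :: complex) = inverse (real (Suc n))"
          by (simp add: norm_divide inverse_eq_divide del: of_nat_Suc)
        have "norm ((F (x + axis j (1 / of_nat (Suc n))) - F x) / (1 / of_nat (Suc n)) - partial j F x)
           \<le> B * norm (1 / of_nat (Suc n) :: complex)"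
          using elim x n by (intro bound) (auto simp del: of_nat_Suc)
        then show "dist ((F (x + axis j (1 / of_nat (Suc n))) - F x) * of_nat (Suc n)) (partial j F x) < e"
          using elim unfolding n by (simp add: dist_norm del: of_nat_Suc)
      qed
    qed
  qed
  moreover have "cball x0 (2 * r) \<subseteq> U"
    using R r by (auto intro: order_trans)
  ultimately show ?thesis using that r by blast
qed

text \<open>
  Both continuity and holomorphy in a coordinate (the same as that of the derivative or another one)
  pass from the difference quotients to their locally uniform limit.
\<close>

lemma sep_hol_on_partial:
  fixes F :: "complex ^ 'm \<Rightarrow> complex"
  assumes F: "sep_hol_on F U" and U: "open U"
  shows "sep_hol_on (partial j F) U"
  unfolding sep_hol_on_def
proof (intro conjI ballI allI)
  have main: "isCont (partial j F) x0 \<and> (\<lambda>z. partial j F (set_coord x0 i z)) field_differentiable at (x0 $ i)"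
    if x0: "x0 \<in> U" for x0 i
  proof -
    define q where "q = (\<lambda>n x. (F (x + axis j (1 / of_nat (Suc n))) - F x) * of_nat (Suc n))"
    obtain r where r: "0 < r" "cball x0 (2 * r) \<subseteq> U"
      and ul: "uniform_limit (cball x0 r) q (partial j F) sequentially"
      unfolding q_def by (rule difference_quotient_uniform_limit[OF F U x0])
    have ev: "\<forall>\<^sub>F n in sequentially. inverse (real (Suc n)) < r"
      using r LIMSEQ_inverse_real_of_nat by (intro order_tendstoD(2)) auto
    have mem: "x \<in> U" "x + axis j (1 / of_nat (Suc n)) \<in> U"
      if x: "x \<in> cball x0 r" and n: "inverse (real (Suc n)) < r" for x n
    proof -
      show "x \<in> U" using x r by (auto intro!: subsetD[OF r(2)])
      have "dist x0 (x + axis j (1 / of_nat (Suc n))) \<le> dist x0 x + dist x (x + axis j (1 / of_nat (Suc n)))"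
        by (rule dist_triangle)
      also have "\<dots> \<le> r + inverse (real (Suc n))"
        using x by (simp add: dist_norm norm_axis_eq norm_divide inverse_eq_divide del: of_nat_Suc)
      finally show "x + axis j (1 / of_nat (Suc n)) \<in> U"
        using n by (intro subsetD[OF r(2)]) auto
    qed
    have contF: "continuous_on U F" using F by (simp add: sep_hol_on_def)
    have "\<forall>\<^sub>F n in sequentially. continuous_on (cball x0 r) (q n)"
      using ev
    proof eventually_elim
      case (elim n)
      show ?case unfolding q_def
      proof (intro continuous_on_mult continuous_on_diff continuous_on_const)
        show "continuous_on (cball x0 r) F"
          by (rule continuous_on_subset[OF contF]) (use mem(1)[OF _ elim] in blast)
        show "continuous_on (cball x0 r) (\<lambda>x. F (x + axis j (1 / of_nat (Suc n))))"
        proof (rule continuous_on_compose2[OF contF])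
          show "continuous_on (cball x0 r) (\<lambda>x. x + axis j (1 / of_nat (Suc n)))"
            by (rule continuous_on_add continuous_on_id continuous_on_const)+
          show "(\<lambda>x. x + axis j (1 / of_nat (Suc n))) ` cball x0 r \<subseteq> U"
            using mem(2)[OF _ elim] by (rule image_subsetI)
        qed
      qed
    qed
    then have "continuous_on (cball x0 r) (partial j F)"
      using ul by (intro uniform_limit_theorem[OF _ ul]) auto
    then have 1: "isCont (partial j F) x0"
      using r by (metis centre_in_ball continuous_on_interior interior_cball)
    have inb: "set_coord x0 i z \<in> cball x0 r" if "z \<in> cball (x0 $ i) r" for z
      using that dist_set_coord[of x0 i z] by (simp add: dist_commute dist_norm norm_minus_commute)
    have ul2: "uniform_limit (cball (x0 $ i) r) (\<lambda>n z. q n (set_coord x0 i z)) (\<lambda>z. partial j F (set_coord x0 i z)) sequentially"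
      by (rule uniform_limit_compose'[OF ul]) (use inb in auto)
    have ev2: "\<forall>\<^sub>F n in sequentially. continuous_on (cball (x0 $ i) r) (\<lambda>z. q n (set_coord x0 i z)) \<and>
        (\<lambda>z. q n (set_coord x0 i z)) holomorphic_on ball (x0 $ i) r"
      using ev
    proof eventually_elim
      case (elim n)
      define h :: complex where "h = 1 / of_nat (Suc n)"
      define d where "d = (if i = j then h else 0)"
      have eq: "set_coord x0 i z + axis j h = set_coord (x0 + axis j h) i (z + d)" for z
        by (auto simp: vec_eq_iff set_coord_nth axis_def d_def)
      have "(\<lambda>z. F (set_coord x0 i z)) holomorphic_on cball (x0 $ i) r"
        by (rule sep_hol_on_slice[OF F]) (use mem inb elim in blast)
      moreover have "(\<lambda>z. F (set_coord (x0 + axis j h) i z)) holomorphic_on ((\<lambda>z. z + d) ` cball (x0 $ i) r)"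
      proof (rule sep_hol_on_slice[OF F])
        fix z assume "z \<in> (\<lambda>z. z + d) ` cball (x0 $ i) r"
        then obtain z' where "z' \<in> cball (x0 $ i) r" "z = z' + d" by blast
        then show "set_coord (x0 + axis j h) i z \<in> U"
          using mem(2)[OF inb elim, of z'] eq[of z'] by (simp add: h_def)
      qed
      then have "(\<lambda>z. F (set_coord (x0 + axis j h) i (z + d))) holomorphic_on cball (x0 $ i) r"
        using holomorphic_on_compose[of "\<lambda>z. z + d" "cball (x0 $ i) r" "\<lambda>z. F (set_coord (x0 + axis j h) i z)"]
        by (simp add: o_def holomorphic_intros)
      ultimately have "(\<lambda>z. q n (set_coord x0 i z)) holomorphic_on cball (x0 $ i) r"
        unfolding q_def h_def[symmetric] eq by (intro holomorphic_intros)
      then show ?case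
        using holomorphic_on_imp_continuous_on holomorphic_on_subset ball_subset_cball by blast
    qed
    have "(\<lambda>z. partial j F (set_coord x0 i z)) holomorphic_on ball (x0 $ i) r"
      by (rule holomorphic_uniform_limit[OF ev2 ul2 trivial_limit_sequentially])
    then show ?thesis
      using 1 r by (auto intro: holomorphic_on_imp_differentiable_at)
  qed
  show "continuous_on U (partial j F)"
    using main by (simp add: continuous_at_imp_continuous_on)
  show "(\<lambda>z. partial j F (set_coord x i z)) field_differentiable at (x $ i)" if "x \<in> U" for x i
    using main[OF that] by blast
qed

lemma funpow_partial_set_coord:
  "(partial j ^^ k) F (set_coord x j z) = (deriv ^^ k) (\<lambda>z. F (set_coord x j z)) z"
proof (induction k arbitrary: z)
  case (Suc k)
  have "(partial j ^^ Suc k) F (set_coord x j z) = deriv (\<lambda>z'. (partial j ^^ k) F (set_coord x j z')) z"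
    by (simp add: partial_def set_coord_nth)
  also have "\<dots> = deriv (\<lambda>z'. (deriv ^^ k) (\<lambda>z. F (set_coord x j z)) z') z"
    by (simp only: Suc.IH)
  finally show ?case by simp
qed simp

lemma sep_hol_on_funpow_partial:
  "sep_hol_on F U \<Longrightarrow> open U \<Longrightarrow> sep_hol_on ((partial j ^^ k) F) U"
  by (induction k) (auto intro: sep_hol_on_partial)

section \<open>Power series expansion of separately holomorphic functions\<close>

text \<open>
  Splits off one exponent of a multi-index; sums over multi-indices are handled by
  induction along this bijection.
\<close>

lemma bij_betw_exponent_update:
  "bij_betw (\<lambda>(k, \<beta>). \<beta>(j := k)) (UNIV \<times> {\<beta>. \<forall>i. i \<notin> S \<longrightarrow> \<beta> i = (0::nat)}) {\<alpha>. \<forall>i. i \<notin> insert j S \<longrightarrow> \<alpha> i = 0}"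
  if "j \<notin> S"
  by (rule bij_betwI[where g = "\<lambda>\<alpha>. (\<alpha> j, \<alpha>(j := 0))"]) (use that in \<open>auto simp: fun_eq_iff\<close>)

lemma summable_geometric_multi:
  fixes q :: "'m \<Rightarrow> real"
  assumes "finite S" "\<And>i. 0 \<le> q i" "\<And>i. q i < 1"
  shows "(\<lambda>\<alpha>. \<Prod>i\<in>S. q i ^ \<alpha> i) summable_on {\<alpha>. \<forall>i. i \<notin> S \<longrightarrow> \<alpha> i = (0::nat)}"
  using assms(1)
proof (induction S)
  case empty
  have "{\<alpha>. \<forall>i. i \<notin> {} \<longrightarrow> \<alpha> i = (0::nat)} = {\<lambda>i::'m. 0}" by auto
  then show ?case by simp
next
  case (insert j S)
  let ?A = "{\<beta>. \<forall>i. i \<notin> S \<longrightarrow> \<beta> i = (0::nat)}"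
  obtain s where s: "((\<lambda>\<alpha>. \<Prod>i\<in>S. q i ^ \<alpha> i) has_sum s) ?A"
    using insert.IH by (auto simp: summable_on_def)
  have geo: "(\<lambda>k. q j ^ k) summable_on UNIV"
    using assms(2,3)[of j] by (intro norm_summable_imp_summable_on) (auto intro: summable_geometric)
  have "(\<lambda>p. q j ^ fst p * (\<Prod>i\<in>S. q i ^ snd p i)) summable_on (UNIV \<times> ?A)"
  proof (rule summable_on_SigmaI)
    show "((\<lambda>y. q j ^ fst (x, y) * (\<Prod>i\<in>S. q i ^ snd (x, y) i)) has_sum q j ^ x * s) ?A" for x
      using has_sum_cmult_right[OF s, of "q j ^ x"] by simp
    show "(\<lambda>x. q j ^ x * s) summable_on UNIV"
      by (rule summable_on_cmult_left[OF geo])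
  qed (use assms in \<open>auto intro!: mult_nonneg_nonneg prod_nonneg\<close>)
  also have "?this \<longleftrightarrow> (\<lambda>p. \<Prod>i\<in>insert j S. q i ^ (case p of (k, \<beta>) \<Rightarrow> \<beta>(j := k)) i) summable_on (UNIV \<times> ?A)"
  proof (rule summable_on_cong)
    fix p :: "nat \<times> ('m \<Rightarrow> nat)"
    have "(\<Prod>i\<in>S. q i ^ (if i = j then fst p else snd p i)) = (\<Prod>i\<in>S. q i ^ snd p i)"
      by (rule prod.cong) (use insert.hyps in auto)
    then show "q j ^ fst p * (\<Prod>i\<in>S. q i ^ snd p i) = (\<Prod>i\<in>insert j S. q i ^ (case p of (k, \<beta>) \<Rightarrow> \<beta>(j := k)) i)"
      using insert.hyps by (simp add: case_prod_beta fun_upd_def)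
  qed
  also have "\<dots> \<longleftrightarrow> (\<lambda>\<alpha>. \<Prod>i\<in>insert j S. q i ^ \<alpha> i) summable_on {\<alpha>. \<forall>i. i \<notin> insert j S \<longrightarrow> \<alpha> i = 0}"
    by (rule summable_on_reindex_bij_betw[OF bij_betw_exponent_update[OF insert.hyps(2)]])
  finally show ?case .
qed

lemma open_polydisc: "open {x :: 'a::real_normed_vector ^ 'm. \<forall>i. norm (x $ i) < R}"
proof -
  have "open (\<Inter>i. {x :: 'a ^ 'm. norm (x $ i) < R})"
    by (intro open_INT ballI open_Collect_less continuous_intros) auto
  also have "(\<Inter>i. {x :: 'a ^ 'm. norm (x $ i) < R}) = {x. \<forall>i. norm (x $ i) < R}" by auto
  finally show ?thesis .
qed

text \<open>
  Induction over the set \<open>S\<close> of coordinates on which \<open>F\<close> depends. For a new coordinate \<open>j\<close>, the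
  one-variable expansion in \<open>x\<^sub>j\<close> has coefficients \<open>T\<^sub>k\<close> that depend on the coordinates in \<open>S\<close> only, are again separately
  holomorphic because they are values of iterated partial derivatives, and are bounded by \<open>M / \<rho>\<^sup>k\<close> by
  Cauchy's inequality. The product bound on the coefficients is part of the claim because it makes
  the resulting double series absolutely convergent.
\<close>

lemma power_series_on_polydisc_aux:
  fixes F :: "complex ^ 'm \<Rightarrow> complex"
  assumes \<rho>: "0 < \<rho>" "\<rho> < R"
  assumes "finite S" "sep_hol_on F {x. \<forall>i. norm (x $ i) < R}"
    and "\<And>x. F x = F (\<chi> i. if i \<in> S then x $ i else 0)"
    and "\<And>x. \<forall>i. norm (x $ i) < R \<Longrightarrow> norm (F x) \<le> M"
  shows "\<exists>c. (\<forall>\<alpha>. norm (c \<alpha>) \<le> M / \<rho> ^ (\<Sum>i\<in>UNIV. \<alpha> i)) \<and> (\<forall>\<alpha>. (\<exists>i. i \<notin> S \<and> \<alpha> i \<noteq> 0) \<longrightarrow> c \<alpha> = 0) \<and>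
     (\<forall>x. (\<forall>i. norm (x $ i) < \<rho>) \<longrightarrow> ((\<lambda>\<alpha>. c \<alpha> * (\<Prod>i\<in>UNIV. x $ i ^ \<alpha> i)) has_sum F x) UNIV)"
  using assms(3-)
proof (induction S arbitrary: F M)
  case empty
  let ?c = "\<lambda>\<alpha>::'m \<Rightarrow> nat. if \<alpha> = (\<lambda>i. 0) then F 0 else 0"
  have F0: "F x = F 0" for x
    using empty.prems(2)[of x] by (simp add: zero_vec_def)
  have M: "norm (F 0) \<le> M" using empty.prems(3)[of 0] \<rho> by simp
  then have M0: "0 \<le> M" using norm_ge_zero order_trans by blast
  have "((\<lambda>\<alpha>. ?c \<alpha> * (\<Prod>i\<in>UNIV. x $ i ^ \<alpha> i)) has_sum F x) UNIV" for x
  proof -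
    have "((\<lambda>\<alpha>. ?c \<alpha> * (\<Prod>i\<in>UNIV. x $ i ^ \<alpha> i)) has_sum F x) {\<lambda>i. 0}"
      by (rule has_sum_finiteI) (use F0 in auto)
    then show ?thesis
      by (rule iffD1[OF has_sum_cong_neutral, rotated -1]) auto
  qed
  then show ?case
    using M M0 \<rho> by (intro exI[of _ ?c]) (auto intro: divide_nonneg_pos)
next
  case (insert j S)
  let ?P = "{x :: complex ^ 'm. \<forall>i. norm (x $ i) < R}"
  have openP: "open ?P"
    by (rule open_polydisc)
  have "norm (F 0) \<le> M" using insert.prems(3)[of 0] \<rho> by simp
  then have M0: "0 \<le> M" using norm_ge_zero order_trans by blast
  \<comment> \<open>The \<open>k\<close>-th Taylor coefficient in \<open>x\<^sub>j\<close>, as a function of the other coordinates.\<close>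
  define T where "T k x = (deriv ^^ k) (\<lambda>z. F (set_coord x j z)) 0 / fact k" for k x
  have T: "T k x = (partial j ^^ k) F (set_coord x j 0) / fact k" for k x
    by (simp add: T_def funpow_partial_set_coord)
  have upd: "set_coord x j z \<in> ?P" if "x \<in> ?P" "norm z < R" for x z
    using that by (auto simp: set_coord_nth)
  have slice: "(\<lambda>z. F (set_coord x j z)) holomorphic_on ball 0 R" if "x \<in> ?P" for x
    using upd[OF that] by (intro sep_hol_on_slice[OF insert.prems(1)]) auto
  have T_bound: "norm (T k x) \<le> M / \<rho> ^ k" if x: "x \<in> ?P" for k x
  proof -
    have "norm ((deriv ^^ k) (\<lambda>z. F (set_coord x j z)) 0) \<le> fact k * M / \<rho> ^ k"
    proof (rule Cauchy_inequality)
      show "(\<lambda>z. F (set_coord x j z)) holomorphic_on ball 0 \<rho>"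
        by (rule holomorphic_on_subset[OF slice[OF x]]) (use \<rho> in auto)
      show "continuous_on (cball 0 \<rho>) (\<lambda>z. F (set_coord x j z))"
        by (rule continuous_on_subset[OF holomorphic_on_imp_continuous_on[OF slice[OF x]]]) (use \<rho> in auto)
      show "norm (F (set_coord x j z)) \<le> M" if "norm (0 - z) = \<rho>" for z
        by (rule insert.prems(3)) (use upd[OF x, of z] that \<rho> in auto)
    qed (use \<rho> in auto)
    then show ?thesis by (simp add: T_def norm_divide divide_le_eq mult.commute)
  qed
  have T_sep: "sep_hol_on (T k) ?P" for k
  proof -
    have *: "sep_hol_on ((partial j ^^ k) F) ?P"
      by (rule sep_hol_on_funpow_partial[OF insert.prems(1) openP])
    show ?thesis
      unfolding sep_hol_on_def
    proof (intro conjI ballI allI)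
      show "continuous_on ?P (T k)"
        unfolding T
      proof (intro continuous_on_divide continuous_on_const ballI)
        show "continuous_on ?P (\<lambda>x. (partial j ^^ k) F (set_coord x j 0))"
        proof (rule continuous_on_compose2[of ?P "(partial j ^^ k) F"])
          show "continuous_on ?P ((partial j ^^ k) F)" using * by (simp add: sep_hol_on_def)
          show "(\<lambda>x. set_coord x j 0) ` ?P \<subseteq> ?P" using \<rho> by (intro image_subsetI upd) auto
        qed (intro continuous_intros)
      qed simp
      fix x i assume x: "x \<in> ?P"
      show "(\<lambda>z. T k (set_coord x i z)) field_differentiable at (x $ i)"
      proof (cases "i = j")
        case True
        then show ?thesis by (simp add: T_def)
      next
        case False
        have "set_coord x j 0 \<in> ?P" by (rule upd[OF x]) (use \<rho> in simp)
        then have "(\<lambda>z. (partial j ^^ k) F (set_coord (set_coord x j 0) i z)) field_differentiable at (set_coord x j 0 $ i)"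
          using * unfolding sep_hol_on_def by blast
        then have "(\<lambda>z. (partial j ^^ k) F (set_coord (set_coord x j 0) i z)) field_differentiable at (x $ i)"
          using False by (simp only: set_coord_nth if_False)
        then have "(\<lambda>z. (partial j ^^ k) F (set_coord (set_coord x j 0) i z) / fact k) field_differentiable at (x $ i)"
          by (rule field_differentiable_divide[OF _ field_differentiable_const]) simp
        then show ?thesis
          unfolding T using False by (simp add: set_coord_commute)
      qed
    qed
  qed
  have T_dep: "T k x = T k (\<chi> i. if i \<in> S then x $ i else 0)" for k x
  proof -
    have "F (set_coord x j z) = F (set_coord (\<chi> i. if i \<in> S then x $ i else 0) j z)" for z
    proof -
      have "(\<chi> i. if i \<in> insert j S then set_coord x j z $ i else 0) =
          (\<chi> i. if i \<in> insert j S then set_coord (\<chi> i. if i \<in> S then x $ i else 0) j z $ i else 0)"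
        by (auto simp: vec_eq_iff set_coord_nth)
      then show ?thesis
        using insert.prems(2)[of "set_coord x j z"] insert.prems(2)[of "set_coord (\<chi> i. if i \<in> S then x $ i else 0) j z"]
        by simp
    qed
    then show ?thesis by (simp add: T_def)
  qed
  have "\<forall>k. \<exists>c. (\<forall>\<alpha>. norm (c \<alpha>) \<le> (M / \<rho> ^ k) / \<rho> ^ (\<Sum>i\<in>UNIV. \<alpha> i)) \<and> (\<forall>\<alpha>. (\<exists>i. i \<notin> S \<and> \<alpha> i \<noteq> 0) \<longrightarrow> c \<alpha> = 0) \<and>
     (\<forall>x. (\<forall>i. norm (x $ i) < \<rho>) \<longrightarrow> ((\<lambda>\<alpha>. c \<alpha> * (\<Prod>i\<in>UNIV. x $ i ^ \<alpha> i)) has_sum T k x) UNIV)"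
    by (intro allI insert.IH T_sep T_dep) (use T_bound in auto)
  then obtain c where c:
    "\<forall>k. (\<forall>\<alpha>. norm (c k \<alpha>) \<le> (M / \<rho> ^ k) / \<rho> ^ (\<Sum>i\<in>UNIV. \<alpha> i)) \<and> (\<forall>\<alpha>. (\<exists>i. i \<notin> S \<and> \<alpha> i \<noteq> 0) \<longrightarrow> c k \<alpha> = 0) \<and>
     (\<forall>x. (\<forall>i. norm (x $ i) < \<rho>) \<longrightarrow> ((\<lambda>\<alpha>. c k \<alpha> * (\<Prod>i\<in>UNIV. x $ i ^ \<alpha> i)) has_sum T k x) UNIV)"
    by (rule choice[THEN exE])
  have c_bound: "norm (c k \<alpha>) \<le> (M / \<rho> ^ k) / \<rho> ^ (\<Sum>i\<in>UNIV. \<alpha> i)" for k \<alpha>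
    using c by blast
  have c_zero: "c k \<alpha> = 0" if "i \<notin> S" "\<alpha> i \<noteq> 0" for k \<alpha> i
    using c that by blast
  have c_sum: "((\<lambda>\<alpha>. c k \<alpha> * (\<Prod>i\<in>UNIV. x $ i ^ \<alpha> i)) has_sum T k x) UNIV" if "\<forall>i. norm (x $ i) < \<rho>" for k x
    using c that by blast
  define d where "d \<alpha> = c (\<alpha> j) (\<alpha>(j := 0))" for \<alpha>
  have d_bound: "norm (d \<alpha>) \<le> M / \<rho> ^ (\<Sum>i\<in>UNIV. \<alpha> i)" for \<alpha>
  proof -
    have "(\<Sum>i\<in>UNIV. \<alpha> i) = \<alpha> j + (\<Sum>i\<in>UNIV. (\<alpha>(j := 0)) i)"
      by (simp add: sum.remove[of UNIV j])
    then show ?thesis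
      using c_bound[of "\<alpha> j" "\<alpha>(j := 0)"] by (simp add: d_def power_add)
  qed
  have d_zero: "d \<alpha> = 0" if "i \<notin> insert j S" "\<alpha> i \<noteq> 0" for \<alpha> i
    using that c_zero[of i "\<alpha>(j := 0)"] by (auto simp: d_def)
  have d_sum: "((\<lambda>\<alpha>. d \<alpha> * (\<Prod>i\<in>UNIV. x $ i ^ \<alpha> i)) has_sum F x) UNIV"
    if x: "\<forall>i. norm (x $ i) < \<rho>" for x
  proof -
    let ?t = "\<lambda>\<alpha>. d \<alpha> * (\<Prod>i\<in>UNIV. x $ i ^ \<alpha> i)"
    let ?A = "{\<beta>. \<forall>i. i \<notin> UNIV - {j} \<longrightarrow> \<beta> i = (0::nat)}"
    have "(\<lambda>\<alpha>. M * (\<Prod>i\<in>UNIV. (norm (x $ i) / \<rho>) ^ \<alpha> i)) summable_on UNIV"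
      using summable_geometric_multi[of UNIV "\<lambda>i. norm (x $ i) / \<rho>"] x \<rho>
      by (intro summable_on_cmult_right) simp
    then have "(\<lambda>\<alpha>. norm (?t \<alpha>)) summable_on UNIV"
    proof (rule Infinite_Sum.abs_summable_on_comparison_test')
      show "norm (?t \<alpha>) \<le> M * (\<Prod>i\<in>UNIV. (norm (x $ i) / \<rho>) ^ \<alpha> i)" for \<alpha>
      proof -
        have "norm (?t \<alpha>) \<le> (M / \<rho> ^ (\<Sum>i\<in>UNIV. \<alpha> i)) * (\<Prod>i\<in>UNIV. norm (x $ i) ^ \<alpha> i)"
          unfolding norm_mult prod_norm[symmetric] norm_power
          by (intro mult_right_mono d_bound prod_nonneg) auto
        also have "\<dots> = M * (\<Prod>i\<in>UNIV. (norm (x $ i) / \<rho>) ^ \<alpha> i)"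
          by (simp add: power_divide prod_dividef power_sum)
        finally show ?thesis .
      qed
    qed
    then have summ: "?t summable_on UNIV"
      by (rule Infinite_Sum.abs_summable_summable)
    have bij: "bij_betw (\<lambda>(k, \<beta>). \<beta>(j := k)) (UNIV \<times> ?A) UNIV"
      using bij_betw_exponent_update[of j "UNIV - {j}"] by (simp add: insert_absorb)
    have eq: "?t (case p of (k, \<beta>) \<Rightarrow> \<beta>(j := k)) = c (fst p) (snd p) * (\<Prod>i\<in>UNIV. x $ i ^ snd p i) * x $ j ^ fst p"
      if pA: "p \<in> UNIV \<times> ?A" for p
    proof -
      obtain k \<beta> where p: "p = (k, \<beta>)" "\<beta> j = 0" using pA by (cases p) auto
      have "(\<beta>(j := k))(j := 0) = \<beta>" using p by auto
      moreover have "(\<Prod>i\<in>UNIV. x $ i ^ (\<beta>(j := k)) i) = (\<Prod>i\<in>UNIV. x $ i ^ \<beta> i) * x $ j ^ k"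
        using p by (simp add: prod.remove[of UNIV j])
      ultimately show ?thesis by (simp add: p d_def)
    qed
    have "((\<lambda>p. c (fst p) (snd p) * (\<Prod>i\<in>UNIV. x $ i ^ snd p i) * x $ j ^ fst p) has_sum F x) (UNIV \<times> ?A)"
    proof (rule has_sum_SigmaI)
      fix k :: nat
      have "((\<lambda>\<beta>. c k \<beta> * (\<Prod>i\<in>UNIV. x $ i ^ \<beta> i)) has_sum T k x) ?A"
        using c_sum[OF x, of k]
        by (rule iffD1[OF has_sum_cong_neutral, rotated -1]) (use c_zero[of j] insert.hyps in auto)
      then show "((\<lambda>y. c (fst (k, y)) (snd (k, y)) * (\<Prod>i\<in>UNIV. x $ i ^ snd (k, y) i) * x $ j ^ fst (k, y)) has_sum
          T k x * x $ j ^ k) ?A"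
        using has_sum_cmult_left by fastforce
    next
      have xP: "x \<in> ?P" using x \<rho> by (auto intro: less_trans)
      have "x $ j \<in> ball 0 R" using xP by simp
      from holomorphic_power_series[OF slice[OF xP] this]
      have "(\<lambda>n. (deriv ^^ n) (\<lambda>z. F (set_coord x j z)) 0 / fact n * (x $ j - 0) ^ n) sums F (set_coord x j (x $ j))" .
      then have "(\<lambda>n. T n x * x $ j ^ n) sums F x" by (simp add: T_def)
      moreover have "summable (\<lambda>n. norm (T n x * x $ j ^ n))"
      proof (rule summable_comparison_test)
        show "\<exists>N. \<forall>n\<ge>N. norm (norm (T n x * x $ j ^ n)) \<le> M * (norm (x $ j) / \<rho>) ^ n"
          using T_bound[OF xP] by (auto simp: norm_mult norm_power power_divide intro!: mult_right_mono)
            (metis (no_types, lifting) T_bound[OF xP] mult_right_mono norm_ge_zero times_divide_eq_left zero_le_power)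
        show "summable (\<lambda>n. M * (norm (x $ j) / \<rho>) ^ n)"
          using x \<rho> by (intro summable_mult summable_geometric) auto
      qed
      ultimately show "((\<lambda>n. T n x * x $ j ^ n) has_sum F x) UNIV"
        by (intro norm_summable_imp_has_sum)
    next
      have "(\<lambda>p. ?t (case p of (k, \<beta>) \<Rightarrow> \<beta>(j := k))) summable_on (UNIV \<times> ?A)"
        using summ summable_on_reindex_bij_betw[OF bij, of ?t] by blast
      then show "(\<lambda>p. c (fst p) (snd p) * (\<Prod>i\<in>UNIV. x $ i ^ snd p i) * x $ j ^ fst p) summable_on (UNIV \<times> ?A)"
        by (rule iffD1[OF summable_on_cong, rotated]) (use eq in auto)
    qed
    then have "((\<lambda>p. ?t (case p of (k, \<beta>) \<Rightarrow> \<beta>(j := k))) has_sum F x) (UNIV \<times> ?A)"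
      by (rule iffD1[OF has_sum_cong, rotated]) (use eq in auto)
    then show ?thesis
      using has_sum_reindex_bij_betw[OF bij, of ?t] by blast
  qed
  show ?case
    using d_bound d_zero d_sum by (intro exI[of _ d]) blast
qed

text \<open>
  Osgood's lemma. The ball on which \<open>F\<close> is bounded contains a polydisc of radius \<open>R\<close>, because
  the norm is at most the sum of the absolute values of the coordinates.
\<close>

theorem sep_hol_on_imp_power_series:
  fixes F :: "complex ^ 'm \<Rightarrow> complex"
  assumes F: "sep_hol_on F U" and U: "open U" "a \<in> U"
  shows "has_power_series_at F a"
proof -
  obtain \<epsilon> where \<epsilon>: "0 < \<epsilon>" "cball a \<epsilon> \<subseteq> U"
    using U open_contains_cball_eq by blast
  have "compact (F ` cball a \<epsilon>)"
    using F \<epsilon> unfolding sep_hol_on_def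
    by (meson compact_cball compact_continuous_image continuous_on_subset)
  then obtain M where M: "\<And>x. x \<in> cball a \<epsilon> \<Longrightarrow> norm (F x) \<le> M"
    using compact_imp_bounded bounded_iff by (metis imageI)
  define R where "R = \<epsilon> / real CARD('m)"
  have R: "0 < R" using \<epsilon> by (simp add: R_def)
  have mem: "a + x \<in> cball a \<epsilon>" if "\<forall>i. norm (x $ i) < R" for x
  proof -
    have "norm x \<le> (\<Sum>i\<in>UNIV. norm (x $ i))"
      by (simp add: norm_vec_def L2_set_le_sum)
    also have "\<dots> \<le> (\<Sum>i\<in>(UNIV::'m set). R)"
      using that by (intro sum_mono) (auto intro: less_imp_le)
    also have "\<dots> = \<epsilon>" by (simp add: R_def)
    finally show ?thesis by (simp add: dist_norm)
  qed
  let ?G = "\<lambda>x. F (a + x)" and ?P = "{x :: complex ^ 'm. \<forall>i. norm (x $ i) < R}"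
  have G: "sep_hol_on ?G ?P"
    unfolding sep_hol_on_def
  proof (intro conjI ballI allI)
    show "continuous_on ?P ?G"
    proof (rule continuous_on_compose2[of U F])
      show "continuous_on U F" using F by (simp add: sep_hol_on_def)
      show "(+) a ` ?P \<subseteq> U"
        by (rule image_subsetI, rule subsetD[OF \<epsilon>(2)], rule mem) simp
    qed (intro continuous_intros)
    fix x i assume x: "x \<in> ?P"
    have "(\<lambda>z. F (set_coord (a + x) i z)) field_differentiable at ((\<lambda>z. a $ i + z) (x $ i))"
      using F mem[of x] x \<epsilon> unfolding sep_hol_on_def by (auto dest!: subsetD)
    then have "((\<lambda>z. F (set_coord (a + x) i z)) \<circ> (\<lambda>z. a $ i + z)) field_differentiable at (x $ i)"
      by (intro field_differentiable_compose field_differentiable_add field_differentiable_const field_differentiable_ident)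
    moreover have "set_coord (a + x) i (a $ i + z) = a + set_coord x i z" for z
      by (auto simp: vec_eq_iff set_coord_nth)
    ultimately show "(\<lambda>z. F (a + set_coord x i z)) field_differentiable at (x $ i)"
      by (simp add: o_def)
  qed
  obtain c where c: "\<And>x. (\<forall>i. norm (x $ i) < R / 2) \<Longrightarrow> ((\<lambda>\<alpha>. c \<alpha> * (\<Prod>i\<in>UNIV. x $ i ^ \<alpha> i)) has_sum ?G x) UNIV"
    using power_series_on_polydisc_aux[of "R / 2" R UNIV ?G M] R G M[OF mem] by auto
  show ?thesis
    unfolding has_power_series_at_def
  proof (intro exI conjI ballI)
    show "0 < R / 2" using R by simp
    fix x assume "x \<in> ball a (R / 2)"
    then have "norm (x - a) < R / 2" by (simp add: dist_norm norm_minus_commute)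
    then have "\<forall>i. norm ((x - a) $ i) < R / 2"
      using Finite_Cartesian_Product.norm_nth_le[of "x - a"] le_less_trans by blast
    from c[OF this] show "((\<lambda>\<alpha>. c \<alpha> * (\<Prod>i\<in>UNIV. (x $ i - a $ i) ^ \<alpha> i)) has_sum F x) UNIV" by simp
  qed
qed

section \<open>Differentiation of power series in several variables\<close>

definition monom_deriv :: "('m \<Rightarrow> nat) \<Rightarrow> complex ^ 'm \<Rightarrow> complex ^ 'm \<Rightarrow> complex" where
  "monom_deriv \<alpha> x v =
     (\<Sum>j\<in>UNIV. of_nat (\<alpha> j) * v $ j * x $ j ^ (\<alpha> j - 1) * (\<Prod>i\<in>UNIV - {j}. x $ i ^ \<alpha> i))"

lemma monom_has_derivative:
  "((\<lambda>x. \<Prod>i\<in>UNIV. x $ i ^ \<alpha> i) has_derivative monom_deriv \<alpha> x) (at x within S)"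
  unfolding monom_deriv_def
  by (intro has_derivative_prod has_derivative_power bounded_linear.has_derivative[OF bounded_linear_vec_nth] has_derivative_ident)

lemma monom_deriv_smult: "monom_deriv \<alpha> x (c *s v) = c * monom_deriv \<alpha> x v"
  by (simp add: monom_deriv_def sum_distrib_left mult_ac)

text \<open>
  Halving the radius absorbs the factors \<open>\<alpha>\<^sub>j\<close> that differentiation produces.
\<close>

lemma norm_monom_deriv_le:
  fixes x v :: "complex ^ 'm"
  assumes \<rho>: "0 < \<rho>" and x: "norm x \<le> \<rho> / 2"
  shows "norm (monom_deriv \<alpha> x v) \<le> (2 * real CARD('m) / \<rho>) * \<rho> ^ (\<Sum>i\<in>UNIV. \<alpha> i) * norm v"
proof -
  have xi: "norm (x $ i) \<le> \<rho> / 2" for i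
    using x Finite_Cartesian_Product.norm_nth_le[of x i] by linarith
  have power_bound: "real n * (\<rho> / 2) ^ (n - 1) \<le> 2 / \<rho> * \<rho> ^ n" for n :: nat
  proof (cases n)
    case (Suc m)
    have "real n \<le> 2 * 2 ^ m"
    proof -
      have "real n \<le> real (2 ^ n)" unfolding of_nat_le_iff by (rule less_imp_le[OF less_exp])
      then show ?thesis by (simp add: Suc)
    qed
    then have "real n * (\<rho> / 2) ^ m \<le> 2 * 2 ^ m * (\<rho> / 2) ^ m"
      using \<rho> by (intro mult_right_mono) auto
    also have "\<dots> = 2 / \<rho> * \<rho> ^ n" using \<rho> Suc by (simp add: power_divide)
    finally show ?thesis using Suc by simp
  qed (use \<rho> in simp)
  have "norm (monom_deriv \<alpha> x v) \<le> (\<Sum>j\<in>(UNIV::'m set). 2 / \<rho> * \<rho> ^ (\<Sum>i\<in>UNIV. \<alpha> i) * norm v)"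
    unfolding monom_deriv_def
  proof (rule sum_norm_le)
    fix j
    have "norm (of_nat (\<alpha> j) * v $ j * x $ j ^ (\<alpha> j - 1) * (\<Prod>i\<in>UNIV - {j}. x $ i ^ \<alpha> i))
        = (real (\<alpha> j) * norm (x $ j) ^ (\<alpha> j - 1)) * (\<Prod>i\<in>UNIV - {j}. norm (x $ i) ^ \<alpha> i) * norm (v $ j)"
      by (simp add: norm_mult norm_power prod_norm[symmetric])
    also have "\<dots> \<le> (2 / \<rho> * \<rho> ^ \<alpha> j) * (\<Prod>i\<in>UNIV - {j}. \<rho> ^ \<alpha> i) * norm v"
    proof (rule mult_mono[OF mult_mono])
      have "real (\<alpha> j) * norm (x $ j) ^ (\<alpha> j - 1) \<le> real (\<alpha> j) * (\<rho> / 2) ^ (\<alpha> j - 1)"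
        by (intro mult_left_mono power_mono xi) auto
      then show "real (\<alpha> j) * norm (x $ j) ^ (\<alpha> j - 1) \<le> 2 / \<rho> * \<rho> ^ \<alpha> j"
        using power_bound order_trans by blast
      have "norm (x $ i) ^ \<alpha> i \<le> \<rho> ^ \<alpha> i" for i
        using xi[of i] \<rho> by (intro power_mono) auto
      then show "(\<Prod>i\<in>UNIV - {j}. norm (x $ i) ^ \<alpha> i) \<le> (\<Prod>i\<in>UNIV - {j}. \<rho> ^ \<alpha> i)"
        by (intro prod_mono) auto
    qed (use \<rho> in \<open>auto intro!: Finite_Cartesian_Product.norm_nth_le mult_nonneg_nonneg divide_nonneg_pos prod_nonneg\<close>)
    also have "\<dots> = 2 / \<rho> * \<rho> ^ (\<Sum>i\<in>UNIV. \<alpha> i) * norm v"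
      by (simp add: power_sum prod.remove[of UNIV j])
    finally show "norm (of_nat (\<alpha> j) * v $ j * x $ j ^ (\<alpha> j - 1) * (\<Prod>i\<in>UNIV - {j}. x $ i ^ \<alpha> i))
        \<le> 2 / \<rho> * \<rho> ^ (\<Sum>i\<in>UNIV. \<alpha> i) * norm v" .
  qed
  then show ?thesis by (simp add: mult_ac)
qed

text \<open>
  Differentiation term by term: after an enumeration of the multi-indices, the bound on the
  derivatives of the monomials makes the differentiated series converge uniformly.
\<close>

theorem power_series_has_derivative:
  fixes c :: "('m::finite \<Rightarrow> nat) \<Rightarrow> complex"
  assumes \<rho>: "0 < \<rho>" and c: "(\<lambda>\<alpha>. norm (c \<alpha>) * \<rho> ^ (\<Sum>i\<in>UNIV. \<alpha> i)) summable_on UNIV"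
  obtains F D where
    "\<And>z. norm z < \<rho> / 2 \<Longrightarrow> ((\<lambda>\<alpha>. c \<alpha> * (\<Prod>i\<in>UNIV. z $ i ^ \<alpha> i)) has_sum F z) UNIV"
    "\<And>z. norm z < \<rho> / 2 \<Longrightarrow> (F has_derivative D z) (at z)"
    "\<And>z v. norm z < \<rho> / 2 \<Longrightarrow> ((\<lambda>\<alpha>. c \<alpha> * monom_deriv \<alpha> z v) has_sum D z v) UNIV"
proof -
  let ?S = "ball 0 (\<rho> / 2) :: (complex ^ 'm) set"
  define F where "F z = (\<Sum>\<^sub>\<infinity>\<alpha>. c \<alpha> * (\<Prod>i\<in>UNIV. z $ i ^ \<alpha> i))" for z :: "complex ^ 'm"
  define D where "D z v = (\<Sum>\<^sub>\<infinity>\<alpha>. c \<alpha> * monom_deriv \<alpha> z v)" for z v :: "complex ^ 'm"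
  define K where "K = 2 * real CARD('m) / \<rho>"
  have K: "0 \<le> K" using \<rho> by (simp add: K_def)
  have F: "((\<lambda>\<alpha>. c \<alpha> * (\<Prod>i\<in>UNIV. z $ i ^ \<alpha> i)) has_sum F z) UNIV" if z: "norm z < \<rho> / 2" for z
  proof -
    have "(\<lambda>\<alpha>. norm (c \<alpha> * (\<Prod>i\<in>UNIV. z $ i ^ \<alpha> i))) summable_on UNIV"
      using c
    proof (rule Infinite_Sum.abs_summable_on_comparison_test')
      fix \<alpha> :: "'m \<Rightarrow> nat"
      have zi: "norm (z $ i) \<le> \<rho>" for i
        using z \<rho> Finite_Cartesian_Product.norm_nth_le[of z i] by linarith
      show "norm (c \<alpha> * (\<Prod>i\<in>UNIV. z $ i ^ \<alpha> i)) \<le> norm (c \<alpha>) * \<rho> ^ (\<Sum>i\<in>UNIV. \<alpha> i)"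
        unfolding norm_mult prod_norm[symmetric] norm_power power_sum
        by (intro mult_left_mono prod_mono conjI power_mono zi) auto
    qed
    then show ?thesis
      unfolding F_def by (rule has_sum_infsum[OF Infinite_Sum.abs_summable_summable])
  qed
  have bound: "norm (c \<alpha> * monom_deriv \<alpha> z v) \<le> norm (c \<alpha>) * \<rho> ^ (\<Sum>i\<in>UNIV. \<alpha> i) * (K * norm v)"
    if z: "norm z < \<rho> / 2" for \<alpha> and z v :: "complex ^ 'm"
    using mult_left_mono[OF norm_monom_deriv_le[OF \<rho> less_imp_le[OF z], of \<alpha> v], of "norm (c \<alpha>)"]
    by (simp add: K_def norm_mult mult_ac)
  have D: "((\<lambda>\<alpha>. c \<alpha> * monom_deriv \<alpha> z v) has_sum D z v) UNIV" if z: "norm z < \<rho> / 2" for z v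
  proof -
    have "(\<lambda>\<alpha>. norm (c \<alpha> * monom_deriv \<alpha> z v)) summable_on UNIV"
      by (rule Infinite_Sum.abs_summable_on_comparison_test'[OF summable_on_cmult_left[OF c]]) (rule bound[OF z])
    then show ?thesis
      unfolding D_def by (rule has_sum_infsum[OF Infinite_Sum.abs_summable_summable])
  qed
  \<comment> \<open>The theorem on differentiation of series is about sequences.\<close>
  define e :: "nat \<Rightarrow> 'm \<Rightarrow> nat" where "e = from_nat_into UNIV"
  have "inj (\<lambda>n::nat. (\<lambda>_::'m. n))" by (auto simp: inj_def fun_eq_iff)
  then have "infinite (UNIV :: ('m \<Rightarrow> nat) set)"
    using finite_imageD infinite_UNIV_nat finite_subset[OF subset_UNIV] by metis
  then have e: "bij_betw e UNIV UNIV"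
    unfolding e_def by (intro bij_betw_from_nat_into countableI_type)
  define b where "b n = norm (c (e n)) * \<rho> ^ (\<Sum>i\<in>UNIV. e n i) * K" for n
  have b0: "0 \<le> b n" for n using K \<rho> by (simp add: b_def)
  have "(\<lambda>n. norm (c (e n)) * \<rho> ^ (\<Sum>i\<in>UNIV. e n i)) summable_on UNIV"
    using c summable_on_reindex_bij_betw[OF e, of "\<lambda>\<alpha>. norm (c \<alpha>) * \<rho> ^ (\<Sum>i\<in>UNIV. \<alpha> i)"] by simp
  then have b: "summable b"
    unfolding b_def by (intro summable_mult2 summable_on_imp_summable)
  have sums_F: "(\<lambda>n. c (e n) * (\<Prod>i\<in>UNIV. z $ i ^ e n i)) sums F z" if "norm z < \<rho> / 2" for z
    using F[OF that] has_sum_reindex_bij_betw[OF e, of "\<lambda>\<alpha>. c \<alpha> * (\<Prod>i\<in>UNIV. z $ i ^ \<alpha> i)"]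
    by (intro has_sum_imp_sums) simp
  have sums_D: "(\<lambda>n. c (e n) * monom_deriv (e n) z v) sums D z v" if "norm z < \<rho> / 2" for z v
    using D[OF that] has_sum_reindex_bij_betw[OF e, of "\<lambda>\<alpha>. c \<alpha> * monom_deriv \<alpha> z v"]
    by (intro has_sum_imp_sums) simp
  have tail: "(\<lambda>n. \<Sum>i. b (i + n)) \<longlonglongrightarrow> 0"
  proof -
    have "(\<lambda>n. suminf b - (\<Sum>i<n. b i)) \<longlonglongrightarrow> suminf b - suminf b"
      by (intro tendsto_intros summable_LIMSEQ[OF b])
    then show ?thesis by (simp add: suminf_minus_initial_segment[OF b])
  qed
  have "\<exists>g. \<forall>x\<in>?S. (\<lambda>n. c (e n) * (\<Prod>i\<in>UNIV. x $ i ^ e n i)) sums g x \<and> (g has_derivative D x) (at x within ?S)"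
  proof (rule has_derivative_series[where f' = "\<lambda>n x v. c (e n) * monom_deriv (e n) x v" and x = 0])
    show "((\<lambda>x. c (e n) * (\<Prod>i\<in>UNIV. x $ i ^ e n i)) has_derivative (\<lambda>v. c (e n) * monom_deriv (e n) x v)) (at x within ?S)"
      for n x by (intro has_derivative_mult_right monom_has_derivative)
    fix \<epsilon> :: real assume "0 < \<epsilon>"
    then have "\<forall>\<^sub>F n in sequentially. (\<Sum>i. b (i + n)) < \<epsilon>"
      using tail by (intro order_tendstoD(2)) auto
    then show "\<forall>\<^sub>F n in sequentially. \<forall>x\<in>?S. \<forall>h. norm ((\<Sum>i<n. c (e i) * monom_deriv (e i) x h) - D x h) \<le> \<epsilon> * norm h"
    proof eventually_elim
      case (elim n)
      show ?case
      proof (intro ballI allI)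
        fix x h :: "complex ^ 'm" assume "x \<in> ?S"
        then have x: "norm x < \<rho> / 2" by simp
        let ?t = "\<lambda>i. c (e i) * monom_deriv (e i) x h"
        have t: "norm (?t i) \<le> b i * norm h" for i
          using bound[OF x, of "e i" h] by (simp add: b_def mult_ac)
        have s: "summable (\<lambda>i. b (i + n) * norm h)"
          by (intro summable_mult2 summable_ignore_initial_segment b)
        have "D x h = suminf ?t" using sums_D[OF x] by (simp add: sums_iff)
        then have "norm ((\<Sum>i<n. ?t i) - D x h) = norm (\<Sum>i. ?t (i + n))"
          using suminf_minus_initial_segment[of ?t n] sums_D[OF x, of h] by (simp add: sums_iff norm_minus_commute)
        also have "\<dots> \<le> (\<Sum>i. b (i + n) * norm h)"
          by (rule norm_suminf_le[OF t s])
        also have "\<dots> = (\<Sum>i. b (i + n)) * norm h"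
          by (rule suminf_mult2[symmetric]) (intro summable_ignore_initial_segment b)
        also have "\<dots> \<le> \<epsilon> * norm h"
          using elim by (intro mult_right_mono) auto
        finally show "norm ((\<Sum>i<n. ?t i) - D x h) \<le> \<epsilon> * norm h" .
      qed
    qed
  next
    show "(\<lambda>n. c (e n) * (\<Prod>i\<in>UNIV. 0 $ i ^ e n i)) sums F 0"
      using \<rho> by (intro sums_F) simp
  qed (use \<rho> in auto)
  then obtain g where g: "\<And>x. x \<in> ?S \<Longrightarrow> (\<lambda>n. c (e n) * (\<Prod>i\<in>UNIV. x $ i ^ e n i)) sums g x"
    "\<And>x. x \<in> ?S \<Longrightarrow> (g has_derivative D x) (at x within ?S)"
    by blast
  have eq: "g x = F x" if "x \<in> ?S" for x
    using g(1)[OF that] sums_F[of x] that sums_unique2 by auto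
  have F': "(F has_derivative D z) (at z)" if "norm z < \<rho> / 2" for z
  proof -
    have z: "z \<in> ?S" using that by simp
    then have "(g has_derivative D z) (at z)"
      using g(2)[OF z] at_within_open[of z ?S] by simp
    then show ?thesis
      by (rule has_derivative_transform_within_open[OF _ open_ball z]) (rule eq)
  qed
  show ?thesis
    by (rule that[OF F F' D])
qed

lemma hol_on_localI: "(\<And>x. x \<in> U \<Longrightarrow> \<exists>V. x \<in> V \<and> hol_on F V) \<Longrightarrow> hol_on F U"
  unfolding hol_on_def by blast

lemma hol_on_subset: "hol_on F U \<Longrightarrow> V \<subseteq> U \<Longrightarrow> hol_on F V"
  unfolding hol_on_def by blast

lemma hol_on_transform:
  assumes "hol_on F U" "open U" "\<And>x. x \<in> U \<Longrightarrow> F x = G x"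
  shows "hol_on G U"
  unfolding hol_on_def
proof
  fix x assume x: "x \<in> U"
  then obtain D where D: "(F has_derivative D) (at x)" "\<forall>c v. D (c *s v) = c * D v"
    using assms(1) unfolding hol_on_def by blast
  have "(G has_derivative D) (at x)"
    by (rule has_derivative_transform_within_open[OF D(1) assms(2) x assms(3)])
  with D show "\<exists>D. (G has_derivative D) (at x) \<and> (\<forall>c v. D (c *s v) = c * D v)" by blast
qed

lemma power_series_hol_on_ball:
  fixes c :: "('m::finite \<Rightarrow> nat) \<Rightarrow> complex"
  assumes \<rho>: "0 < \<rho>" and c: "(\<lambda>\<alpha>. norm (c \<alpha>) * \<rho> ^ (\<Sum>i\<in>UNIV. \<alpha> i)) summable_on UNIV"
  obtains F where
    "\<And>z. z \<in> ball a (\<rho> / 2) \<Longrightarrow> ((\<lambda>\<alpha>. c \<alpha> * (\<Prod>i\<in>UNIV. (z $ i - a $ i) ^ \<alpha> i)) has_sum F z) UNIV"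
    "hol_on F (ball a (\<rho> / 2))"
proof -
  from power_series_has_derivative[OF assms] obtain G D where
    G: "\<And>z. norm z < \<rho> / 2 \<Longrightarrow> ((\<lambda>\<alpha>. c \<alpha> * (\<Prod>i\<in>UNIV. z $ i ^ \<alpha> i)) has_sum G z) UNIV"
    and G': "\<And>z. norm z < \<rho> / 2 \<Longrightarrow> (G has_derivative D z) (at z)"
    and D: "\<And>z v. norm z < \<rho> / 2 \<Longrightarrow> ((\<lambda>\<alpha>. c \<alpha> * monom_deriv \<alpha> z v) has_sum D z v) UNIV"
    by blast
  have small: "norm (z - a) < \<rho> / 2" if "z \<in> ball a (\<rho> / 2)" for z
    using that by (simp add: dist_norm norm_minus_commute)
  show ?thesis
  proof (rule that[of "\<lambda>z. G (z - a)"])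
    show "((\<lambda>\<alpha>. c \<alpha> * (\<Prod>i\<in>UNIV. (z $ i - a $ i) ^ \<alpha> i)) has_sum G (z - a)) UNIV"
      if "z \<in> ball a (\<rho> / 2)" for z
      using G[OF small[OF that]] by simp
    show "hol_on (\<lambda>z. G (z - a)) (ball a (\<rho> / 2))"
      unfolding hol_on_def
    proof
      fix x assume x: "x \<in> ball a (\<rho> / 2)"
      have "((\<lambda>y. G (y - a)) has_derivative (\<lambda>h. D (x - a) h)) (at x)"
        by (rule has_derivative_compose[of "\<lambda>y. y - a" "\<lambda>h. h" x UNIV G, OF _ G'[OF small[OF x]]])
          (auto intro!: derivative_eq_intros)
      moreover have "D (x - a) (k *s v) = k * D (x - a) v" for k v
        using has_sum_cmult_right[OF D[OF small[OF x], of v], of k] D[OF small[OF x], of "k *s v"]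
        by (simp add: monom_deriv_smult mult.left_commute) (metis infsumI)
      ultimately show "\<exists>D. ((\<lambda>z. G (z - a)) has_derivative D) (at x) \<and> (\<forall>c v. D (c *s v) = c * D v)" by blast
    qed
  qed
qed

text \<open>
  A point all of whose coordinates have the same positive offset: absolute convergence of a power
  series there controls its coefficients with one radius for all coordinates.
\<close>

lemma diagonal_point_in_ball:
  fixes a :: "'k::real_normed_field ^ 'm"
  assumes "0 < r"
  shows "a + (\<chi> i. of_real (r / (2 * real CARD('m)))) \<in> ball a r"
proof -
  let ?\<rho> = "r / (2 * real CARD('m))"
  have "norm (\<chi> i::'m. (of_real ?\<rho> :: 'k)) \<le> (\<Sum>i\<in>(UNIV::'m set). norm (of_real ?\<rho> :: 'k))"
    by (simp only: norm_vec_def vec_lambda_beta) (rule L2_set_le_sum, simp)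
  also have "\<dots> = r / 2" using assms by (simp only: norm_of_real) simp
  finally show ?thesis using assms by (simp add: dist_norm)
qed

lemma power_series_imp_hol_on:
  fixes F :: "complex ^ 'm \<Rightarrow> complex"
  assumes "has_power_series_at F a"
  obtains r where "0 < r" "hol_on F (ball a r)"
proof -
  obtain c r where r: "0 < r"
    and c: "\<And>x. x \<in> ball a r \<Longrightarrow> ((\<lambda>\<alpha>. c \<alpha> * (\<Prod>i\<in>UNIV. (x $ i - a $ i) ^ \<alpha> i)) has_sum F x) UNIV"
    using assms unfolding has_power_series_at_def by blast
  define \<rho> where "\<rho> = r / (2 * real CARD('m))"
  have \<rho>: "0 < \<rho>" using r by (simp add: \<rho>_def)
  have "(\<lambda>\<alpha>. c \<alpha> * (\<Prod>i\<in>UNIV. complex_of_real \<rho> ^ \<alpha> i)) summable_on UNIV"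
    using c[OF diagonal_point_in_ball[OF r, of a]] by (auto simp: summable_on_def \<rho>_def)
  then have "(\<lambda>\<alpha>. norm (c \<alpha> * (\<Prod>i\<in>UNIV. complex_of_real \<rho> ^ \<alpha> i))) summable_on UNIV"
    by (simp only: summable_on_iff_abs_summable_on_complex)
  then have "(\<lambda>\<alpha>. norm (c \<alpha>) * \<rho> ^ (\<Sum>i\<in>UNIV. \<alpha> i)) summable_on UNIV"
    using \<rho> by (simp add: norm_mult prod_norm[symmetric] norm_power power_sum)
  from power_series_hol_on_ball[OF \<rho> this, of a] obtain G where
    G: "\<And>z. z \<in> ball a (\<rho> / 2) \<Longrightarrow> ((\<lambda>\<alpha>. c \<alpha> * (\<Prod>i\<in>UNIV. (z $ i - a $ i) ^ \<alpha> i)) has_sum G z) UNIV"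
    and hol: "hol_on G (ball a (\<rho> / 2))" by blast
  define s where "s = min r (\<rho> / 2)"
  have s: "0 < s" "s \<le> r" "s \<le> \<rho> / 2" using r \<rho> by (auto simp: s_def)
  have "hol_on F (ball a s)"
  proof (rule hol_on_transform[OF hol_on_subset[OF hol] open_ball])
    show "G x = F x" if "x \<in> ball a s" for x
      by (rule has_sum_unique[OF G c]) (use that s in auto)
  qed (use s in auto)
  then show ?thesis using that s by blast
qed

text \<open>
  The detour over power series restores joint differentiability, which a limit of difference
  quotients would give for each coordinate only.
\<close>

lemma hol_on_partial:
  fixes F :: "complex ^ 'm \<Rightarrow> complex"
  assumes "hol_on F U" "open U"
  shows "hol_on (partial j F) U"
proof (rule hol_on_localI)
  fix x assume "x \<in> U"
  then have "has_power_series_at (partial j F) x"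
    using sep_hol_on_imp_power_series[OF sep_hol_on_partial[OF hol_on_imp_sep_hol_on]] assms by blast
  then show "\<exists>V. x \<in> V \<and> hol_on (partial j F) V"
    by (metis power_series_imp_hol_on centre_in_ball)
qed

section \<open>Operations on holomorphic functions of several variables\<close>

lemma has_derivative_vecI:
  fixes f :: "'a::real_normed_vector \<Rightarrow> 'b::real_normed_vector ^ 'm"
  assumes "\<And>i. ((\<lambda>x. f x $ i) has_derivative (\<lambda>v. D v $ i)) F"
  shows "(f has_derivative D) F"
proof -
  have eq: "(\<Sum>i\<in>UNIV. axis i (y $ i)) = y" for y :: "'b ^ 'm"
    by (simp add: vec_eq_iff axis_def if_distrib cong: if_cong)
  have "((\<lambda>x. \<Sum>i\<in>UNIV. axis i (f x $ i)) has_derivative (\<lambda>v. \<Sum>i\<in>UNIV. axis i (D v $ i))) F"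
    by (intro has_derivative_sum bounded_linear.has_derivative[OF bounded_linear_axis] assms)
  then show ?thesis by (simp only: eq)
qed

lemma has_derivative_vecD:
  "(f has_derivative D) F \<Longrightarrow> ((\<lambda>x. f x $ i) has_derivative (\<lambda>v. D v $ i)) F"
  by (rule bounded_linear.has_derivative[OF bounded_linear_vec_nth])

lemma hol_on_const: "hol_on (\<lambda>x. c) U"
  unfolding hol_on_def by (auto intro!: exI[of _ "\<lambda>v. 0"])

lemma hol_on_nth: "hol_on (\<lambda>x. x $ i) U"
  unfolding hol_on_def
  by (auto intro!: exI[of _ "\<lambda>v. v $ i"] bounded_linear.has_derivative[OF bounded_linear_vec_nth])

lemma hol_on_add:
  assumes "hol_on F U" "hol_on G U"
  shows "hol_on (\<lambda>x. F x + G x) U"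
  unfolding hol_on_def
proof
  fix x assume x: "x \<in> U"
  obtain D where D: "(F has_derivative D) (at x)" "\<And>c v. D (c *s v) = c * D v"
    using assms(1) x unfolding hol_on_def by blast
  obtain E where E: "(G has_derivative E) (at x)" "\<And>c v. E (c *s v) = c * E v"
    using assms(2) x unfolding hol_on_def by blast
  show "\<exists>D. ((\<lambda>x. F x + G x) has_derivative D) (at x) \<and> (\<forall>c v. D (c *s v) = c * D v)"
    using D E by (intro exI[of _ "\<lambda>v. D v + E v"]) (auto simp: distrib_left)
qed

lemma hol_on_mult:
  assumes "hol_on F U" "hol_on G U"
  shows "hol_on (\<lambda>x. F x * G x) U"
  unfolding hol_on_def
proof
  fix x assume x: "x \<in> U"
  obtain D where D: "(F has_derivative D) (at x)" "\<And>c v. D (c *s v) = c * D v"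
    using assms(1) x unfolding hol_on_def by blast
  obtain E where E: "(G has_derivative E) (at x)" "\<And>c v. E (c *s v) = c * E v"
    using assms(2) x unfolding hol_on_def by blast
  show "\<exists>D. ((\<lambda>x. F x * G x) has_derivative D) (at x) \<and> (\<forall>c v. D (c *s v) = c * D v)"
    using D E by (intro exI[of _ "\<lambda>v. F x * E v + D v * G x"]) (auto simp: algebra_simps intro!: derivative_eq_intros)
qed

lemma hol_on_sum: "(\<And>i. i \<in> I \<Longrightarrow> hol_on (f i) U) \<Longrightarrow> hol_on (\<lambda>x. \<Sum>i\<in>I. f i x) U"
  by (induction I rule: infinite_finite_induct) (auto intro: hol_on_const hol_on_add)

lemma hol_on_exp:
  assumes "hol_on F U"
  shows "hol_on (\<lambda>x. exp (F x)) U"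
  unfolding hol_on_def
proof
  fix x assume x: "x \<in> U"
  obtain D where D: "(F has_derivative D) (at x)" "\<And>c v. D (c *s v) = c * D v"
    using assms(1) x unfolding hol_on_def by blast
  have "(exp has_derivative (\<lambda>v. v * exp (F x))) (at (F x))"
    using DERIV_exp[of "F x"] by (simp add: has_field_derivative_def mult_commute_abs)
  from has_derivative_compose[OF D(1) this]
  show "\<exists>D. ((\<lambda>x. exp (F x)) has_derivative D) (at x) \<and> (\<forall>c v. D (c *s v) = c * D v)"
    using D(2) by (intro exI[of _ "\<lambda>v. D v * exp (F x)"]) (auto simp: algebra_simps)
qed

lemma hol_on_compose:
  fixes G :: "complex ^ 'm \<Rightarrow> complex ^ 'p"
  assumes F: "hol_on F V" and G: "\<And>i. hol_on (\<lambda>x. G x $ i) U" and sub: "\<And>x. x \<in> U \<Longrightarrow> G x \<in> V"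
  shows "hol_on (\<lambda>x. F (G x)) U"
  unfolding hol_on_def
proof
  fix x assume x: "x \<in> U"
  obtain D where D: "(F has_derivative D) (at (G x))" "\<And>c v. D (c *s v) = c * D v"
    using F sub[OF x] unfolding hol_on_def by blast
  have "\<forall>i. \<exists>D. ((\<lambda>x. G x $ i) has_derivative D) (at x) \<and> (\<forall>c v. D (c *s v) = c * D v)"
    using G x unfolding hol_on_def by blast
  then obtain E where E: "\<And>i. ((\<lambda>x. G x $ i) has_derivative E i) (at x)" "\<And>i c v. E i (c *s v) = c * E i v"
    by metis
  have "(G has_derivative (\<lambda>v. \<chi> i. E i v)) (at x)"
    by (rule has_derivative_vecI) (simp add: E)
  from has_derivative_compose[OF this D(1)]
  have "((\<lambda>x. F (G x)) has_derivative (\<lambda>v. D (\<chi> i. E i v))) (at x)" .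
  moreover have "(\<chi> i. E i (c *s v)) = c *s (\<chi> i. E i v)" for c v
    by (simp add: vec_eq_iff E)
  ultimately show "\<exists>D. ((\<lambda>x. F (G x)) has_derivative D) (at x) \<and> (\<forall>c v. D (c *s v) = c * D v)"
    using D(2) by (intro exI[of _ "\<lambda>v. D (\<chi> i. E i v)"]) auto
qed

lemma hol_on_frechet_derivative:
  fixes F :: "complex ^ 'm \<Rightarrow> complex"
  assumes F: "hol_on F U" and U: "open U"
  shows "hol_on (\<lambda>x. frechet_derivative F (at x) v) U"
proof (rule hol_on_transform[OF _ U])
  show "hol_on (\<lambda>x. \<Sum>j\<in>UNIV. v $ j * partial j F x) U"
    by (intro hol_on_sum hol_on_mult hol_on_const hol_on_partial assms)
  fix x assume "x \<in> U"
  then obtain D where D: "(F has_derivative D) (at x)" "\<And>c v. D (c *s v) = c * D v"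
    using F unfolding hol_on_def by blast
  show "(\<Sum>j\<in>UNIV. v $ j * partial j F x) = frechet_derivative F (at x) v"
    using hol_on_derivative_eq_partial[OF D] frechet_derivative_at[OF D(1)] by simp
qed

lemma hol_on_continuous: "hol_on F U \<Longrightarrow> continuous_on U F"
  using hol_on_imp_sep_hol_on sep_hol_on_def by blast

section \<open>Operations on continuously differentiable functions\<close>

lemma Ck_on_subset: "Ck_on k f U \<Longrightarrow> V \<subseteq> U \<Longrightarrow> Ck_on k f V"
  by (induction k arbitrary: f) (auto intro: continuous_on_subset)

lemma Ck_on_localI:
  "(\<And>x. x \<in> U \<Longrightarrow> \<exists>V. open V \<and> x \<in> V \<and> Ck_on k f V) \<Longrightarrow> Ck_on k f U"
proof (induction k arbitrary: f)
  case 0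
  have "isCont f x" if "x \<in> U" for x
    using 0[OF that] by (auto simp: continuous_on_eq_continuous_at)
  then show ?case by (simp add: continuous_at_imp_continuous_on)
next
  case (Suc k)
  show ?case
    unfolding Ck_on.simps
  proof (intro conjI ballI allI)
    show "f differentiable at x" if "x \<in> U" for x
      using Suc.prems[OF that] by auto
    show "Ck_on k (\<lambda>x. frechet_derivative f (at x) v) U" for v
      by (rule Suc.IH) (use Suc.prems in fastforce)
  qed
qed

lemma Ck_on_cong:
  "open U \<Longrightarrow> (\<And>x. x \<in> U \<Longrightarrow> f x = g x) \<Longrightarrow> Ck_on k f U \<Longrightarrow> Ck_on k g U"
proof (induction k arbitrary: f g)
  case 0
  then show ?case by (simp cong: continuous_on_cong)
next
  case (Suc k)
  have d: "f differentiable at x" if "x \<in> U" for x using Suc.prems that by auto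
  show ?case
    unfolding Ck_on.simps
  proof (intro conjI ballI allI)
    show "g differentiable at x" if "x \<in> U" for x
    proof -
      obtain D where "(f has_derivative D) (at x)" using d \<open>x \<in> U\<close> unfolding differentiable_def by blast
      then have "(g has_derivative D) (at x)"
        by (rule has_derivative_transform_within_open[OF _ Suc.prems(1) \<open>x \<in> U\<close> Suc.prems(2)])
      then show ?thesis unfolding differentiable_def by blast
    qed
    have eq: "frechet_derivative f (at x) v = frechet_derivative g (at x) v" if "x \<in> U" for x v
      using frechet_derivative_transform_within_open[OF d[OF that] Suc.prems(1) that Suc.prems(2)] by (rule fun_cong)
    fix v
    have "Ck_on k (\<lambda>x. frechet_derivative f (at x) v) U"
      using Suc.prems(3) unfolding Ck_on.simps by blast
    then show "Ck_on k (\<lambda>x. frechet_derivative g (at x) v) U"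
      by (rule Suc.IH[OF Suc.prems(1), rotated]) (rule eq)
  qed
qed

lemma Ck_on_SucI:
  assumes "open U" "\<And>x. x \<in> U \<Longrightarrow> (f has_derivative D x) (at x)" "\<And>v. Ck_on k (\<lambda>x. D x v) U"
  shows "Ck_on (Suc k) f U"
  unfolding Ck_on.simps
proof (intro conjI ballI allI)
  show "f differentiable at x" if "x \<in> U" for x
    using assms(2)[OF that] differentiable_def by blast
  have eq: "D x v = frechet_derivative f (at x) v" if "x \<in> U" for x v
    using frechet_derivative_at[OF assms(2)[OF that]] by simp
  show "Ck_on k (\<lambda>x. frechet_derivative f (at x) v) U" for v
    by (rule Ck_on_cong[OF assms(1) eq assms(3)])
qed

text \<open>
  Together with the introduction rule above, this lets proofs work with any formula for the
  derivative instead of \<open>frechet_derivative\<close>.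
\<close>

lemma Ck_on_SucE:
  assumes "Ck_on (Suc k) f U"
  shows "\<exists>D. (\<forall>x\<in>U. (f has_derivative D x) (at x)) \<and> (\<forall>v. Ck_on k (\<lambda>x. D x v) U)"
  using assms frechet_derivative_works[of f]
  by (intro exI[of _ "\<lambda>x. frechet_derivative f (at x)"]) auto

lemma Ck_on_Suc_imp: "Ck_on (Suc k) f U \<Longrightarrow> Ck_on k f U"
proof (induction k arbitrary: f)
  case 0
  then show ?case
    by (simp add: continuous_at_imp_continuous_on differentiable_imp_continuous_within)
next
  case (Suc k)
  then show ?case
    unfolding Ck_on.simps(2)[of "Suc k"] Ck_on.simps(2)[of k] by blast
qed

lemma Ck_on_const: "open U \<Longrightarrow> Ck_on k (\<lambda>x. c) U"
proof (induction k arbitrary: c)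
  case (Suc k)
  show ?case by (rule Ck_on_SucI[OF Suc.prems has_derivative_const Suc.IH[OF Suc.prems]])
qed simp

lemma Ck_on_bounded_linear:
  assumes "bounded_linear f" "open U"
  shows "Ck_on k f U"
proof (cases k)
  case 0
  then show ?thesis using assms by (simp add: linear_continuous_on)
next
  case (Suc n)
  show ?thesis
    unfolding Suc
    by (rule Ck_on_SucI[OF assms(2) bounded_linear_imp_has_derivative[OF assms(1)] Ck_on_const[OF assms(2)]])
qed

lemma Ck_on_add:
  "open U \<Longrightarrow> Ck_on k f U \<Longrightarrow> Ck_on k g U \<Longrightarrow> Ck_on k (\<lambda>x. f x + g x) U"
proof (induction k arbitrary: f g)
  case (Suc k)
  obtain D where D: "\<And>x. x \<in> U \<Longrightarrow> (f has_derivative D x) (at x)" "\<And>v. Ck_on k (\<lambda>x. D x v) U"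
    using Ck_on_SucE[OF Suc.prems(2)] by blast
  obtain E where E: "\<And>x. x \<in> U \<Longrightarrow> (g has_derivative E x) (at x)" "\<And>v. Ck_on k (\<lambda>x. E x v) U"
    using Ck_on_SucE[OF Suc.prems(3)] by blast
  show ?case
    by (rule Ck_on_SucI[OF Suc.prems(1) has_derivative_add[OF D(1) E(1)] Suc.IH[OF Suc.prems(1) D(2) E(2)]])
qed (auto intro: continuous_intros)

lemma Ck_on_sum:
  "open U \<Longrightarrow> (\<And>i. i \<in> I \<Longrightarrow> Ck_on k (f i) U) \<Longrightarrow> Ck_on k (\<lambda>x. \<Sum>i\<in>I. f i x) U"
  by (induction I rule: infinite_finite_induct) (auto intro: Ck_on_const Ck_on_add)

lemma Ck_on_linear_compose:
  "bounded_linear L \<Longrightarrow> open U \<Longrightarrow> Ck_on k f U \<Longrightarrow> Ck_on k (\<lambda>x. L (f x)) U"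
proof (induction k arbitrary: f)
  case 0
  then show ?case using bounded_linear.continuous_on by auto
next
  case (Suc k)
  obtain D where D: "\<And>x. x \<in> U \<Longrightarrow> (f has_derivative D x) (at x)" "\<And>v. Ck_on k (\<lambda>x. D x v) U"
    using Ck_on_SucE[OF Suc.prems(3)] by blast
  show ?case
    by (rule Ck_on_SucI[OF Suc.prems(2) bounded_linear.has_derivative[OF Suc.prems(1) D(1)] Suc.IH[OF Suc.prems(1,2) D(2)]])
qed

lemma Ck_on_bilinear:
  "bounded_bilinear B \<Longrightarrow> open U \<Longrightarrow> Ck_on k f U \<Longrightarrow> Ck_on k g U \<Longrightarrow> Ck_on k (\<lambda>x. B (f x) (g x)) U"
proof (induction k arbitrary: f g)
  case 0
  then show ?case using bounded_bilinear.continuous_on by auto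
next
  case (Suc k)
  obtain D where D: "\<And>x. x \<in> U \<Longrightarrow> (f has_derivative D x) (at x)" "\<And>v. Ck_on k (\<lambda>x. D x v) U"
    using Ck_on_SucE[OF Suc.prems(3)] by blast
  obtain E where E: "\<And>x. x \<in> U \<Longrightarrow> (g has_derivative E x) (at x)" "\<And>v. Ck_on k (\<lambda>x. E x v) U"
    using Ck_on_SucE[OF Suc.prems(4)] by blast
  note fg = Suc.prems(3,4)[THEN Ck_on_Suc_imp]
  show ?case
    by (rule Ck_on_SucI[OF Suc.prems(2) bounded_bilinear.FDERIV[OF Suc.prems(1) D(1) E(1)]])
      (auto intro!: Ck_on_add Suc.IH Suc.prems D E fg)
qed

lemmas Ck_on_mult = Ck_on_bilinear[OF bounded_bilinear_mult]
lemmas Ck_on_scaleR = Ck_on_bilinear[OF bounded_bilinear_scaleR]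

text \<open>
  The derivative of \<open>f\<close> at a moving point is only known to be \<open>C\<^sup>k\<close> in fixed directions, so the
  direction supplied by the inner function is expanded in a basis.
\<close>

lemma Ck_on_compose:
  fixes f :: "'b::euclidean_space \<Rightarrow> 'c::real_normed_vector"
  shows "open U \<Longrightarrow> open V \<Longrightarrow> Ck_on k f V \<Longrightarrow> Ck_on k G U \<Longrightarrow> (\<And>x. x \<in> U \<Longrightarrow> G x \<in> V) \<Longrightarrow>
    Ck_on k (\<lambda>x. f (G x)) U"
proof (induction k arbitrary: f)
  case 0
  then show ?case by (auto intro: continuous_on_compose2)
next
  case (Suc k)
  obtain D where D: "\<And>x. x \<in> V \<Longrightarrow> (f has_derivative D x) (at x)" "\<And>v. Ck_on k (\<lambda>x. D x v) V"
    using Ck_on_SucE[OF Suc.prems(3)] by blast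
  obtain E where E: "\<And>x. x \<in> U \<Longrightarrow> (G has_derivative E x) (at x)" "\<And>v. Ck_on k (\<lambda>x. E x v) U"
    using Ck_on_SucE[OF Suc.prems(4)] by blast
  show ?case
  proof (rule Ck_on_SucI[OF Suc.prems(1)])
    fix x assume x: "x \<in> U"
    have lin: "linear (D (G x))"
      by (rule has_derivative_linear[OF D(1)[OF Suc.prems(5)[OF x]]])
    have "D (G x) (\<Sum>b\<in>Basis. (w \<bullet> b) *\<^sub>R b) = (\<Sum>b\<in>Basis. (w \<bullet> b) *\<^sub>R D (G x) b)" for w
      by (simp add: linear_sum[OF lin] linear_scale[OF lin] del: euclidean_representation)
    then have expand: "D (G x) w = (\<Sum>b\<in>Basis. (w \<bullet> b) *\<^sub>R D (G x) b)" for w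
      unfolding euclidean_representation .
    have eq: "(\<lambda>v. \<Sum>b\<in>Basis. (E x v \<bullet> b) *\<^sub>R D (G x) b) = (\<lambda>v. D (G x) (E x v))"
      by (rule ext, rule expand[symmetric])
    show "((\<lambda>x. f (G x)) has_derivative (\<lambda>v. \<Sum>b\<in>Basis. (E x v \<bullet> b) *\<^sub>R D (G x) b)) (at x)"
      unfolding eq by (rule has_derivative_compose[OF E(1)[OF x] D(1)[OF Suc.prems(5)[OF x]]])
  next
    show "Ck_on k (\<lambda>x. \<Sum>b\<in>Basis. (E x v \<bullet> b) *\<^sub>R D (G x) b) U" for v
    proof (intro Ck_on_sum[OF Suc.prems(1)] Ck_on_scaleR[OF Suc.prems(1)])
      fix b :: 'b
      show "Ck_on k (\<lambda>x. E x v \<bullet> b) U"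
        by (rule Ck_on_linear_compose[OF bounded_linear_inner_left Suc.prems(1)]) (use E in blast)
      have "Ck_on k (\<lambda>x. D x b) V" using D by blast
      then show "Ck_on k (\<lambda>x. D (G x) b) U"
        by (rule Suc.IH[OF Suc.prems(1,2) _ Ck_on_Suc_imp[OF Suc.prems(4)] Suc.prems(5)])
    qed
  qed
qed

lemma Ck_on_vecI:
  fixes f :: "'a::real_normed_vector \<Rightarrow> 'b::real_normed_vector ^ 'm"
  assumes "open U" "\<And>i. Ck_on k (\<lambda>x. f x $ i) U"
  shows "Ck_on k f U"
proof -
  have eq: "(\<Sum>i\<in>UNIV. axis i (y $ i)) = y" for y :: "'b ^ 'm"
    by (simp add: vec_eq_iff axis_def if_distrib cong: if_cong)
  have "Ck_on k (\<lambda>x. \<Sum>i\<in>UNIV. axis i (f x $ i)) U"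
    by (intro Ck_on_sum Ck_on_linear_compose[OF bounded_linear_axis] assms)
  then show ?thesis by (simp only: eq)
qed

lemma Ck_on_inverse:
  fixes f :: "'a::real_normed_vector \<Rightarrow> 'k::real_normed_field"
  shows "open U \<Longrightarrow> Ck_on k f U \<Longrightarrow> (\<And>x. x \<in> U \<Longrightarrow> f x \<noteq> 0) \<Longrightarrow> Ck_on k (\<lambda>x. inverse (f x)) U"
proof (induction k)
  case 0
  then show ?case by (auto intro!: continuous_intros)
next
  case (Suc k)
  obtain D where D: "\<And>x. x \<in> U \<Longrightarrow> (f has_derivative D x) (at x)" "\<And>v. Ck_on k (\<lambda>x. D x v) U"
    using Ck_on_SucE[OF Suc.prems(2)] by blast
  have inv: "Ck_on k (\<lambda>x. inverse (f x)) U"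
    by (rule Suc.IH[OF Suc.prems(1) Ck_on_Suc_imp[OF Suc.prems(2)] Suc.prems(3)])
  show ?case
  proof (rule Ck_on_SucI[OF Suc.prems(1)])
    show "((\<lambda>x. inverse (f x)) has_derivative (\<lambda>v. (-1) * (inverse (f x) * D x v * inverse (f x)))) (at x)" if "x \<in> U" for x
      using has_derivative_compose[OF D(1)[OF that] has_derivative_inverse'[OF Suc.prems(3)[OF that]]] by simp
    show "Ck_on k (\<lambda>x. (-1) * (inverse (f x) * D x v * inverse (f x))) U" for v
      by (intro Ck_on_mult Ck_on_const Suc.prems inv D)
  qed
qed

lemma Ck_on_exp:
  fixes f :: "'a::real_normed_vector \<Rightarrow> 'k::{real_normed_field,banach}"
  shows "open U \<Longrightarrow> Ck_on k f U \<Longrightarrow> Ck_on k (\<lambda>x. exp (f x)) U"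
proof (induction k)
  case 0
  then show ?case by (auto intro!: continuous_intros)
next
  case (Suc k)
  obtain D where D: "\<And>x. x \<in> U \<Longrightarrow> (f has_derivative D x) (at x)" "\<And>v. Ck_on k (\<lambda>x. D x v) U"
    using Ck_on_SucE[OF Suc.prems(2)] by blast
  show ?case
  proof (rule Ck_on_SucI[OF Suc.prems(1)])
    show "((\<lambda>x. exp (f x)) has_derivative (\<lambda>v. exp (f x) * D x v)) (at x)" if "x \<in> U" for x
    proof -
      have "(exp has_derivative (\<lambda>v. exp (f x) * v)) (at (f x))"
        using DERIV_exp[of "f x"] by (simp add: has_field_derivative_def)
      from has_derivative_compose[OF D(1)[OF that] this] show ?thesis .
    qed
    show "Ck_on k (\<lambda>x. exp (f x) * D x v) U" for v
      by (intro Ck_on_mult Suc.IH Suc.prems D Ck_on_Suc_imp)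
  qed
qed

section \<open>Implicit functions of a scalar unknown\<close>

lemma time_space_nth [simp]: "time_space t x $ None = t" "time_space t x $ Some j = x $ j"
  by (simp_all add: time_space_def)

text \<open>
  A time coordinate also serves as the unknown of an implicit equation. If the parameters include a
  time already, such an equation lives on \<open>'k ^ ('n option option)\<close>, and this projection is applied twice.
\<close>

definition space_part :: "'k ^ ('n option) \<Rightarrow> 'k ^ 'n" where
  "space_part q = (\<chi> j. q $ Some j)"

lemma space_part_nth [simp]: "space_part q $ j = q $ Some j"
  by (simp add: space_part_def)

lemma space_part_time_space [simp]: "space_part (time_space t x) = x"
  by (simp add: vec_eq_iff)

lemma vec_option_eq_iff: "p = q \<longleftrightarrow> p $ None = q $ None \<and> (\<forall>j. p $ Some j = q $ Some j)"
  by (metis vec_eq_iff option.exhaust)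

lemma time_space_axis: "time_space t 0 = axis None t"
  by (simp add: vec_option_eq_iff axis_def)

lemma time_space_add: "time_space (s + t) (x + y) = time_space s x + time_space t y"
  by (simp add: vec_option_eq_iff)

lemma time_space_smult: "time_space (c * t) (c *s x) = c *s time_space t x"
  by (simp add: vec_option_eq_iff)

lemma norm_time_space_le: "norm (time_space (t::'k::real_normed_vector) (x :: 'k ^ 'n)) \<le> norm t + norm x"
proof -
  have "(\<Sum>i\<in>UNIV. (norm (time_space t x $ i))\<^sup>2) = (norm t)\<^sup>2 + (\<Sum>j\<in>UNIV. (norm (x $ j))\<^sup>2)"
    by (simp add: UNIV_option_conv sum.reindex)
  also have "(\<Sum>j\<in>UNIV. (norm (x $ j))\<^sup>2) = (norm x)\<^sup>2"
    by (simp add: norm_vec_def L2_set_def sum_nonneg)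
  finally have "norm (time_space t x) = sqrt ((norm t)\<^sup>2 + (norm x)\<^sup>2)"
    by (simp add: norm_vec_def[of "time_space t x"] L2_set_def)
  also have "\<dots> \<le> norm t + norm x"
    by (rule real_le_lsqrt) (auto simp: power2_sum)
  finally show ?thesis .
qed

lemma bounded_linear_time_space: "bounded_linear (\<lambda>x. time_space (0::'k::real_normed_vector) (x :: 'k ^ 'n))"
  by (rule bounded_linear_intro[where K = 1])
    (use norm_time_space_le[of "0::'k"] in \<open>auto simp: vec_option_eq_iff\<close>)

lemma has_derivative_time_space:
  fixes f :: "'a::real_normed_vector \<Rightarrow> 'k::real_normed_vector"
  assumes "(f has_derivative f') F" "(g has_derivative g') F"
  shows "((\<lambda>x. time_space (f x) (g x)) has_derivative (\<lambda>v. time_space (f' v) (g' v))) F"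
proof (rule has_derivative_vecI)
  show "((\<lambda>x. time_space (f x) (g x) $ i) has_derivative (\<lambda>v. time_space (f' v) (g' v) $ i)) F" for i
    using assms has_derivative_vecD[OF assms(2)] by (cases i) auto
qed

lemma continuous_on_time_space [continuous_intros]:
  fixes f :: "'a::topological_space \<Rightarrow> 'k::real_normed_vector"
  assumes "continuous_on S f" "continuous_on S g"
  shows "continuous_on S (\<lambda>x. time_space (f x) (g x))"
proof -
  have "continuous_on S (\<lambda>x. \<chi> i. time_space (f x) (g x) $ i)"
  proof (rule continuous_on_vec_lambda)
    show "continuous_on S (\<lambda>x. time_space (f x) (g x) $ i)" for i
      using assms by (cases i) (auto intro!: continuous_intros)
  qed
  then show ?thesis by simp
qed

lemma tendsto_time_space [tendsto_intros]:
  fixes f :: "'a \<Rightarrow> 'k::real_normed_vector"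
  assumes "(f \<longlongrightarrow> a) F" "(g \<longlongrightarrow> b) F"
  shows "((\<lambda>x. time_space (f x) (g x)) \<longlongrightarrow> time_space a b) F"
proof (rule vec_tendstoI)
  show "((\<lambda>x. time_space (f x) (g x) $ i) \<longlongrightarrow> time_space a b $ i) F" for i
    using assms by (cases i) (auto intro!: tendsto_intros)
qed

text \<open>
  Differentiability of an implicit function that is only known to be continuous. The linear
  approximation of the equation first shows that the increment of \<open>u\<close> is at most a multiple of the increment of \<open>x\<close>;
  inserted again, this bounds the error by a small multiple of the increment of \<open>x\<close>.
\<close>

lemma implicit_has_derivative:
  fixes F :: "'k::real_normed_field ^ ('m::finite option) \<Rightarrow> 'k" and u :: "'k ^ 'm \<Rightarrow> 'k"
  assumes F: "(F has_derivative L) (at (time_space (u a) a))"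
    and lin: "\<And>c v. L (c *s v) = c * L v" and nz: "L (axis None 1) \<noteq> 0"
    and cont: "isCont u a"
    and eq: "\<forall>\<^sub>F x in nhds a. F (time_space (u x) x) = F (time_space (u a) a)"
  shows "(u has_derivative (\<lambda>v. - L (time_space 0 v) / L (axis None 1))) (at a)"
proof -
  let ?c = "L (axis None 1)" and ?P = "\<lambda>v. L (time_space 0 v)"
  have bl: "bounded_linear ?P"
    using bounded_linear_compose[OF has_derivative_bounded_linear[OF F] bounded_linear_time_space] .
  obtain K where "0 \<le> K" "\<forall>v. norm (?P v) \<le> norm v * K"
    using bounded_linear.nonneg_bounded[OF bl] by blast
  then have K: "0 \<le> K" "\<And>v. norm (?P v) \<le> K * norm v"
    by (simp_all add: mult.commute)
  \<comment> \<open>\<open>B\<close> is the Lipschitz constant that results from the first use of the linear approximation.\<close>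
  define B where "B = 2 * K / norm ?c + 1"
  have B: "1 \<le> B" using K by (simp add: B_def)
  have c0: "0 < norm ?c" using nz by simp
  show ?thesis
    unfolding has_derivative_at_alt
  proof (intro conjI allI impI)
    show "bounded_linear (\<lambda>v. - ?P v / ?c)"
      by (rule bounded_linear_compose[OF bounded_linear_divide bounded_linear_minus[OF bl]])
    fix e :: real assume e: "0 < e"
    define e' where "e' = min (norm ?c / 2) (e * norm ?c / (1 + B))"
    have "0 < e * norm ?c / (1 + B)" using e c0 B by (intro divide_pos_pos mult_pos_pos) auto
    then have e': "0 < e'" "e' \<le> norm ?c / 2" "e' \<le> e * norm ?c / (1 + B)"
      unfolding e'_def using c0 by (simp_all only: min.cobounded1 min.cobounded2 min_less_iff_conj half_gt_zero_iff)
    obtain d where d: "0 < d" "\<And>y. norm (y - time_space (u a) a) < d \<Longrightarrow>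
        norm (F y - F (time_space (u a) a) - L (y - time_space (u a) a)) \<le> e' * norm (y - time_space (u a) a)"
      using F e'(1) unfolding has_derivative_at_alt by blast
    have "((\<lambda>x. time_space (u x) x) \<longlongrightarrow> time_space (u a) a) (at a)"
      using cont by (intro tendsto_intros) (simp add: isCont_def)
    then have "((\<lambda>x. time_space (u x) x) \<longlongrightarrow> time_space (u a) a) (nhds a)"
      using tendsto_at_iff_tendsto_nhds[of "\<lambda>x. time_space (u x) x" a] by simp
    then have "\<forall>\<^sub>F x in nhds a. dist (time_space (u x) x) (time_space (u a) a) < d"
      using d(1) by (rule tendstoD)
    then have "\<forall>\<^sub>F x in nhds a. norm (u x - u a - (- ?P (x - a) / ?c)) \<le> e * norm (x - a)"
      using eq
    proof eventually_elim
      case (elim x)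
      let ?p = "time_space (u x) x - time_space (u a) a"
      have p: "?p = time_space (u x - u a) (x - a)"
        by (simp add: vec_option_eq_iff)
      have Lp: "L ?p = ?c * (u x - u a) + ?P (x - a)"
      proof -
        have "?p = (u x - u a) *s axis None 1 + time_space 0 (x - a)"
          unfolding p by (simp add: vec_option_eq_iff axis_def)
        then have "L ?p = L ((u x - u a) *s axis None 1) + ?P (x - a)"
          using linear_add[OF has_derivative_linear[OF F]] by metis
        then show ?thesis by (simp only: lin mult.commute)
      qed
      have *: "norm (?c * (u x - u a) + ?P (x - a)) \<le> e' * (norm (u x - u a) + norm (x - a))"
      proof -
        have "norm (?c * (u x - u a) + ?P (x - a)) = norm (F (time_space (u x) x) - F (time_space (u a) a) - L ?p)"
          using elim(2) norm_minus_cancel[of "L ?p"] by (simp add: Lp)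
        also have "\<dots> \<le> e' * norm ?p" using d(2) elim(1) by (simp add: dist_norm)
        also have "\<dots> \<le> e' * (norm (u x - u a) + norm (x - a))"
          using e' norm_time_space_le unfolding p by (intro mult_left_mono) auto
        finally show ?thesis .
      qed
      have "norm ?c * norm (u x - u a) \<le> norm (?c * (u x - u a) + ?P (x - a)) + norm (?P (x - a))"
        by (metis add_diff_cancel_right' norm_mult norm_triangle_ineq4)
      also have "\<dots> \<le> e' * (norm (u x - u a) + norm (x - a)) + K * norm (x - a)"
        using * K(2) by (rule add_mono)
      also have "\<dots> \<le> norm ?c / 2 * (norm (u x - u a) + norm (x - a)) + K * norm (x - a)"
        by (intro add_right_mono mult_right_mono e') auto
      finally have "norm ?c * norm (u x - u a) \<le> (2 * K + norm ?c) * norm (x - a)"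
        by (simp add: algebra_simps)
      also have "2 * K + norm ?c = norm ?c * B"
        using c0 by (simp add: B_def distrib_left)
      finally have **: "norm (u x - u a) \<le> B * norm (x - a)"
        using c0 by (simp only: mult.assoc mult_le_cancel_left_pos)
      have "u x - u a - (- ?P (x - a) / ?c) = (?c * (u x - u a) + ?P (x - a)) / ?c"
        using nz by (simp add: field_simps)
      then have "norm (u x - u a - (- ?P (x - a) / ?c)) = norm (?c * (u x - u a) + ?P (x - a)) / norm ?c"
        by (simp only: norm_divide)
      also have "\<dots> \<le> e' * (B * norm (x - a) + norm (x - a)) / norm ?c"
        using * ** e' by (intro divide_right_mono order_trans[OF *] mult_left_mono add_right_mono) auto
      also have "\<dots> = e' * ((1 + B) / norm ?c) * norm (x - a)" by (simp add: field_simps)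
      also have "\<dots> \<le> e * norm (x - a)"
      proof (rule mult_right_mono)
        show "e' * ((1 + B) / norm ?c) \<le> e"
          using e'(3) c0 B by (simp add: field_simps)
      qed simp
      finally show ?case .
    qed
    then show "\<exists>d>0. \<forall>y. norm (y - a) < d \<longrightarrow> norm (u y - u a - (- ?P (y - a) / ?c)) \<le> e * norm (y - a)"
      by (simp add: eventually_nhds_metric dist_norm)
  qed
qed

lemma open_Collect_less_on:
  fixes f :: "'a::topological_space \<Rightarrow> real"
  assumes "continuous_on W f" "open W"
  shows "open {x \<in> W. f x < c}"
proof -
  have "open (W \<inter> f -` {..<c})"
    by (rule continuous_open_preimage[OF assms open_lessThan])
  also have "W \<inter> f -` {..<c} = {x \<in> W. f x < c}" by auto
  finally show ?thesis .
qed

text \<open>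
  The slope in the unknown is the same number \<open>c\<close> at all points of \<open>C \<times> {b}\<close>, so near this compact set
  the simplified Newton map \<open>u \<mapsto> u - F p u / c\<close> contracts a ball around \<open>b\<close>, of one radius for all
  parameters. This gives one solution over a whole neighbourhood of \<open>C\<close>, with no gluing.
\<close>

lemma implicit_function_exists:
  fixes F :: "'p::metric_space \<Rightarrow> 'k::{real_normed_field,euclidean_space} \<Rightarrow> 'k"
  assumes C: "compact C" and W: "open W" "C \<times> {b} \<subseteq> W"
    and cont: "continuous_on W (\<lambda>(p, u). F p u)"
    and deriv: "\<And>p u. (p, u) \<in> W \<Longrightarrow> (F p has_field_derivative dF p u) (at u)"
    and cont': "continuous_on W (\<lambda>(p, u). dF p u)"
    and zero: "\<And>p. p \<in> C \<Longrightarrow> F p b = 0"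
    and slope: "\<And>p. p \<in> C \<Longrightarrow> dF p b = c" "c \<noteq> 0"
  shows "\<exists>V r g. open V \<and> C \<subseteq> V \<and> 0 < r \<and> V \<times> cball b r \<subseteq> W \<and> continuous_on V g \<and>
    (\<forall>p\<in>V. g p \<in> cball b r \<and> F p (g p) = 0 \<and>
      (\<forall>u\<in>cball b r. dF p u \<noteq> 0 \<and> (F p u = 0 \<longrightarrow> u = g p)))"
proof -
  \<comment> \<open>Where the Newton map has derivative less than \<open>1/2\<close> in the unknown.\<close>
  define W' where "W' = {q \<in> W. norm (1 - (case q of (p, u) \<Rightarrow> dF p u) / c) < 1 / 2}"
  have "continuous_on W (\<lambda>q. norm (1 - (case q of (p, u) \<Rightarrow> dF p u) / c))"
    using cont' slope(2) by (intro continuous_intros) auto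
  then have W'_open: "open W'"
    unfolding W'_def using W(1) by (rule open_Collect_less_on)
  have W'_sub: "C \<times> {b} \<subseteq> W'"
    using W(2) slope by (auto simp: W'_def)
  have "open ((\<lambda>(u, p). (p, u)) -` W')"
    by (intro open_vimage[OF W'_open]) (auto simp: case_prod_beta intro!: continuous_intros)
  moreover have "{b} \<times> C \<subseteq> (\<lambda>(u, p). (p, u)) -` W'"
    using W'_sub by auto
  ultimately have "\<exists>X0. b \<in> X0 \<and> open X0 \<and> X0 \<times> C \<subseteq> (\<lambda>(u, p). (p, u)) -` W'"
    by (rule Elementary_Topology.tube_lemma[OF C])
  then obtain X0 where X0: "b \<in> X0" "open X0" "X0 \<times> C \<subseteq> (\<lambda>(u, p). (p, u)) -` W'"
    by blast
  then obtain r where r: "0 < r" "cball b r \<subseteq> X0"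
    using open_contains_cball_eq by blast
  have "\<exists>X. p \<in> X \<and> open X \<and> X \<times> cball b r \<subseteq> W'" if "p \<in> C" for p
  proof (rule Elementary_Topology.tube_lemma[OF compact_cball W'_open])
    show "{p} \<times> cball b r \<subseteq> W'" using X0(3) r(2) that by fastforce
  qed
  then obtain X where X: "\<And>p. p \<in> C \<Longrightarrow> p \<in> X p \<and> open (X p) \<and> X p \<times> cball b r \<subseteq> W'"
    by metis
  define V1 where "V1 = (\<Union>p\<in>C. X p)"
  have V1: "open V1" "C \<subseteq> V1" "V1 \<times> cball b r \<subseteq> W'"
    using X by (auto simp: V1_def)
  have V1W: "(p, u) \<in> W" "norm (1 - dF p u / c) \<le> 1 / 2" if "p \<in> V1" "u \<in> cball b r" for p u
    using V1(3) that by (auto simp: W'_def dest!: subsetD)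
  have contp: "continuous_on V1 (\<lambda>p. F p u)" if "u \<in> cball b r" for u
  proof -
    have "continuous_on V1 (\<lambda>p. (p, u))" by (intro continuous_intros)
    moreover have "(\<lambda>p. (p, u)) ` V1 \<subseteq> W" using V1W(1) that by blast
    ultimately show ?thesis using continuous_on_compose2[OF cont, of V1 "\<lambda>p. (p, u)"] by simp
  qed
  \<comment> \<open>Where the centre \<open>b\<close> moves by less than \<open>r/2\<close>, so that the Newton map preserves the ball.\<close>
  define V where "V = {p \<in> V1. norm (F p b / c) < r / 2}"
  have "continuous_on V1 (\<lambda>p. norm (F p b / c))"
    using contp[of b] r slope(2) by (intro continuous_intros) auto
  then have V_open: "open V"
    unfolding V_def using V1(1) by (rule open_Collect_less_on)
  have V_sub: "C \<subseteq> V" using V1(2) zero r by (auto simp: V_def)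
  \<comment> \<open>The simplified Newton map.\<close>
  define N where "N p u = u - F p u / c" for p u
  have lip: "norm (N p u - N p v) \<le> 1 / 2 * norm (u - v)"
    if p: "p \<in> V1" and uv: "u \<in> cball b r" "v \<in> cball b r" for p u v
  proof (rule field_differentiable_bound[of "cball b r"])
    show "(N p has_field_derivative 1 - dF p z / c) (at z within cball b r)" if z: "z \<in> cball b r" for z
      unfolding N_def
      by (rule has_field_derivative_at_within, intro DERIV_diff DERIV_ident DERIV_cdivide deriv V1W(1) p z)
  qed (use V1W(2) p uv in auto)
  have fix_iff: "N p u = u \<longleftrightarrow> F p u = 0" for p u
    using slope(2) by (simp add: N_def)
  have ex: "\<exists>!u. u \<in> cball b r \<and> F p u = 0" if p: "p \<in> V" for p
  proof -
    have pV1: "p \<in> V1" and small: "norm (F p b / c) < r / 2" using p by (auto simp: V_def)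
    have "\<exists>!u\<in>cball b r. N p u = u"
    proof (rule Banach_fix[of _ "1 / 2"])
      show "complete (cball b r)" by (simp add: complete_eq_closed)
      show "N p ` cball b r \<subseteq> cball b r"
      proof (rule image_subsetI)
        fix u assume u: "u \<in> cball b r"
        have "norm (N p u - b) \<le> norm (N p u - N p b) + norm (N p b - b)"
          using norm_triangle_ineq[of "N p u - N p b" "N p b - b"] by simp
        also have "\<dots> \<le> 1 / 2 * norm (u - b) + r / 2"
          using lip[OF pV1 u, of b] small r by (intro add_mono) (auto simp: N_def)
        also have "\<dots> \<le> r" using u by (simp add: dist_norm norm_minus_commute)
        finally show "N p u \<in> cball b r" by (simp add: dist_norm norm_minus_commute)
      qed
    qed (use r lip[OF pV1] in \<open>auto simp: dist_norm\<close>)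
    then show ?thesis by (simp add: fix_iff)
  qed
  define g where "g p = (THE u. u \<in> cball b r \<and> F p u = 0)" for p
  have g: "g p \<in> cball b r" "F p (g p) = 0" if "p \<in> V" for p
    using theI'[OF ex[OF that]] by (auto simp: g_def)
  have g_unique: "u = g p" if "p \<in> V" "u \<in> cball b r" "F p u = 0" for p u
    using ex[OF that(1)] g[OF that(1)] that(2,3) by blast
  have contg: "continuous_on V g"
    unfolding continuous_on_def
  proof
    fix p0 assume p0: "p0 \<in> V"
    have p01: "p0 \<in> V1" using p0 by (simp add: V_def)
    have bnd: "norm (g p - g p0) \<le> 2 * norm (F p (g p0) / c)" if "p \<in> V" for p
    proof -
      have pV1: "p \<in> V1" using that by (simp add: V_def)
      have "norm (g p - g p0) = norm (N p (g p) - N p (g p0) - F p (g p0) / c)"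
        using g[OF that] by (simp add: N_def)
      also have "\<dots> \<le> 1 / 2 * norm (g p - g p0) + norm (F p (g p0) / c)"
        using lip[OF pV1 g(1)[OF that] g(1)[OF p0]] norm_triangle_ineq4[of "N p (g p) - N p (g p0)" "F p (g p0) / c"]
        by linarith
      finally show ?thesis by simp
    qed
    have "((\<lambda>p. F p (g p0)) \<longlongrightarrow> F p0 (g p0)) (at p0 within V)"
    proof (rule tendsto_within_subset)
      show "((\<lambda>p. F p (g p0)) \<longlongrightarrow> F p0 (g p0)) (at p0 within V1)"
        using contp[OF g(1)[OF p0]] p01 unfolding continuous_on_def by blast
      show "V \<subseteq> V1" by (auto simp: V_def)
    qed
    then have "((\<lambda>p. 2 * norm (F p (g p0) / c)) \<longlongrightarrow> 2 * norm (F p0 (g p0) / c)) (at p0 within V)"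
      using slope(2) by (intro tendsto_intros)
    then have "((\<lambda>p. 2 * norm (F p (g p0) / c)) \<longlongrightarrow> 0) (at p0 within V)"
      using g(2)[OF p0] by simp
    then have "((\<lambda>p. g p - g p0) \<longlongrightarrow> 0) (at p0 within V)"
      by (rule Lim_null_comparison[rotated]) (use bnd in \<open>auto simp: eventually_at_filter\<close>)
    then show "(g \<longlongrightarrow> g p0) (at p0 within V)"
      by (simp add: LIM_zero_iff)
  qed
  have VW: "V \<times> cball b r \<subseteq> W" using V1W(1) by (auto simp: V_def)
  have nz: "dF p u \<noteq> 0" if "p \<in> V" "u \<in> cball b r" for p u
    using V1W(2)[of p u] that by (auto simp: V_def)
  show ?thesis
    using V_open V_sub r(1) VW contg g g_unique nz
    by (intro exI[of _ V] exI[of _ r] exI[of _ g] conjI ballI impI)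
qed

section \<open>Smooth germs in the real and complex cases\<close>

text \<open>
  The scalars \<open>'k\<close> are the real or the complex numbers, seen inside the complex numbers by \<open>emb\<close>;
  \<open>ret\<close> is a linear retraction (the real part, or the identity) that transports statements about
  complex extensions back. The last axiom expresses that \<open>C_infinity\<close> occurs for real scalars only.
\<close>

locale scalar_regularity =
  fixes reg :: regularity
    and emb :: "'k::{real_normed_field,euclidean_space} \<Rightarrow> complex"
    and ret :: "complex \<Rightarrow> 'k"
  assumes bounded_linear_emb: "bounded_linear emb"
    and emb_mult: "emb (x * y) = emb x * emb y"
    and norm_emb: "norm (emb x) = norm x"
    and bounded_linear_ret: "bounded_linear ret"
    and ret_mult: "ret (emb x * z) = x * ret z"
    and ret_emb: "ret (emb x) = x"
    and real_if_C_infinity: "reg = C_infinity \<Longrightarrow> emb x \<in> \<real>"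
begin

sublocale emb: bounded_linear emb by (rule bounded_linear_emb)
sublocale ret: bounded_linear ret by (rule bounded_linear_ret)

lemma emb_eq_iff: "emb x = emb y \<longleftrightarrow> x = y"
  by (metis ret_emb)

lemma emb_one: "emb 1 = 1"
  using emb_mult[of 1 1] norm_emb[of 1] by auto

lemma emb_of_real: "emb (of_real r) = of_real r"
  by (simp add: of_real_def emb.scaleR emb_one)

lemma emb_power: "emb (x ^ n) = emb x ^ n"
  by (induction n) (auto simp: emb_one emb_mult)

lemma emb_prod: "emb (\<Prod>i\<in>I. f i) = (\<Prod>i\<in>I. emb (f i))"
  by (induction I rule: infinite_finite_induct) (auto simp: emb_one emb_mult)

lemma emb_of_nat: "emb (of_nat n) = of_nat n"
  using emb_of_real[of "real n"] by simp

lemma emb_exp: "emb (exp x) = exp (emb x)"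
proof -
  have "(\<lambda>n. emb (x ^ n /\<^sub>R fact n)) sums emb (exp x)"
    by (rule emb.sums[OF exp_converges])
  then have "(\<lambda>n. emb x ^ n /\<^sub>R fact n) sums emb (exp x)"
    by (simp only: emb.scaleR emb_power)
  then show ?thesis using exp_converges[of "emb x"] sums_unique2 by blast
qed

lemma of_real_if_C_infinity:
  fixes x :: 'k
  assumes "reg = C_infinity"
  obtains r where "x = of_real r"
proof -
  obtain r where "emb x = of_real r" using real_if_C_infinity[OF assms, of x] Reals_cases by blast
  then have "x = of_real r" using emb_of_real[of r] emb_eq_iff by metis
  then show ?thesis by (rule that)
qed

definition vemb :: "'k ^ 'm \<Rightarrow> complex ^ 'm" where
  "vemb x = (\<chi> i. emb (x $ i))"

lemma vemb_nth [simp]: "vemb x $ i = emb (x $ i)"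
  by (simp add: vemb_def)

lemma norm_vemb: "norm (vemb x) = norm x"
  by (simp add: norm_vec_def norm_emb)

lemma bounded_linear_vemb: "bounded_linear vemb"
  by (rule bounded_linear_intro[where K = 1])
    (auto simp: vec_eq_iff emb.add emb.scaleR norm_vemb)

lemma vemb_smult: "vemb (c *s v) = emb c *s vemb v"
  by (simp add: vec_eq_iff emb_mult)

lemma dist_vemb: "dist (vemb x) (vemb y) = dist x y"
  using linear_diff[OF bounded_linear.linear[OF bounded_linear_vemb], of x y] norm_vemb[of "x - y"]
  by (simp add: dist_norm)

lemma vemb_time_space: "vemb (time_space t x) = time_space (emb t) (vemb x)"
  by (simp add: vec_option_eq_iff)

lemma vemb_axis: "vemb (axis i 1) = axis i 1"
  by (simp add: vec_eq_iff axis_def emb_one emb.zero)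

definition extends :: "(complex ^ 'm \<Rightarrow> complex) \<Rightarrow> ('k ^ 'm \<Rightarrow> 'k) \<Rightarrow> (complex ^ 'm) set \<Rightarrow> bool" where
  "extends F f U \<longleftrightarrow> open U \<and> hol_on F U \<and> (\<forall>x. vemb x \<in> U \<longrightarrow> F (vemb x) = emb (f x))"

text \<open>
  The expansion of the extension restricts to scalar arguments, and \<open>ret\<close> makes its coefficients
  scalar: for real scalars it takes their real parts.
\<close>

lemma extends_imp_power_series:
  fixes f :: "'k ^ 'm \<Rightarrow> 'k"
  assumes "extends F f U" "vemb a \<in> U"
  shows "has_power_series_at f a"
proof -
  have "has_power_series_at F (vemb a)"
    using assms sep_hol_on_imp_power_series[OF hol_on_imp_sep_hol_on] unfolding extends_def by blast
  then obtain c r where r: "0 < r" and c: "\<And>x. x \<in> ball (vemb a) r \<Longrightarrow>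
      ((\<lambda>\<alpha>. c \<alpha> * (\<Prod>i\<in>UNIV. (x $ i - vemb a $ i) ^ \<alpha> i)) has_sum F x) UNIV"
    unfolding has_power_series_at_def by blast
  obtain s where s: "0 < s" "ball (vemb a) s \<subseteq> U"
    using assms unfolding extends_def by (meson openE)
  show ?thesis
    unfolding has_power_series_at_def
  proof (intro exI[of _ "\<lambda>\<alpha>. ret (c \<alpha>)"] exI[of _ "min r s"] conjI ballI)
    fix x assume "x \<in> ball a (min r s)"
    then have x: "vemb x \<in> ball (vemb a) r" "vemb x \<in> U"
      using s by (auto simp: dist_vemb)
    have eq: "ret (c \<alpha> * (\<Prod>i\<in>UNIV. (vemb x $ i - vemb a $ i) ^ \<alpha> i)) = ret (c \<alpha>) * (\<Prod>i\<in>UNIV. (x $ i - a $ i) ^ \<alpha> i)" for \<alpha>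
      using ret_mult[of "\<Prod>i\<in>UNIV. (x $ i - a $ i) ^ \<alpha> i" "c \<alpha>"]
      by (simp add: emb_prod emb_power emb.diff mult.commute)
    have "((\<lambda>\<alpha>. ret (c \<alpha> * (\<Prod>i\<in>UNIV. (vemb x $ i - vemb a $ i) ^ \<alpha> i))) has_sum ret (F (vemb x))) UNIV"
      by (rule has_sum_bounded_linear[OF bounded_linear_ret c[OF x(1)]])
    moreover have "F (vemb x) = emb (f x)"
      using assms(1) x(2) unfolding extends_def by blast
    ultimately show "((\<lambda>\<alpha>. ret (c \<alpha>) * (\<Prod>i\<in>UNIV. (x $ i - a $ i) ^ \<alpha> i)) has_sum f x) UNIV"
      by (simp only: eq ret_emb)
  qed (use r s in auto)
qed

text \<open>
  The estimate is stated after the embedding, because for complex series convergence and absolute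
  convergence are the same.
\<close>

lemma power_series_coefficients_summable:
  fixes f :: "'k ^ 'm \<Rightarrow> 'k"
  assumes r: "0 < r" and c: "\<And>x. x \<in> ball a r \<Longrightarrow> ((\<lambda>\<alpha>. c \<alpha> * (\<Prod>i\<in>UNIV. (x $ i - a $ i) ^ \<alpha> i)) has_sum f x) UNIV"
  shows "(\<lambda>\<alpha>. norm (emb (c \<alpha>)) * (r / (2 * real CARD('m))) ^ (\<Sum>i\<in>UNIV. \<alpha> i)) summable_on UNIV"
proof -
  define \<rho> where "\<rho> = r / (2 * real CARD('m))"
  have \<rho>: "0 < \<rho>" using r by (simp add: \<rho>_def)
  obtain s where "((\<lambda>\<alpha>. c \<alpha> * (\<Prod>i\<in>UNIV. of_real \<rho> ^ \<alpha> i)) has_sum s) UNIV"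
    using c[OF diagonal_point_in_ball[OF r, of a]] by (auto simp: \<rho>_def)
  then have "((\<lambda>\<alpha>. emb (c \<alpha> * (\<Prod>i\<in>UNIV. of_real \<rho> ^ \<alpha> i))) has_sum emb s) UNIV"
    by (rule has_sum_bounded_linear[OF bounded_linear_emb])
  then have "(\<lambda>\<alpha>. emb (c \<alpha>) * (\<Prod>i\<in>UNIV. complex_of_real \<rho> ^ \<alpha> i)) summable_on UNIV"
    by (auto simp: summable_on_def emb_mult emb_prod emb_power emb_of_real)
  then have "(\<lambda>\<alpha>. norm (emb (c \<alpha>) * (\<Prod>i\<in>UNIV. complex_of_real \<rho> ^ \<alpha> i))) summable_on UNIV"
    by (simp only: summable_on_iff_abs_summable_on_complex)
  then show ?thesis
    using \<rho> by (simp add: norm_mult prod_norm[symmetric] norm_power power_sum \<rho>_def[symmetric])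
qed

lemma power_series_imp_extends:
  fixes f :: "'k ^ 'm \<Rightarrow> 'k"
  assumes "has_power_series_at f a"
  obtains F U where "vemb a \<in> U" "extends F f U"
proof -
  obtain c r where r: "0 < r"
    and c: "\<And>x. x \<in> ball a r \<Longrightarrow> ((\<lambda>\<alpha>. c \<alpha> * (\<Prod>i\<in>UNIV. (x $ i - a $ i) ^ \<alpha> i)) has_sum f x) UNIV"
    using assms unfolding has_power_series_at_def by blast
  define \<rho> where "\<rho> = r / (2 * real CARD('m))"
  have \<rho>: "0 < \<rho>" using r by (simp add: \<rho>_def)
  have "(\<lambda>\<alpha>. norm (emb (c \<alpha>)) * \<rho> ^ (\<Sum>i\<in>UNIV. \<alpha> i)) summable_on UNIV"
    unfolding \<rho>_def by (rule power_series_coefficients_summable[OF r c])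
  from power_series_hol_on_ball[OF \<rho> this, of "vemb a"] obtain F where
    F: "\<And>z. z \<in> ball (vemb a) (\<rho> / 2) \<Longrightarrow> ((\<lambda>\<alpha>. emb (c \<alpha>) * (\<Prod>i\<in>UNIV. (z $ i - vemb a $ i) ^ \<alpha> i)) has_sum F z) UNIV"
    and hol: "hol_on F (ball (vemb a) (\<rho> / 2))" by blast
  have "extends F f (ball (vemb a) (min r (\<rho> / 2)))"
    unfolding extends_def
  proof (intro conjI allI impI open_ball)
    show "hol_on F (ball (vemb a) (min r (\<rho> / 2)))"
      by (rule hol_on_subset[OF hol]) auto
    fix x assume x: "vemb x \<in> ball (vemb a) (min r (\<rho> / 2))"
    then have "((\<lambda>\<alpha>. emb (c \<alpha> * (\<Prod>i\<in>UNIV. (x $ i - a $ i) ^ \<alpha> i))) has_sum emb (f x)) UNIV"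
      by (intro has_sum_bounded_linear[OF bounded_linear_emb] c) (simp add: dist_vemb)
    then have "((\<lambda>\<alpha>. emb (c \<alpha>) * (\<Prod>i\<in>UNIV. (vemb x $ i - vemb a $ i) ^ \<alpha> i)) has_sum emb (f x)) UNIV"
      by (simp add: emb_mult emb_prod emb_power emb.diff)
    then show "F (vemb x) = emb (f x)"
      using has_sum_unique F[of "vemb x"] x by auto
  qed
  then show ?thesis using that[of "ball (vemb a) (min r (\<rho> / 2))" F] r \<rho> by auto
qed

definition smooth_at :: "('k ^ 'm \<Rightarrow> 'k) \<Rightarrow> 'k ^ 'm \<Rightarrow> bool" where
  "smooth_at f a \<longleftrightarrow> (\<exists>U. open U \<and> a \<in> U \<and> smooth_on reg f U)"

lemma smooth_at_C_infinity:
  "reg = C_infinity \<Longrightarrow> smooth_at f a \<longleftrightarrow> (\<exists>U. open U \<and> a \<in> U \<and> (\<forall>k. Ck_on k f U))"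
  unfolding smooth_at_def smooth_on_def by simp

lemma smooth_at_Analytic:
  "reg = Analytic \<Longrightarrow> smooth_at f a \<longleftrightarrow> (\<exists>F U. vemb a \<in> U \<and> extends F f U)"
proof
  assume "reg = Analytic" "smooth_at f a"
  then have "has_power_series_at f a" unfolding smooth_at_def smooth_on_def by auto
  then obtain F U where "vemb a \<in> U" "extends F f U" by (rule power_series_imp_extends)
  then show "\<exists>F U. vemb a \<in> U \<and> extends F f U" by blast
next
  assume reg: "reg = Analytic" and "\<exists>F U. vemb a \<in> U \<and> extends F f U"
  then obtain F U where U: "vemb a \<in> U" "extends F f U" by blast
  have "open (vemb -` U)"
    using U(2) linear_continuous_on[OF bounded_linear_vemb]
    by (intro open_vimage) (auto simp: extends_def)
  then show "smooth_at f a"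
    unfolding smooth_at_def smooth_on_def
    using U extends_imp_power_series[OF U(2)] by (intro exI[of _ "vemb -` U"]) (simp add: reg)
qed

lemma smooth_on_iff_smooth_at: "open U \<Longrightarrow> smooth_on reg f U \<longleftrightarrow> (\<forall>a\<in>U. smooth_at f a)"
proof
  show "open U \<Longrightarrow> smooth_on reg f U \<Longrightarrow> \<forall>a\<in>U. smooth_at f a"
    unfolding smooth_at_def by blast
  assume "open U" and *: "\<forall>a\<in>U. smooth_at f a"
  show "smooth_on reg f U"
  proof (cases reg)
    case C_infinity
    have "Ck_on k f U" for k
      by (rule Ck_on_localI) (use * smooth_at_C_infinity[OF C_infinity] in blast)
    then show ?thesis by (simp add: smooth_on_def C_infinity)
  next
    case Analytic
    then show ?thesis using * unfolding smooth_on_def smooth_at_def by auto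
  qed
qed

lemma smooth_at_eventually: "smooth_at f a \<Longrightarrow> \<forall>\<^sub>F x in nhds a. smooth_at f x"
  unfolding smooth_at_def eventually_nhds by blast

lemma open_smooth_at: "open {x. smooth_at f x}"
proof (subst open_subopen, intro ballI)
  fix x assume "x \<in> {x. smooth_at f x}"
  then obtain U where "open U" "x \<in> U" "smooth_on reg f U" unfolding smooth_at_def by blast
  then show "\<exists>T. open T \<and> x \<in> T \<and> T \<subseteq> {x. smooth_at f x}"
    unfolding smooth_at_def by (intro exI[of _ U]) blast
qed

text \<open>
  An extension of \<open>f\<close> extends \<open>g\<close> once its domain is cut down to a complex ball that meets the
  scalar points only where \<open>f\<close> and \<open>g\<close> agree.
\<close>

lemma smooth_at_cong:
  fixes f :: "'k ^ 'm \<Rightarrow> 'k"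
  assumes f: "smooth_at f a" and eq: "\<forall>\<^sub>F x in nhds a. f x = g x"
  shows "smooth_at g a"
proof (cases reg)
  case C_infinity
  obtain U where U: "open U" "a \<in> U" "\<And>k. Ck_on k f U"
    using f smooth_at_C_infinity[OF C_infinity] by blast
  obtain N where N: "open N" "a \<in> N" "\<And>x. x \<in> N \<Longrightarrow> f x = g x"
    using eq unfolding eventually_nhds by blast
  have "Ck_on k g (U \<inter> N)" for k
    by (rule Ck_on_cong[of _ f]) (use U N in \<open>auto intro: Ck_on_subset\<close>)
  then show ?thesis
    unfolding smooth_at_C_infinity[OF C_infinity] using U N by blast
next
  case Analytic
  obtain F U where U: "vemb a \<in> U" "extends F f U"
    using f smooth_at_Analytic[OF Analytic] by blast
  obtain e where e: "0 < e" "\<And>x. dist x a < e \<Longrightarrow> f x = g x"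
    using eq unfolding eventually_nhds_metric by blast
  have "extends F g (U \<inter> ball (vemb a) e)"
    using U(2) e unfolding extends_def
    by (auto intro: hol_on_subset simp: dist_vemb dist_commute)
  then show ?thesis
    unfolding smooth_at_Analytic[OF Analytic] using U e by (metis Int_iff centre_in_ball)
qed

text \<open>
  Differentiating \<open>F \<circ> vemb = emb \<circ> f\<close> on both sides gives the last conjunct, by which derivatives of
  extensions are extensions of derivatives.
\<close>

lemma extends_has_derivative:
  fixes f :: "'k ^ 'm \<Rightarrow> 'k"
  assumes F: "extends F f U" and x: "vemb x \<in> U"
  shows "\<exists>D. (f has_derivative (\<lambda>v. ret (D (vemb v)))) (at x) \<and> (F has_derivative D) (at (vemb x)) \<and>
    (\<forall>c v. D (c *s v) = c * D v) \<and> (\<forall>v. emb (ret (D (vemb v))) = D (vemb v))"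
proof -
  obtain D where D: "(F has_derivative D) (at (vemb x))" "\<And>c v. D (c *s v) = c * D v"
    using F x unfolding extends_def hol_on_def by blast
  have FD: "((\<lambda>x. F (vemb x)) has_derivative (\<lambda>v. D (vemb v))) (at x)"
    by (rule has_derivative_compose[OF bounded_linear_imp_has_derivative[OF bounded_linear_vemb] D(1)])
  have opn: "open (vemb -` U)"
    using F linear_continuous_on[OF bounded_linear_vemb]
    by (intro open_vimage) (auto simp: extends_def)
  have eq: "F (vemb y) = emb (f y)" if "y \<in> vemb -` U" for y
    using F that unfolding extends_def by blast
  have "((\<lambda>x. ret (F (vemb x))) has_derivative (\<lambda>v. ret (D (vemb v)))) (at x)"
    by (rule bounded_linear.has_derivative[OF bounded_linear_ret FD])
  then have fD: "(f has_derivative (\<lambda>v. ret (D (vemb v)))) (at x)"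
    by (rule has_derivative_transform_within_open[OF _ opn]) (use x eq in \<open>auto simp: ret_emb\<close>)
  have "((\<lambda>x. emb (f x)) has_derivative (\<lambda>v. emb (ret (D (vemb v))))) (at x)"
    by (rule bounded_linear.has_derivative[OF bounded_linear_emb fD])
  moreover have "((\<lambda>x. emb (f x)) has_derivative (\<lambda>v. D (vemb v))) (at x)"
    by (rule has_derivative_transform_within_open[OF FD opn]) (use x eq in auto)
  ultimately have "(\<lambda>v. emb (ret (D (vemb v)))) = (\<lambda>v. D (vemb v))"
    by (rule has_derivative_unique)
  then have "emb (ret (D (vemb v))) = D (vemb v)" for v by (rule fun_cong)
  then show ?thesis using fD D by (intro exI[of _ D]) simp
qed

lemma smooth_at_has_derivative:
  fixes f :: "'k ^ 'm \<Rightarrow> 'k"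
  assumes "smooth_at f a"
  shows "(f has_derivative frechet_derivative f (at a)) (at a)"
    and "frechet_derivative f (at a) (c *s v) = c * frechet_derivative f (at a) v"
proof -
  have "\<exists>D. (f has_derivative D) (at a) \<and> (\<forall>c v. D (c *s v) = c * D v)"
  proof (cases reg)
    case C_infinity
    obtain U where U: "open U" "a \<in> U" "\<And>k. Ck_on k f U"
      using assms smooth_at_C_infinity[OF C_infinity] by blast
    have "f differentiable (at a)" using U(3)[of 1] U(2) by simp
    then obtain D where D: "(f has_derivative D) (at a)" unfolding differentiable_def by blast
    have "D (c *s v) = c * D v" for c v
    proof -
      obtain r where r: "c = of_real r" using of_real_if_C_infinity[OF C_infinity] .
      have "c *s v = r *\<^sub>R v" by (simp add: vec_eq_iff r scaleR_conv_of_real[where 'a = 'k])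
      then show ?thesis
        using linear_scale[OF has_derivative_linear[OF D]] by (simp add: r scaleR_conv_of_real[where 'a = 'k])
    qed
    with D show ?thesis by blast
  next
    case Analytic
    obtain F U where U: "vemb a \<in> U" "extends F f U"
      using assms smooth_at_Analytic[OF Analytic] by blast
    obtain D where "(f has_derivative (\<lambda>v. ret (D (vemb v)))) (at a) \<and> (F has_derivative D) (at (vemb a)) \<and>
        (\<forall>c v. D (c *s v) = c * D v) \<and> (\<forall>v. emb (ret (D (vemb v))) = D (vemb v))"
      using extends_has_derivative[OF U(2,1)] by (rule exE)
    then have D: "(f has_derivative (\<lambda>v. ret (D (vemb v)))) (at a)" "(F has_derivative D) (at (vemb a))"
      "\<And>c v. D (c *s v) = c * D v" "\<And>v. emb (ret (D (vemb v))) = D (vemb v)"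
      by simp_all
    show ?thesis
      by (rule exI, rule conjI[OF D(1)]) (simp add: vemb_smult D(3) ret_mult)
  qed
  then obtain D where D: "(f has_derivative D) (at a)" "\<And>c v. D (c *s v) = c * D v" by blast
  have "D = frechet_derivative f (at a)" by (rule frechet_derivative_at[OF D(1)])
  with D show "(f has_derivative frechet_derivative f (at a)) (at a)"
    "frechet_derivative f (at a) (c *s v) = c * frechet_derivative f (at a) v" by auto
qed

lemma smooth_at_isCont: "smooth_at f a \<Longrightarrow> isCont f a"
  by (rule has_derivative_continuous[OF smooth_at_has_derivative(1)])

lemma smooth_at_derivative:
  fixes f :: "'k ^ 'm \<Rightarrow> 'k"
  assumes "smooth_at f a"
  shows "smooth_at (\<lambda>x. frechet_derivative f (at x) v) a"
proof (cases reg)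
  case C_infinity
  obtain U where U: "open U" "a \<in> U" "\<And>k. Ck_on k f U"
    using assms smooth_at_C_infinity[OF C_infinity] by blast
  have "Ck_on k (\<lambda>x. frechet_derivative f (at x) v) U" for k
    using U(3)[of "Suc k"] by simp
  then show ?thesis unfolding smooth_at_C_infinity[OF C_infinity] using U by blast
next
  case Analytic
  obtain F U where U: "vemb a \<in> U" "extends F f U"
    using assms smooth_at_Analytic[OF Analytic] by blast
  have "extends (\<lambda>z. frechet_derivative F (at z) (vemb v)) (\<lambda>x. frechet_derivative f (at x) v) U"
    unfolding extends_def
  proof (intro conjI allI impI)
    show "open U" using U by (simp add: extends_def)
    show "hol_on (\<lambda>z. frechet_derivative F (at z) (vemb v)) U"
      using U by (intro hol_on_frechet_derivative) (auto simp: extends_def)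
    fix x assume x: "vemb x \<in> U"
    obtain D where "(f has_derivative (\<lambda>v. ret (D (vemb v)))) (at x) \<and> (F has_derivative D) (at (vemb x)) \<and>
        (\<forall>c v. D (c *s v) = c * D v) \<and> (\<forall>v. emb (ret (D (vemb v))) = D (vemb v))"
      using extends_has_derivative[OF U(2) x] by (rule exE)
    then have D: "(f has_derivative (\<lambda>v. ret (D (vemb v)))) (at x)" "(F has_derivative D) (at (vemb x))"
      "\<And>c v. D (c *s v) = c * D v" "\<And>v. emb (ret (D (vemb v))) = D (vemb v)"
      by simp_all
    show "frechet_derivative F (at (vemb x)) (vemb v) = emb (frechet_derivative f (at x) v)"
      by (simp only: frechet_derivative_at[OF D(1), symmetric] frechet_derivative_at[OF D(2), symmetric] D(4))
  qed
  then show ?thesis unfolding smooth_at_Analytic[OF Analytic] using U by blast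
qed

lemma smooth_at_const: "smooth_at (\<lambda>x. c) a"
proof (cases reg)
  case C_infinity
  then show ?thesis unfolding smooth_at_C_infinity[OF C_infinity]
    by (intro exI[of _ UNIV]) (auto intro: Ck_on_const)
next
  case Analytic
  have "extends (\<lambda>z. emb c) (\<lambda>x. c) UNIV" by (auto simp: extends_def hol_on_const)
  then show ?thesis unfolding smooth_at_Analytic[OF Analytic] by blast
qed

lemma smooth_at_nth: "smooth_at (\<lambda>x. x $ i) a"
proof (cases reg)
  case C_infinity
  then show ?thesis unfolding smooth_at_C_infinity[OF C_infinity]
    by (intro exI[of _ UNIV]) (auto intro: Ck_on_bounded_linear)
next
  case Analytic
  have "extends (\<lambda>z. z $ i) (\<lambda>x. x $ i) UNIV" by (auto simp: extends_def hol_on_nth)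
  then show ?thesis unfolding smooth_at_Analytic[OF Analytic] by blast
qed

text \<open>
  A pattern common to sum, product and exponential: an operation that preserves both kinds
  of regularity and commutes with the embedding.
\<close>

lemma smooth_at_binary:
  fixes f g :: "'k ^ 'm \<Rightarrow> 'k"
  assumes fg: "smooth_at f a" "smooth_at g a"
    and Ck: "\<And>k U. open U \<Longrightarrow> Ck_on k f U \<Longrightarrow> Ck_on k g U \<Longrightarrow> Ck_on k (\<lambda>x. B (f x) (g x)) U"
    and hol: "\<And>F G U. hol_on F U \<Longrightarrow> hol_on G U \<Longrightarrow> hol_on (\<lambda>x :: complex ^ 'm. B' (F x) (G x)) U"
    and emb: "\<And>x y. emb (B x y) = B' (emb x) (emb y)"
  shows "smooth_at (\<lambda>x. B (f x) (g x)) a"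
proof (cases reg)
  case C_infinity
  obtain U where U: "open U" "a \<in> U" "\<And>k. Ck_on k f U"
    using fg(1) smooth_at_C_infinity[OF C_infinity] by blast
  obtain V where V: "open V" "a \<in> V" "\<And>k. Ck_on k g V"
    using fg(2) smooth_at_C_infinity[OF C_infinity] by blast
  have "Ck_on k (\<lambda>x. B (f x) (g x)) (U \<inter> V)" for k
    by (intro Ck open_Int U V Ck_on_subset[OF U(3)] Ck_on_subset[OF V(3)]) auto
  then show ?thesis unfolding smooth_at_C_infinity[OF C_infinity] using U V by blast
next
  case Analytic
  obtain F U where U: "vemb a \<in> U" "extends F f U"
    using fg(1) smooth_at_Analytic[OF Analytic] by blast
  obtain G V where V: "vemb a \<in> V" "extends G g V"
    using fg(2) smooth_at_Analytic[OF Analytic] by blast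
  have "extends (\<lambda>x. B' (F x) (G x)) (\<lambda>x. B (f x) (g x)) (U \<inter> V)"
    unfolding extends_def
  proof (intro conjI allI impI)
    show "hol_on (\<lambda>x. B' (F x) (G x)) (U \<inter> V)"
      using U V by (intro hol) (auto simp: extends_def intro: hol_on_subset)
  qed (use U V in \<open>auto simp: extends_def emb\<close>)
  then show ?thesis unfolding smooth_at_Analytic[OF Analytic] using U V by blast
qed

lemma smooth_at_add: "smooth_at f a \<Longrightarrow> smooth_at g a \<Longrightarrow> smooth_at (\<lambda>x. f x + g x) a"
  by (rule smooth_at_binary[where B = "(+)" and B' = "(+)"]) (auto intro: Ck_on_add hol_on_add simp: emb.add)

lemma smooth_at_mult: "smooth_at f a \<Longrightarrow> smooth_at g a \<Longrightarrow> smooth_at (\<lambda>x. f x * g x) a"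
  by (rule smooth_at_binary[where B = "(*)" and B' = "(*)"]) (auto intro: Ck_on_mult hol_on_mult simp: emb_mult)

lemma smooth_at_exp: "smooth_at f a \<Longrightarrow> smooth_at (\<lambda>x. exp (f x)) a"
  by (rule smooth_at_binary[where B = "\<lambda>x y. exp x" and B' = "\<lambda>x y. exp x" and g = f])
    (auto intro: Ck_on_exp hol_on_exp simp: emb_exp)

lemma smooth_at_minus: "smooth_at f a \<Longrightarrow> smooth_at (\<lambda>x. - f x) a"
  using smooth_at_mult[OF smooth_at_const[of "-1"]] by fastforce

lemma smooth_at_diff: "smooth_at f a \<Longrightarrow> smooth_at g a \<Longrightarrow> smooth_at (\<lambda>x. f x - g x) a"
  using smooth_at_add[OF _ smooth_at_minus] by fastforce

lemma smooth_at_sum: "(\<And>i. i \<in> I \<Longrightarrow> smooth_at (f i) a) \<Longrightarrow> smooth_at (\<lambda>x. \<Sum>i\<in>I. f i x) a"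
  by (induction I rule: infinite_finite_induct) (auto intro: smooth_at_const smooth_at_add)

lemma smooth_at_prod: "(\<And>i. i \<in> I \<Longrightarrow> smooth_at (f i) a) \<Longrightarrow> smooth_at (\<lambda>x. \<Prod>i\<in>I. f i x) a"
  by (induction I rule: infinite_finite_induct) (auto intro: smooth_at_const smooth_at_mult)

lemma smooth_at_compose:
  fixes G :: "'k ^ 'm \<Rightarrow> 'k ^ 'p"
  assumes f: "smooth_at f (G a)" and G: "\<And>i. smooth_at (\<lambda>x. G x $ i) a"
  shows "smooth_at (\<lambda>x. f (G x)) a"
proof (cases reg)
  case C_infinity
  obtain V where V: "open V" "G a \<in> V" "\<And>k. Ck_on k f V"
    using f smooth_at_C_infinity[OF C_infinity] by blast
  have "\<forall>i. \<exists>U. open U \<and> a \<in> U \<and> (\<forall>k. Ck_on k (\<lambda>x. G x $ i) U)"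
    using G smooth_at_C_infinity[OF C_infinity] by blast
  then obtain U where U: "\<And>i. open (U i)" "\<And>i. a \<in> U i" "\<And>i k. Ck_on k (\<lambda>x. G x $ i) (U i)"
    by metis
  define U0 where "U0 = (\<Inter>i. U i)"
  have U0: "open U0" "a \<in> U0" using U by (auto simp: U0_def)
  have G0: "Ck_on k G U0" for k
    by (rule Ck_on_vecI[OF U0(1)]) (rule Ck_on_subset[OF U(3)], auto simp: U0_def)
  have "open (U0 \<inter> G -` V)"
    using G0[of 0] by (intro continuous_open_preimage U0 V) simp
  moreover have "Ck_on k (\<lambda>x. f (G x)) (U0 \<inter> G -` V)" for k
    by (rule Ck_on_compose[OF calculation V(1,3) Ck_on_subset[OF G0]]) auto
  ultimately show ?thesis unfolding smooth_at_C_infinity[OF C_infinity] using U0 V by blast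
next
  case Analytic
  obtain F V where V: "vemb (G a) \<in> V" "extends F f V"
    using f smooth_at_Analytic[OF Analytic] by blast
  have "\<forall>i. \<exists>F U. vemb a \<in> U \<and> extends F (\<lambda>x. G x $ i) U"
    using G smooth_at_Analytic[OF Analytic] by blast
  then obtain H U where U: "\<And>i. vemb a \<in> U i" "\<And>i. extends (H i) (\<lambda>x. G x $ i) (U i)"
    by metis
  define H' where "H' z = (\<chi> i. H i z)" for z
  define U0 where "U0 = (\<Inter>i. U i)"
  have U0: "open U0" "vemb a \<in> U0" using U by (auto simp: U0_def extends_def)
  have hol: "hol_on (\<lambda>x. H' x $ i) U0" for i
    using U(2)[of i] by (auto simp: H'_def U0_def extends_def intro: hol_on_subset)
  have H'_eq: "H' (vemb x) = vemb (G x)" if "vemb x \<in> U0" for x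
    using U(2) that by (auto simp: vec_eq_iff H'_def U0_def extends_def)
  have "continuous_on U0 (\<lambda>x. \<chi> i. H' x $ i)"
    by (intro continuous_on_vec_lambda hol_on_continuous hol)
  then have opn: "open (U0 \<inter> H' -` V)"
    using V U0 by (intro continuous_open_preimage) (auto simp: extends_def)
  have "extends (\<lambda>z. F (H' z)) (\<lambda>x. f (G x)) (U0 \<inter> H' -` V)"
    unfolding extends_def
  proof (intro conjI allI impI opn)
    show "hol_on (\<lambda>z. F (H' z)) (U0 \<inter> H' -` V)"
      by (rule hol_on_compose[of F V]) (use V hol in \<open>auto simp: extends_def intro: hol_on_subset\<close>)
    fix x assume "vemb x \<in> U0 \<inter> H' -` V"
    then show "F (H' (vemb x)) = emb (f (G x))"
      using V(2) H'_eq[of x] by (auto simp: extends_def)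
  qed
  moreover have "vemb a \<in> U0 \<inter> H' -` V" using U0 V H'_eq[of a] by auto
  ultimately show ?thesis
    unfolding smooth_at_Analytic[OF Analytic]
    by (intro exI[of _ "\<lambda>z. F (H' z)"] exI[of _ "U0 \<inter> H' -` V"] conjI)
qed

end

section \<open>Smoothness of implicit functions\<close>

lemma time_slice_has_field_derivative:
  fixes F :: "'k::real_normed_field ^ ('m::finite option) \<Rightarrow> 'k"
  assumes "(F has_derivative L) (at (time_space t x))" and lin: "\<And>c v. L (c *s v) = c * L v"
  shows "((\<lambda>t. F (time_space t x)) has_field_derivative L (axis None 1)) (at t)"
proof -
  have "((\<lambda>t. time_space t x) has_derivative (\<lambda>h. time_space h 0)) (at t)"
    by (rule has_derivative_time_space[OF has_derivative_ident has_derivative_const])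
  from has_derivative_compose[OF this assms(1)]
  have "((\<lambda>t. F (time_space t x)) has_derivative (\<lambda>h. L (time_space h 0))) (at t)" .
  moreover have "(\<lambda>h. L (time_space h 0)) = (*) (L (axis None 1))"
  proof
    fix h :: 'k
    have "time_space h 0 = h *s (axis None 1 :: 'k ^ ('m option))"
      by (simp add: vec_option_eq_iff axis_def)
    then show "L (time_space h 0) = L (axis None 1) * h" by (simp add: lin mult.commute)
  qed
  ultimately show ?thesis unfolding has_field_derivative_def by (simp only:)
qed

context scalar_regularity
begin

text \<open>
  A continuous solution of a smooth equation with non-vanishing slope is smooth. For \<open>C_infinity\<close>,
  the formula for the derivative of \<open>u\<close> shows that \<open>u\<close> is \<open>C\<^sup>k\<^sup>+\<^sup>1\<close> if it is \<open>C\<^sup>k\<close>. In the analytic cases, the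
  extended equation has a holomorphic solution by the complex implicit function theorem, and by
  uniqueness it takes the values of \<open>u\<close> at scalar points.
\<close>

lemma smooth_at_implicit:
  fixes F :: "'k ^ ('m::finite option) \<Rightarrow> 'k" and u :: "'k ^ 'm \<Rightarrow> 'k"
  assumes U: "open U" "a \<in> U" and contu: "continuous_on U u"
    and eq: "\<And>x. x \<in> U \<Longrightarrow> F (time_space (u x) x) = 0"
    and sm: "\<And>x. x \<in> U \<Longrightarrow> smooth_at F (time_space (u x) x)"
    and nz: "\<And>x. x \<in> U \<Longrightarrow> frechet_derivative F (at (time_space (u x) x)) (axis None 1) \<noteq> 0"
  shows "smooth_at u a"
proof (cases reg)
  case C_infinity
  let ?p = "\<lambda>x. time_space (u x) x" and ?L = "\<lambda>q. frechet_derivative F (at q)"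
  obtain V where V: "open V" "?p a \<in> V" "\<And>k. Ck_on k F V"
    using sm[OF U(2)] smooth_at_C_infinity[OF C_infinity] by blast
  have "continuous_on U ?p" by (intro continuous_intros contu)
  then have U': "open (U \<inter> ?p -` V)" by (intro continuous_open_preimage U V)
  let ?U = "U \<inter> ?p -` V"
  have deriv: "(u has_derivative (\<lambda>v. (-1) * (?L (?p x) (time_space 0 v) * inverse (?L (?p x) (axis None 1))))) (at x)" if x: "x \<in> ?U" for x
  proof -
    have xU: "x \<in> U" using x by simp
    have "(u has_derivative (\<lambda>v. - ?L (?p x) (time_space 0 v) / ?L (?p x) (axis None 1))) (at x)"
    proof (rule implicit_has_derivative)
      show "isCont u x" using contu U(1) xU by (simp add: continuous_on_eq_continuous_at)
      show "\<forall>\<^sub>F y in nhds x. F (?p y) = F (?p x)"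
        using U(1) xU eq unfolding eventually_nhds by metis
    qed (use smooth_at_has_derivative[OF sm[OF xU]] nz[OF xU] in auto)
    then show ?thesis by (simp add: divide_inverse)
  qed
  have "Ck_on k u ?U" for k
  proof (induction k)
    case 0
    show ?case using contu by (auto intro: continuous_on_subset)
  next
    case (Suc k)
    have p: "Ck_on k ?p ?U"
    proof (rule Ck_on_vecI[OF U'])
      show "Ck_on k (\<lambda>x. ?p x $ i) ?U" for i
        using Suc by (cases i) (auto intro: Ck_on_bounded_linear[OF _ U'])
    qed
    have L: "Ck_on k (\<lambda>x. ?L (?p x) v) ?U" for v
    proof (rule Ck_on_compose[OF U' V(1) _ p])
      show "Ck_on k (\<lambda>q. ?L q v) V" using V(3)[of "Suc k"] by simp
    qed simp
    show ?case
      by (rule Ck_on_SucI[OF U' deriv], assumption)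
        (intro Ck_on_mult Ck_on_inverse Ck_on_const L U', use nz in auto)
  qed
  then show ?thesis
    unfolding smooth_at_C_infinity[OF C_infinity] using U' U V by (intro exI[of _ ?U]) auto
next
  case Analytic
  obtain G O' where O': "vemb (time_space (u a) a) \<in> O'" "extends G F O'"
    using sm[OF U(2)] smooth_at_Analytic[OF Analytic] by blast
  have openO: "open O'" and holG: "hol_on G O'" and GF: "\<And>q. vemb q \<in> O' \<Longrightarrow> G (vemb q) = emb (F q)"
    using O'(2) unfolding extends_def by blast+
  let ?q = "\<lambda>(z, w). time_space w z :: complex ^ ('m option)"
  let ?W = "?q -` O'"
  let ?d = "\<lambda>z w. frechet_derivative G (at (time_space w z)) (axis None 1)"
  have contq: "continuous_on S ?q" for S :: "((complex ^ 'm) \<times> complex) set"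
    by (simp only: case_prod_beta') (intro continuous_intros)
  have G': "(G has_derivative frechet_derivative G (at q)) (at q)" 
    "frechet_derivative G (at q) (c *s v) = c * frechet_derivative G (at q) v" if "q \<in> O'" for q c v
  proof -
    obtain D where D: "(G has_derivative D) (at q)" "\<And>c v. D (c *s v) = c * D v"
      using holG \<open>q \<in> O'\<close> unfolding hol_on_def by blast
    then show "(G has_derivative frechet_derivative G (at q)) (at q)" 
      "frechet_derivative G (at q) (c *s v) = c * frechet_derivative G (at q) v"
      using frechet_derivative_at[OF D(1)] by auto
  qed
  have W: "open ?W" by (rule open_vimage[OF openO contq])
  have contW: "continuous_on ?W (\<lambda>(z, w). h (time_space w z))" if "continuous_on O' h" for h :: "_ \<Rightarrow> complex"
  proof -
    have "continuous_on ?W (\<lambda>x. h (?q x))" by (rule continuous_on_compose2[OF that contq]) auto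
    then show ?thesis by (simp only: case_prod_beta')
  qed
  have zw0: "?q (vemb a, emb (u a)) = vemb (time_space (u a) a)" by (simp add: vemb_time_space)
  have slope: "?d (vemb a) (emb (u a)) = emb (frechet_derivative F (at (time_space (u a) a)) (axis None 1))"
  proof -
    obtain D where "(F has_derivative (\<lambda>v. ret (D (vemb v)))) (at (time_space (u a) a)) \<and>
        (G has_derivative D) (at (vemb (time_space (u a) a))) \<and>
        (\<forall>c v. D (c *s v) = c * D v) \<and> (\<forall>v. emb (ret (D (vemb v))) = D (vemb v))"
      using extends_has_derivative[OF O'(2,1)] by (rule exE)
    then have D: "(F has_derivative (\<lambda>v. ret (D (vemb v)))) (at (time_space (u a) a))"
        "(G has_derivative D) (at (vemb (time_space (u a) a)))" "\<And>v. emb (ret (D (vemb v))) = D (vemb v)"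
      by simp_all
    show ?thesis
      using D(3)[of "axis None 1"]
      by (simp only: frechet_derivative_at[OF D(1), symmetric] frechet_derivative_at[OF D(2), symmetric]
          vemb_time_space[symmetric] vemb_axis)
  qed
  have slope_nz: "?d (vemb a) (emb (u a)) \<noteq> 0"
    using nz[OF U(2)] slope norm_emb by (metis norm_eq_zero)
  have in_W: "{vemb a} \<times> {emb (u a)} \<subseteq> ?W" using O' zw0 by auto
  have derivW: "((\<lambda>w. G (time_space w z)) has_field_derivative ?d z w) (at w)" if "(z, w) \<in> ?W" for z w
    using that by (intro time_slice_has_field_derivative G') auto
  have zero: "G (time_space (emb (u a)) z) = 0" if "z \<in> {vemb a}" for z
    using GF[OF O'(1)] eq[OF U(2)] that by (simp add: vemb_time_space emb.zero)
  have slopeW: "?d z (emb (u a)) = ?d (vemb a) (emb (u a))" if "z \<in> {vemb a}" for z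
    using that by simp
  have "\<exists>V r g. open V \<and> {vemb a} \<subseteq> V \<and> 0 < r \<and> V \<times> cball (emb (u a)) r \<subseteq> ?W \<and> continuous_on V g \<and>
    (\<forall>z\<in>V. g z \<in> cball (emb (u a)) r \<and> G (time_space (g z) z) = 0 \<and>
      (\<forall>w\<in>cball (emb (u a)) r. ?d z w \<noteq> 0 \<and> (G (time_space w z) = 0 \<longrightarrow> w = g z)))"
    by (rule implicit_function_exists[OF _ W in_W contW[OF hol_on_continuous[OF holG]] derivW
          contW[OF hol_on_continuous[OF hol_on_frechet_derivative[OF holG openO]]] zero slopeW slope_nz]) simp
  then obtain V r g where V: "open V" "{vemb a} \<subseteq> V" "0 < r" "V \<times> cball (emb (u a)) r \<subseteq> ?W" "continuous_on V g"
    and g_all: "\<forall>z\<in>V. g z \<in> cball (emb (u a)) r \<and> G (time_space (g z) z) = 0 \<and>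
      (\<forall>w\<in>cball (emb (u a)) r. ?d z w \<noteq> 0 \<and> (G (time_space w z) = 0 \<longrightarrow> w = g z))"
    by (elim exE conjE)
  have g: "g z \<in> cball (emb (u a)) r" "G (time_space (g z) z) = 0" if "z \<in> V" for z
    using g_all that by blast+
  have g_unique: "w = g z" if "z \<in> V" "w \<in> cball (emb (u a)) r" "G (time_space w z) = 0" for z w
    using g_all that by blast
  have g_nz: "?d z w \<noteq> 0" if "z \<in> V" "w \<in> cball (emb (u a)) r" for z w
    using g_all that by blast
  have VO: "time_space w z \<in> O'" if "z \<in> V" "w \<in> cball (emb (u a)) r" for z w
    using subsetD[OF V(4), of "(z, w)"] that by simp
  have "hol_on g V"
    unfolding hol_on_def
  proof
    fix z assume z: "z \<in> V"
    have q: "time_space (g z) z \<in> O'" by (rule VO[OF z g(1)[OF z]])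
    have "(g has_derivative (\<lambda>v. - frechet_derivative G (at (time_space (g z) z)) (time_space 0 v) / ?d z (g z))) (at z)"
    proof (rule implicit_has_derivative)
      show "(G has_derivative frechet_derivative G (at (time_space (g z) z))) (at (time_space (g z) z))"
        by (rule G'(1)[OF q])
      show "frechet_derivative G (at (time_space (g z) z)) (c *s v) = c * frechet_derivative G (at (time_space (g z) z)) v" for c v
        by (rule G'(2)[OF q])
      show "?d z (g z) \<noteq> 0" by (rule g_nz[OF z g(1)[OF z]])
      show "isCont g z" using V(1,5) z by (simp add: continuous_on_eq_continuous_at)
      show "\<forall>\<^sub>F y in nhds z. G (time_space (g y) y) = G (time_space (g z) z)"
        using V(1) z g(2) unfolding eventually_nhds by metis
    qed
    moreover have "frechet_derivative G (at (time_space (g z) z)) (time_space 0 (c *s v)) =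
        c * frechet_derivative G (at (time_space (g z) z)) (time_space 0 v)" for c v
      using G'(2)[OF q, of c "time_space 0 v"] time_space_smult[of c 0 v] by simp
    ultimately show "\<exists>D. (g has_derivative D) (at z) \<and> (\<forall>c v. D (c *s v) = c * D v)"
      by (intro exI[of _ "\<lambda>v. - frechet_derivative G (at (time_space (g z) z)) (time_space 0 v) / ?d z (g z)"]) simp
  qed
  moreover obtain e where e: "0 < e" "\<And>x. dist x a < e \<Longrightarrow> x \<in> U \<and> u x \<in> cball (u a) r"
  proof -
    have "continuous (at a) u" using contu U by (simp add: continuous_on_eq_continuous_at)
    then have "\<forall>\<^sub>F x in nhds a. dist (u x) (u a) < r"
      using tendsto_at_iff_tendsto_nhds[of u a] V(3) by (auto simp: isCont_def tendsto_iff)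
    moreover have "\<forall>\<^sub>F x in nhds a. x \<in> U" using U by (rule eventually_nhds_in_open)
    ultimately have "\<forall>\<^sub>F x in nhds a. x \<in> U \<and> u x \<in> cball (u a) r"
      by eventually_elim (simp add: dist_commute)
    then show ?thesis using that unfolding eventually_nhds_metric by blast
  qed
  ultimately have "extends g u (V \<inter> ball (vemb a) e)"
    unfolding extends_def
  proof (intro conjI allI impI)
    fix x assume x: "vemb x \<in> V \<inter> ball (vemb a) e"
    then have xU: "x \<in> U" "u x \<in> cball (u a) r" using e(2)[of x] by (auto simp: dist_vemb dist_commute)
    have ball: "emb (u x) \<in> cball (emb (u a)) r"
      using xU(2) norm_emb[of "u a - u x"] by (simp add: dist_norm emb.diff)
    then have "vemb (time_space (u x) x) \<in> O'" using VO x by (auto simp: vemb_time_space)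
    then have "G (time_space (emb (u x)) (vemb x)) = 0"
      using GF eq[OF xU(1)] by (simp add: vemb_time_space[symmetric] emb.zero)
    then show "g (vemb x) = emb (u x)" using g_unique[of "vemb x"] ball x by auto
  qed (use V in \<open>auto intro: hol_on_subset\<close>)
  moreover have "vemb a \<in> V \<inter> ball (vemb a) e" using V e by auto
  ultimately show ?thesis unfolding smooth_at_Analytic[OF Analytic]
    by (intro exI[of _ g] exI[of _ "V \<inter> ball (vemb a) e"] conjI)
qed

lemma smooth_implicit_function:
  fixes F :: "'k ^ ('m::finite option) \<Rightarrow> 'k" and C :: "('k ^ 'm) set"
  assumes C: "compact C" and sm: "\<And>p. p \<in> C \<Longrightarrow> smooth_at F (time_space b p)"
    and zero: "\<And>p. p \<in> C \<Longrightarrow> F (time_space b p) = 0"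
    and slope: "\<And>p. p \<in> C \<Longrightarrow> frechet_derivative F (at (time_space b p)) (axis None 1) = c" "c \<noteq> 0"
  shows "\<exists>V r g. open V \<and> C \<subseteq> V \<and> 0 < r \<and>
    (\<forall>p\<in>V. g p \<in> cball b r \<and> F (time_space (g p) p) = 0 \<and> smooth_at g p \<and>
      (\<forall>u\<in>cball b r. F (time_space u p) = 0 \<longrightarrow> u = g p))"
proof -
  let ?q = "\<lambda>(p, u). time_space u p :: 'k ^ ('m option)"
  let ?W = "?q -` {q. smooth_at F q}"
  let ?d = "\<lambda>p u. frechet_derivative F (at (time_space u p)) (axis None 1)"
  have contq: "continuous_on S ?q" for S :: "(('k ^ 'm) \<times> 'k) set"
    by (simp only: case_prod_beta') (intro continuous_intros)
  have W: "open ?W" by (rule open_vimage[OF open_smooth_at contq])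
  have contW: "continuous_on ?W (\<lambda>(p, u). h (time_space u p))" if "continuous_on {q. smooth_at F q} h" for h :: "_ \<Rightarrow> 'k"
  proof -
    have "continuous_on ?W (\<lambda>x. h (?q x))" by (rule continuous_on_compose2[OF that contq]) auto
    then show ?thesis by (simp only: case_prod_beta')
  qed
  have contF: "continuous_on {q. smooth_at F q} F"
    by (intro continuous_at_imp_continuous_on ballI smooth_at_isCont) simp
  have contd: "continuous_on {q. smooth_at F q} (\<lambda>q. frechet_derivative F (at q) (axis None 1))"
    by (intro continuous_at_imp_continuous_on ballI smooth_at_isCont smooth_at_derivative) simp
  have in_W: "C \<times> {b} \<subseteq> ?W" using sm by auto
  have derivW: "((\<lambda>u. F (time_space u p)) has_field_derivative ?d p u) (at u)" if "(p, u) \<in> ?W" for p u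
    using that by (intro time_slice_has_field_derivative smooth_at_has_derivative) auto
  have "\<exists>V r g. open V \<and> C \<subseteq> V \<and> 0 < r \<and> V \<times> cball b r \<subseteq> ?W \<and> continuous_on V g \<and>
    (\<forall>p\<in>V. g p \<in> cball b r \<and> F (time_space (g p) p) = 0 \<and>
      (\<forall>u\<in>cball b r. ?d p u \<noteq> 0 \<and> (F (time_space u p) = 0 \<longrightarrow> u = g p)))"
    by (rule implicit_function_exists[OF C W in_W contW[OF contF] derivW contW[OF contd] zero slope])
  then obtain V r g where V: "open V" "C \<subseteq> V" "0 < r" "V \<times> cball b r \<subseteq> ?W" "continuous_on V g"
    and g_all: "\<forall>p\<in>V. g p \<in> cball b r \<and> F (time_space (g p) p) = 0 \<and>
      (\<forall>u\<in>cball b r. ?d p u \<noteq> 0 \<and> (F (time_space u p) = 0 \<longrightarrow> u = g p))"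
    by (elim exE conjE)
  have g: "g p \<in> cball b r" "F (time_space (g p) p) = 0" if "p \<in> V" for p
    using g_all that by blast+
  have g_nz: "?d p u \<noteq> 0" if "p \<in> V" "u \<in> cball b r" for p u
    using g_all that by blast
  have VW: "smooth_at F (time_space u p)" if "p \<in> V" "u \<in> cball b r" for p u
    using subsetD[OF V(4), of "(p, u)"] that by simp
  have sg: "smooth_at g p" if "p \<in> V" for p
  proof (rule smooth_at_implicit[where F = F, OF V(1) that V(5)])
    fix x assume x: "x \<in> V"
    show "F (time_space (g x) x) = 0" "smooth_at F (time_space (g x) x)"
      "frechet_derivative F (at (time_space (g x) x)) (axis None 1) \<noteq> 0"
      by (fact g(2)[OF x] VW[OF x g(1)[OF x]] g_nz[OF x g(1)[OF x]])+
  qed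
  show ?thesis
    using V(1-3) g sg g_all by (intro exI[of _ V] exI[of _ r] exI[of _ g]) blast
qed

end

section \<open>Primitives with respect to the weighted Euler field\<close>

text \<open>
  The scaling \<open>x \<mapsto> (s\<^bsup>w\<^sub>i\<^esup> x\<^sub>i)\<^sub>i\<close> is the flow of the weighted Euler field at time \<open>ln s\<close>, extended to \<open>s = 0\<close>.
\<close>

definition weighted_scale :: "('m \<Rightarrow> nat) \<Rightarrow> real \<Rightarrow> 'k::real_vector ^ 'm \<Rightarrow> 'k ^ 'm" where
  "weighted_scale w s x = (\<chi> i. s ^ w i *\<^sub>R x $ i)"

lemma weighted_scale_nth [simp]: "weighted_scale w s x $ i = s ^ w i *\<^sub>R x $ i"
  by (simp add: weighted_scale_def)

lemma norm_weighted_scale_le: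
  fixes x :: "'k::real_normed_vector ^ 'm"
  assumes "0 \<le> s" "s \<le> 1"
  shows "norm (weighted_scale w s x) \<le> norm x"
  unfolding norm_vec_def
proof (rule L2_set_mono)
  show "norm (weighted_scale w s x $ i) \<le> norm (x $ i)" for i
    using mult_right_mono[OF power_le_one[OF assms, of "w i"] norm_ge_zero[of "x $ i"]] assms by simp
qed simp

lemma bounded_linear_weighted_scale: "bounded_linear (weighted_scale w s :: 'k::real_normed_vector ^ 'm \<Rightarrow> _)"
proof -
  have "bounded_linear (\<lambda>x :: 'k ^ 'm. \<Sum>i\<in>UNIV. axis i (s ^ w i *\<^sub>R x $ i))"
    by (intro bounded_linear_sum bounded_linear_compose[OF bounded_linear_axis]
        bounded_linear_compose[OF bounded_linear_scaleR_right] bounded_linear_vec_nth)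
  also have "(\<lambda>x :: 'k ^ 'm. \<Sum>i\<in>UNIV. axis i (s ^ w i *\<^sub>R x $ i)) = weighted_scale w s"
    by (auto simp: vec_eq_iff fun_eq_iff axis_def if_distrib cong: if_cong)
  finally show ?thesis .
qed

lemma continuous_on_weighted_scale [continuous_intros]:
  fixes f :: "'a::topological_space \<Rightarrow> 'k::real_normed_vector ^ 'm"
  shows "continuous_on S g \<Longrightarrow> continuous_on S f \<Longrightarrow> continuous_on S (\<lambda>x. weighted_scale w (g x) (f x))"
  unfolding weighted_scale_def by (intro continuous_on_vec_lambda) (auto intro!: continuous_intros)

definition euler_vector :: "('m \<Rightarrow> nat) \<Rightarrow> 'k::real_normed_field ^ 'm \<Rightarrow> 'k ^ 'm" where
  "euler_vector w x = (\<chi> i. of_nat (w i) * x $ i)"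

lemma euler_vector_nth [simp]: "euler_vector w x $ i = of_nat (w i) * x $ i"
  by (simp add: euler_vector_def)

context scalar_regularity
begin

lemma frechet_derivative_expand:
  fixes f :: "'k ^ 'm \<Rightarrow> 'k"
  assumes "smooth_at f x"
  shows "frechet_derivative f (at x) v = (\<Sum>i\<in>UNIV. v $ i * frechet_derivative f (at x) (axis i 1))"
proof -
  have lin: "linear (frechet_derivative f (at x))"
    by (rule has_derivative_linear[OF smooth_at_has_derivative(1)[OF assms]])
  have "frechet_derivative f (at x) (\<Sum>i\<in>UNIV. v $ i *s axis i 1) = (\<Sum>i\<in>UNIV. v $ i * frechet_derivative f (at x) (axis i 1))"
    by (simp add: linear_sum[OF lin] smooth_at_has_derivative(2)[OF assms])
  then show ?thesis unfolding vec_eq_sum_axis[symmetric] .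
qed

lemma smooth_at_continuous_on: "(\<And>x. x \<in> U \<Longrightarrow> smooth_at f x) \<Longrightarrow> continuous_on U f"
  by (intro continuous_at_imp_continuous_on ballI smooth_at_isCont)

text \<open>
  With \<open>a = W - 1\<close> this is the weighted primitive. Other exponents occur because a derivative in
  direction \<open>i\<close> raises the exponent by \<open>w\<^sub>i\<close>.
\<close>

definition weighted_integral :: "('m::finite \<Rightarrow> nat) \<Rightarrow> nat \<Rightarrow> ('k ^ 'm \<Rightarrow> 'k) \<Rightarrow> 'k ^ 'm \<Rightarrow> 'k" where
  "weighted_integral w a g x = integral {0..1} (\<lambda>s. s ^ a *\<^sub>R g (weighted_scale w s x))"

lemma weighted_integrand_continuous:
  fixes g :: "'k ^ 'm \<Rightarrow> 'k"
  assumes "\<And>x. x \<in> ball 0 r \<Longrightarrow> smooth_at g x"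
  shows "continuous_on (ball 0 r \<times> {0..1}) (\<lambda>(x, s). s ^ a *\<^sub>R g (weighted_scale w s x))"
proof -
  have cg: "continuous_on (ball 0 r) g" by (rule smooth_at_continuous_on[OF assms])
  have "continuous_on (ball 0 r \<times> {0..1}) (\<lambda>p. g (weighted_scale w (snd p) (fst p)))"
  proof (rule continuous_on_compose2[OF cg])
    show "(\<lambda>p. weighted_scale w (snd p) (fst p :: 'k ^ 'm)) ` (ball 0 r \<times> {0..1}) \<subseteq> ball 0 r"
    proof (rule image_subsetI)
      fix p :: "('k ^ 'm) \<times> real" assume "p \<in> ball 0 r \<times> {0..1}"
      then show "weighted_scale w (snd p) (fst p) \<in> ball 0 r"
        using norm_weighted_scale_le[of "snd p" w "fst p"] by (auto simp: mem_Times_iff)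
    qed
  qed (auto intro!: continuous_intros)
  then show ?thesis
    unfolding case_prod_beta' by (intro continuous_intros)
qed

lemma weighted_integrand_continuous_slice:
  fixes g :: "'k ^ 'm \<Rightarrow> 'k"
  assumes "\<And>x. x \<in> ball 0 r \<Longrightarrow> smooth_at g x" "x \<in> ball 0 r"
  shows "continuous_on {0..1} (\<lambda>s. s ^ a *\<^sub>R g (weighted_scale w s x))"
proof -
  have "continuous_on {0..1} (\<lambda>s. (\<lambda>(x, s). s ^ a *\<^sub>R g (weighted_scale w s x)) (x, s))"
  proof (rule continuous_on_compose2[OF weighted_integrand_continuous[OF assms(1)]])
    show "continuous_on {0..1} (Pair x)" by (intro continuous_intros)
    show "Pair x ` {0..1} \<subseteq> ball 0 r \<times> {0..1}" using assms(2) by blast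
  qed
  then show ?thesis by simp
qed

lemma weighted_integral_has_integral:
  fixes g :: "'k ^ 'm \<Rightarrow> 'k"
  assumes "\<And>x. x \<in> ball 0 r \<Longrightarrow> smooth_at g x" "x \<in> ball 0 r"
  shows "((\<lambda>s. s ^ a *\<^sub>R g (weighted_scale w s x)) has_integral weighted_integral w a g x) {0..1}"
  unfolding weighted_integral_def
  by (intro integrable_integral integrable_continuous_real weighted_integrand_continuous_slice[OF assms])

text \<open>
  Differentiation under the integral sign keeps the shape of the integral: the exponent \<open>a\<close> becomes
  \<open>a + w\<^sub>i\<close> and \<open>g\<close> becomes a partial derivative. Smoothness of all orders follows by induction.
\<close>

lemma weighted_integral_has_derivative:
  fixes g :: "'k ^ 'm \<Rightarrow> 'k"
  assumes g: "\<And>x. x \<in> ball 0 r \<Longrightarrow> smooth_at g x" and x0: "x0 \<in> ball 0 r"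
  shows "(weighted_integral w a g has_derivative
    (\<lambda>v. \<Sum>i\<in>UNIV. v $ i * weighted_integral w (a + w i) (\<lambda>x. frechet_derivative g (at x) (axis i 1)) x0)) (at x0)"
proof -
  let ?d = "\<lambda>i x. frechet_derivative g (at x) (axis i 1)"
  \<comment> \<open>The derivative of the integrand as a bounded linear map; writing it as a sum over coordinates makes its continuity evident.\<close>
  define fx where "fx x s = (\<Sum>i\<in>UNIV. blinfun_mult_left (s ^ (a + w i) *\<^sub>R ?d i (weighted_scale w s x)) o\<^sub>L Blinfun (\<lambda>v :: 'k ^ 'm. v $ i))" for x s
  have fx_apply: "blinfun_apply (fx x s) v = (\<Sum>i\<in>UNIV. v $ i * (s ^ (a + w i) *\<^sub>R ?d i (weighted_scale w s x)))" for x s v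
    by (simp add: fx_def blinfun.sum_left bounded_linear_Blinfun_apply[OF bounded_linear_vec_nth])
  have smd: "smooth_at (?d i) x" if "x \<in> ball 0 r" for i x
    by (rule smooth_at_derivative[OF g[OF that]])
  have mem: "weighted_scale w s x \<in> ball 0 r" if "x \<in> ball 0 r" "s \<in> {0..1}" for x :: "'k ^ 'm" and s
    using that norm_weighted_scale_le[of s w x] by simp
  have "((\<lambda>x. integral (cbox 0 1) (\<lambda>s. s ^ a *\<^sub>R g (weighted_scale w s x))) has_derivative
      blinfun_apply (integral (cbox 0 1) (fx x0))) (at x0 within ball 0 r)"
  proof (rule leibniz_rule)
    fix x :: "'k ^ 'm" and s :: real assume x: "x \<in> ball 0 r" and s: "s \<in> cbox 0 1"
    have sg: "smooth_at g (weighted_scale w s x)" using g mem x s by simp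
    have "((\<lambda>x. s ^ a *\<^sub>R g (weighted_scale w s x)) has_derivative
        (\<lambda>v. s ^ a *\<^sub>R frechet_derivative g (at (weighted_scale w s x)) (weighted_scale w s v))) (at x)"
      by (intro bounded_linear.has_derivative[OF bounded_linear_scaleR_right]
          has_derivative_compose[OF bounded_linear_imp_has_derivative[OF bounded_linear_weighted_scale]]
          smooth_at_has_derivative(1)[OF sg])
    moreover have "(\<lambda>v. s ^ a *\<^sub>R frechet_derivative g (at (weighted_scale w s x)) (weighted_scale w s v)) = blinfun_apply (fx x s)"
      unfolding fx_apply frechet_derivative_expand[OF sg, of "weighted_scale w s _"]
      by (simp add: scaleR_sum_right power_add mult.commute)
    ultimately show "((\<lambda>x. s ^ a *\<^sub>R g (weighted_scale w s x)) has_derivative blinfun_apply (fx x s)) (at x within ball 0 r)"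
      using has_derivative_at_withinI by metis
  next
    fix x :: "'k ^ 'm" assume "x \<in> ball 0 r"
    then show "(\<lambda>s. s ^ a *\<^sub>R g (weighted_scale w s x)) integrable_on cbox 0 1"
      using integrable_continuous_real[OF weighted_integrand_continuous_slice[OF g]] by simp
  next
    have c: "continuous_on (ball 0 r \<times> {0..1}) (\<lambda>p. snd p ^ (a + w i) *\<^sub>R ?d i (weighted_scale w (snd p) (fst p)))" for i
      using weighted_integrand_continuous[OF smd, of r "a + w i" w i] by (simp add: case_prod_beta')
    have "continuous_on (ball 0 r \<times> {0..1}) (\<lambda>p. fx (fst p) (snd p))"
      unfolding fx_def
      by (intro continuous_on_sum bounded_bilinear.continuous_on[OF bounded_bilinear_blinfun_compose]
          bounded_linear.continuous_on[OF bounded_linear_blinfun_mult_left] c continuous_on_const)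
    then show "continuous_on (ball 0 r \<times> cbox 0 1) (\<lambda>(x, s). fx x s)"
      by (simp add: case_prod_beta')
  qed (use x0 in auto)
  moreover have "blinfun_apply (integral (cbox 0 1) (fx x0)) v = (\<Sum>i\<in>UNIV. v $ i * weighted_integral w (a + w i) (?d i) x0)" for v
  proof -
    have c: "continuous_on {0..1} (\<lambda>s. s ^ (a + w i) *\<^sub>R ?d i (weighted_scale w s x0))" for i
      by (rule weighted_integrand_continuous_slice[OF smd x0])
    have "continuous_on {0..1} (fx x0)"
      unfolding fx_def
      by (intro continuous_on_sum bounded_bilinear.continuous_on[OF bounded_bilinear_blinfun_compose]
          bounded_linear.continuous_on[OF bounded_linear_blinfun_mult_left] c continuous_on_const)
    then have "fx x0 integrable_on cbox 0 1" by (simp add: integrable_continuous_real)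
    then have "blinfun_apply (integral (cbox 0 1) (fx x0)) v = integral {0..1} (\<lambda>s. blinfun_apply (fx x0 s) v)"
      by (simp add: blinfun_apply_integral)
    also have "\<dots> = (\<Sum>i\<in>UNIV. v $ i * weighted_integral w (a + w i) (?d i) x0)"
      unfolding fx_apply
      by (intro integral_unique has_integral_sum has_integral_mult_right weighted_integral_has_integral[of r] smd x0) auto
    finally show ?thesis .
  qed
  then have eq: "blinfun_apply (integral (cbox 0 1) (fx x0)) = (\<lambda>v. \<Sum>i\<in>UNIV. v $ i * weighted_integral w (a + w i) (?d i) x0)"
    by (rule ext)
  ultimately have "((\<lambda>x. integral (cbox 0 1) (\<lambda>s. s ^ a *\<^sub>R g (weighted_scale w s x))) has_derivative
      (\<lambda>v. \<Sum>i\<in>UNIV. v $ i * weighted_integral w (a + w i) (?d i) x0)) (at x0)"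
    unfolding at_within_open[OF x0 open_ball] eq by blast
  then show ?thesis
    by (simp add: weighted_integral_def[abs_def])
qed

lemma Ck_on_weighted_integral:
  fixes g :: "'k ^ 'm \<Rightarrow> 'k"
  assumes "\<And>x. x \<in> ball 0 r \<Longrightarrow> smooth_at g x"
  shows "Ck_on k (weighted_integral w a g) (ball 0 r)"
  using assms
proof (induction k arbitrary: a g)
  case 0
  have "isCont (weighted_integral w a g) x" if "x \<in> ball 0 r" for x
    by (rule has_derivative_continuous[OF weighted_integral_has_derivative[OF 0 that]])
  then show ?case by (simp add: continuous_at_imp_continuous_on)
next
  case (Suc k)
  show ?case
  proof (rule Ck_on_SucI[OF open_ball weighted_integral_has_derivative[OF Suc.prems]])
    show "Ck_on k (\<lambda>x. \<Sum>i\<in>UNIV. v $ i * weighted_integral w (a + w i) (\<lambda>x. frechet_derivative g (at x) (axis i 1)) x) (ball 0 r)" for v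
      by (intro Ck_on_sum Ck_on_mult Ck_on_const open_ball Suc.IH smooth_at_derivative Suc.prems)
  qed
qed

text \<open>
  The left-hand side is the integral over \<open>[0,1]\<close> of the derivative of
  \<open>s\<^sup>W g(s\<^bsup>w\<^sub>i\<^esup> x\<^sub>i)\<close>, which vanishes at \<open>s = 0\<close> since \<open>W > 0\<close>.
\<close>

lemma weighted_integral_euler:
  fixes g :: "'k ^ 'm \<Rightarrow> 'k"
  assumes g: "\<And>x. x \<in> ball 0 r \<Longrightarrow> smooth_at g x" and x: "x \<in> ball 0 r" and W: "0 < W"
  shows "of_nat W * weighted_integral w (W - 1) g x +
    frechet_derivative (weighted_integral w (W - 1) g) (at x) (euler_vector w x) = g x"
proof -
  let ?d = "\<lambda>i x. frechet_derivative g (at x) (axis i 1)"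
  let ?I = "\<lambda>i. weighted_integral w (W - 1 + w i) (?d i) x"
  have d: "frechet_derivative (weighted_integral w (W - 1) g) (at x) (euler_vector w x) = (\<Sum>i\<in>UNIV. (of_nat (w i) * x $ i) * ?I i)"
    using frechet_derivative_at[OF weighted_integral_has_derivative[OF g x, of w "W - 1"]] by (metis (no_types, lifting) euler_vector_nth sum.cong)
  let ?\<phi>' = "\<lambda>s. of_nat W * (s ^ (W - 1) *\<^sub>R g (weighted_scale w s x)) +
      (\<Sum>i\<in>UNIV. (of_nat (w i) * x $ i) * (s ^ (W - 1 + w i) *\<^sub>R ?d i (weighted_scale w s x)))"
  have "(?\<phi>' has_integral of_nat W * weighted_integral w (W - 1) g x + (\<Sum>i\<in>UNIV. (of_nat (w i) * x $ i) * ?I i)) {0..1}"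
    by (intro has_integral_add has_integral_mult_right has_integral_sum weighted_integral_has_integral[of r] g x
        smooth_at_derivative) auto
  moreover have "(?\<phi>' has_integral (1 ^ W *\<^sub>R g (weighted_scale w 1 x) - 0 ^ W *\<^sub>R g (weighted_scale w 0 x))) {0..1}"
  proof (rule fundamental_theorem_of_calculus)
    fix s :: real assume s: "s \<in> {0..1}"
    have sg: "smooth_at g (weighted_scale w s x)"
      using g norm_weighted_scale_le[of s w x] s x by simp
    have "((\<lambda>s. weighted_scale w s x) has_derivative (\<lambda>h. \<chi> i. (h * (of_nat (w i) * s ^ (w i - 1))) *\<^sub>R x $ i)) (at s within {0..1})"
      by (rule has_derivative_vecI) (auto intro!: derivative_eq_intros simp: mult_ac)
    note scale_deriv = this
    have expand: "frechet_derivative g (at (weighted_scale w s x)) (\<chi> i. (h * (of_nat (w i) * s ^ (w i - 1))) *\<^sub>R x $ i) =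
        h *\<^sub>R (\<Sum>i\<in>UNIV. ((of_nat (w i) * s ^ (w i - 1)) *\<^sub>R x $ i) * ?d i (weighted_scale w s x))" for h
      by (subst frechet_derivative_expand[OF sg]) (simp add: scaleR_sum_right)
    from has_derivative_compose[OF scale_deriv smooth_at_has_derivative(1)[OF sg]]
    have "((\<lambda>s. g (weighted_scale w s x)) has_derivative
        (\<lambda>h. frechet_derivative g (at (weighted_scale w s x)) (\<chi> i. (h * (of_nat (w i) * s ^ (w i - 1))) *\<^sub>R x $ i))) (at s within {0..1})" .
    then have "((\<lambda>s. g (weighted_scale w s x)) has_derivative
        (\<lambda>h. h *\<^sub>R (\<Sum>i\<in>UNIV. ((of_nat (w i) * s ^ (w i - 1)) *\<^sub>R x $ i) * ?d i (weighted_scale w s x)))) (at s within {0..1})"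
      unfolding expand .
    then have "((\<lambda>s. g (weighted_scale w s x)) has_vector_derivative
        (\<Sum>i\<in>UNIV. ((of_nat (w i) * s ^ (w i - 1)) *\<^sub>R x $ i) * ?d i (weighted_scale w s x))) (at s within {0..1})"
      by (simp add: has_vector_derivative_def)
    moreover have "((\<lambda>s. s ^ W) has_field_derivative (of_nat W * s ^ (W - 1))) (at s within {0..1})"
      by (auto intro!: derivative_eq_intros)
    ultimately have "((\<lambda>s. s ^ W *\<^sub>R g (weighted_scale w s x)) has_vector_derivative
        s ^ W *\<^sub>R (\<Sum>i\<in>UNIV. ((of_nat (w i) * s ^ (w i - 1)) *\<^sub>R x $ i) * ?d i (weighted_scale w s x)) +
        (of_nat W * s ^ (W - 1)) *\<^sub>R g (weighted_scale w s x)) (at s within {0..1})"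
      by (intro has_vector_derivative_scaleR)
    moreover have "s ^ W *\<^sub>R (\<Sum>i\<in>UNIV. ((of_nat (w i) * s ^ (w i - 1)) *\<^sub>R x $ i) * ?d i (weighted_scale w s x)) =
        (\<Sum>i\<in>UNIV. (of_nat (w i) * x $ i) * (s ^ (W - 1 + w i) *\<^sub>R ?d i (weighted_scale w s x)))"
      unfolding scaleR_sum_right
    proof (rule sum.cong[OF refl])
      fix i
      have nat_scale: "of_nat (w i) * x $ i = real (w i) *\<^sub>R x $ i"
        by (simp add: scaleR_conv_of_real)
      have "s ^ W * (of_nat (w i) * s ^ (w i - 1)) = of_nat (w i) * s ^ (W - 1 + w i)"
        using W by (cases "w i") (auto simp: power_add[symmetric])
      then show "s ^ W *\<^sub>R (((of_nat (w i) * s ^ (w i - 1)) *\<^sub>R x $ i) * ?d i (weighted_scale w s x)) =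
          (of_nat (w i) * x $ i) * (s ^ (W - 1 + w i) *\<^sub>R ?d i (weighted_scale w s x))"
        unfolding nat_scale mult_scaleR_left mult_scaleR_right scaleR_scaleR by (simp only: mult.commute)
    qed
    moreover have "(of_nat W * s ^ (W - 1)) *\<^sub>R g (weighted_scale w s x) = of_nat W * (s ^ (W - 1) *\<^sub>R g (weighted_scale w s x))"
      by (simp add: scaleR_conv_of_real)
    ultimately show "((\<lambda>s. s ^ W *\<^sub>R g (weighted_scale w s x)) has_vector_derivative ?\<phi>' s) (at s within {0..1})"
      by (simp add: add.commute)
  qed simp
  ultimately have "of_nat W * weighted_integral w (W - 1) g x + (\<Sum>i\<in>UNIV. (of_nat (w i) * x $ i) * ?I i) =
      1 ^ W *\<^sub>R g (weighted_scale w 1 x) - 0 ^ W *\<^sub>R g (weighted_scale w 0 x)"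
    by (rule has_integral_unique)
  moreover have "weighted_scale w 1 x = x" by (simp add: vec_eq_iff)
  ultimately show ?thesis using W d by simp
qed

text \<open>
  Monomials are eigenvectors of the Euler field.
\<close>

lemma monom_deriv_euler:
  "monom_deriv \<alpha> z (euler_vector w z) = of_nat (\<Sum>i\<in>UNIV. w i * \<alpha> i) * (\<Prod>i\<in>UNIV. z $ i ^ \<alpha> i)"
proof -
  have eq: "of_nat (\<alpha> j) * (of_nat (w j) * z $ j) * z $ j ^ (\<alpha> j - 1) * (\<Prod>i\<in>UNIV - {j}. z $ i ^ \<alpha> i)
      = of_nat (w j * \<alpha> j) * (\<Prod>i\<in>UNIV. z $ i ^ \<alpha> i)" for j
  proof (cases "\<alpha> j")
    case (Suc n)
    have "(\<Prod>i\<in>UNIV. z $ i ^ \<alpha> i) = z $ j ^ \<alpha> j * (\<Prod>i\<in>UNIV - {j}. z $ i ^ \<alpha> i)"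
      by (rule prod.remove) auto
    also have "z $ j ^ \<alpha> j = z $ j * z $ j ^ (\<alpha> j - 1)" by (simp add: Suc)
    finally show ?thesis by (simp only: of_nat_mult mult_ac)
  qed simp
  show ?thesis
    by (simp only: monom_deriv_def euler_vector_nth eq sum_distrib_right of_nat_sum)
qed

text \<open>
  In the analytic cases the monomial \<open>x\<^sup>\<alpha>\<close> is multiplied by \<open>W + \<Sum>\<^sub>i w\<^sub>i \<alpha>\<^sub>i \<ge> 1\<close> under \<open>W + E\<close>, so
  dividing the coefficients of \<open>g\<close> by these numbers solves the equation without loss of convergence.
\<close>

theorem weighted_primitive:
  fixes g :: "'k ^ 'm \<Rightarrow> 'k" and w :: "'m \<Rightarrow> nat"
  assumes g: "smooth_at g 0" and W: "0 < W"
  shows "\<exists>G. smooth_at G 0 \<and> (\<forall>\<^sub>F x in nhds 0. of_nat W * G x + frechet_derivative G (at x) (euler_vector w x) = g x)"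
proof (cases reg)
  case C_infinity
  obtain r where r: "0 < r" "\<And>x. x \<in> ball 0 r \<Longrightarrow> smooth_at g x"
    using smooth_at_eventually[OF g] unfolding eventually_nhds_metric by (auto simp: dist_commute)
  have "smooth_at (weighted_integral w (W - 1) g) 0"
    unfolding smooth_at_C_infinity[OF C_infinity]
    using r Ck_on_weighted_integral[OF r(2)] by (intro exI[of _ "ball 0 r"]) auto
  moreover have "\<forall>\<^sub>F x in nhds 0. of_nat W * weighted_integral w (W - 1) g x +
      frechet_derivative (weighted_integral w (W - 1) g) (at x) (euler_vector w x) = g x"
    unfolding eventually_nhds using r weighted_integral_euler[OF r(2) _ W] by (intro exI[of _ "ball 0 r"]) auto
  ultimately show ?thesis by blast
next
  case Analytic
  have "has_power_series_at g 0"
    using g unfolding smooth_at_def smooth_on_def by (auto simp: Analytic)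
  then obtain c r where r: "0 < r"
    and c: "\<And>x. x \<in> ball 0 r \<Longrightarrow> ((\<lambda>\<alpha>. c \<alpha> * (\<Prod>i\<in>UNIV. (x $ i - 0 $ i) ^ \<alpha> i)) has_sum g x) UNIV"
    unfolding has_power_series_at_def by blast
  define \<rho> where "\<rho> = r / (2 * real CARD('m))"
  have \<rho>: "0 < \<rho>" using r by (simp add: \<rho>_def)
  define d where "d \<alpha> = (of_nat (W + (\<Sum>i\<in>UNIV. w i * \<alpha> i)) :: complex)" for \<alpha>
  have d: "1 \<le> norm (d \<alpha>)" for \<alpha>
  proof -
    have "1 \<le> W + (\<Sum>i\<in>UNIV. w i * \<alpha> i)" using W by simp
    then have "real 1 \<le> real (W + (\<Sum>i\<in>UNIV. w i * \<alpha> i))" unfolding of_nat_le_iff .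
    then show ?thesis unfolding d_def norm_of_nat by simp
  qed
  have d0: "d \<alpha> \<noteq> 0" for \<alpha> using d[of \<alpha>] by auto
  have "(\<lambda>\<alpha>. norm (emb (c \<alpha>)) * \<rho> ^ (\<Sum>i\<in>UNIV. \<alpha> i)) summable_on UNIV"
    unfolding \<rho>_def by (rule power_series_coefficients_summable[OF r c])
  then have "(\<lambda>\<alpha>. norm (norm (emb (c \<alpha>) / d \<alpha>) * \<rho> ^ (\<Sum>i\<in>UNIV. \<alpha> i))) summable_on UNIV"
  proof (rule Infinite_Sum.abs_summable_on_comparison_test')
    show "norm (norm (emb (c \<alpha>) / d \<alpha>) * \<rho> ^ (\<Sum>i\<in>UNIV. \<alpha> i)) \<le> norm (emb (c \<alpha>)) * \<rho> ^ (\<Sum>i\<in>UNIV. \<alpha> i)" for \<alpha>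
    proof -
      have "norm (emb (c \<alpha>) / d \<alpha>) \<le> norm (emb (c \<alpha>))"
        using d0[of \<alpha>] mult_left_mono[OF d[of \<alpha>] norm_ge_zero[of "emb (c \<alpha>)"]]
        by (simp add: norm_divide divide_le_eq)
      then have "norm (emb (c \<alpha>) / d \<alpha>) * \<rho> ^ (\<Sum>i\<in>UNIV. \<alpha> i) \<le> norm (emb (c \<alpha>)) * \<rho> ^ (\<Sum>i\<in>UNIV. \<alpha> i)"
        using \<rho> by (intro mult_right_mono) auto
      then show ?thesis using \<rho> by (simp add: abs_mult)
    qed
  qed
  then have "(\<lambda>\<alpha>. norm (emb (c \<alpha>) / d \<alpha>) * \<rho> ^ (\<Sum>i\<in>UNIV. \<alpha> i)) summable_on UNIV"
    using \<rho> by (simp add: abs_mult)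
  from power_series_has_derivative[OF \<rho> this] obtain F D where
    F: "\<And>z. norm z < \<rho> / 2 \<Longrightarrow> ((\<lambda>\<alpha>. emb (c \<alpha>) / d \<alpha> * (\<Prod>i\<in>UNIV. z $ i ^ \<alpha> i)) has_sum F z) UNIV"
    and F': "\<And>z. norm z < \<rho> / 2 \<Longrightarrow> (F has_derivative D z) (at z)"
    and D: "\<And>z v. norm z < \<rho> / 2 \<Longrightarrow> ((\<lambda>\<alpha>. emb (c \<alpha>) / d \<alpha> * monom_deriv \<alpha> z v) has_sum D z v) UNIV"
    by blast
  define G where "G x = ret (F (vemb x))" for x
  define s where "s = min r (\<rho> / 2)"
  have s: "0 < s" "s \<le> r" "s \<le> \<rho> / 2" using r \<rho> by (auto simp: s_def)
  have ext: "extends F G (ball 0 s)"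
    unfolding extends_def hol_on_def
  proof (intro conjI ballI allI impI open_ball)
    fix z :: "complex ^ 'm" assume "z \<in> ball 0 s"
    then have z: "norm z < \<rho> / 2" using s by simp
    have "D z (k *s v) = k * D z v" for k v
    proof (rule has_sum_unique[OF D[OF z]])
      show "((\<lambda>\<alpha>. emb (c \<alpha>) / d \<alpha> * monom_deriv \<alpha> z (k *s v)) has_sum k * D z v) UNIV"
        using has_sum_cmult_right[OF D[OF z, of v], of k] by (simp only: monom_deriv_smult mult.left_commute)
    qed
    then show "\<exists>D. (F has_derivative D) (at z) \<and> (\<forall>c v. D (c *s v) = c * D v)" using F'[OF z] by blast
  next
    fix x :: "'k ^ 'm" assume "vemb x \<in> ball 0 s"
    then have x: "norm (vemb x) < \<rho> / 2" using s by simp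
    \<comment> \<open>The denominators are real numbers, so the coefficients stay in the image of \<open>emb\<close>.\<close>
    have q: "emb (c \<alpha>) / d \<alpha> * (\<Prod>i\<in>UNIV. vemb x $ i ^ \<alpha> i) =
        emb (c \<alpha> * of_real (1 / real (W + (\<Sum>i\<in>UNIV. w i * \<alpha> i))) * (\<Prod>i\<in>UNIV. x $ i ^ \<alpha> i))" for \<alpha>
      unfolding emb_mult emb_of_real emb_prod emb_power d_def by simp
    have "((\<lambda>\<alpha>. emb (ret (emb (c \<alpha>) / d \<alpha> * (\<Prod>i\<in>UNIV. vemb x $ i ^ \<alpha> i)))) has_sum emb (ret (F (vemb x)))) UNIV"
      by (intro has_sum_bounded_linear[OF bounded_linear_emb] has_sum_bounded_linear[OF bounded_linear_ret] F x)
    then have "((\<lambda>\<alpha>. emb (c \<alpha>) / d \<alpha> * (\<Prod>i\<in>UNIV. vemb x $ i ^ \<alpha> i)) has_sum emb (ret (F (vemb x)))) UNIV"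
      unfolding q ret_emb .
    then show "F (vemb x) = emb (G x)"
      unfolding G_def using has_sum_unique F[OF x] by blast
  qed
  have "vemb (0 :: 'k ^ 'm) \<in> ball 0 s" using s by (simp add: norm_vemb)
  then have "smooth_at G 0"
    unfolding smooth_at_Analytic[OF Analytic] using ext by blast
  moreover have "of_nat W * G x + frechet_derivative G (at x) (euler_vector w x) = g x" if x: "x \<in> ball 0 s" for x
  proof -
    have xs: "norm (vemb x) < \<rho> / 2" "vemb x \<in> ball 0 s" using x s by (auto simp: norm_vemb)
    obtain D' where "(G has_derivative (\<lambda>v. ret (D' (vemb v)))) (at x) \<and>
        (F has_derivative D') (at (vemb x)) \<and>
        (\<forall>c v. D' (c *s v) = c * D' v) \<and> (\<forall>v. emb (ret (D' (vemb v))) = D' (vemb v))"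
      using extends_has_derivative[OF ext xs(2)] by (rule exE)
    then have D': "(G has_derivative (\<lambda>v. ret (D' (vemb v)))) (at x)" "(F has_derivative D') (at (vemb x))"
      "\<And>v. emb (ret (D' (vemb v))) = D' (vemb v)" by simp_all
    have "D' = D (vemb x)" by (rule has_derivative_unique[OF D'(2) F'[OF xs(1)]])
    then have emb_deriv: "emb (frechet_derivative G (at x) v) = D (vemb x) (vemb v)" for v
      using frechet_derivative_at[OF D'(1)] D'(3)[of v] by metis
    have "vemb (euler_vector w x) = euler_vector w (vemb x)"
      by (simp add: vec_eq_iff emb_mult emb_of_nat)
    then have "((\<lambda>\<alpha>. of_nat W * (emb (c \<alpha>) / d \<alpha> * (\<Prod>i\<in>UNIV. vemb x $ i ^ \<alpha> i)) +
        emb (c \<alpha>) / d \<alpha> * monom_deriv \<alpha> (vemb x) (euler_vector w (vemb x))) has_sum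
        of_nat W * F (vemb x) + D (vemb x) (vemb (euler_vector w x))) UNIV"
      using F[OF xs(1)] D[OF xs(1), of "euler_vector w (vemb x)"]
      by (intro has_sum_add has_sum_cmult_right) auto
    moreover have "of_nat W * (emb (c \<alpha>) / d \<alpha> * (\<Prod>i\<in>UNIV. vemb x $ i ^ \<alpha> i)) +
        emb (c \<alpha>) / d \<alpha> * monom_deriv \<alpha> (vemb x) (euler_vector w (vemb x)) = emb (c \<alpha> * (\<Prod>i\<in>UNIV. (x $ i - 0 $ i) ^ \<alpha> i))" for \<alpha>
    proof -
      let ?P = "\<Prod>i\<in>UNIV. vemb x $ i ^ \<alpha> i" and ?n = "of_nat (\<Sum>i\<in>UNIV. w i * \<alpha> i) :: complex"
      have "of_nat W * (emb (c \<alpha>) / d \<alpha> * ?P) + emb (c \<alpha>) / d \<alpha> * (?n * ?P) = emb (c \<alpha>) * ?P * ((of_nat W + ?n) / d \<alpha>)"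
        by (simp add: add_divide_distrib algebra_simps)
      also have "of_nat W + ?n = d \<alpha>" unfolding d_def of_nat_add ..
      finally show ?thesis
        using d0[of \<alpha>] unfolding monom_deriv_euler by (simp add: emb_mult emb_prod emb_power)
    qed
    ultimately have "((\<lambda>\<alpha>. emb (c \<alpha> * (\<Prod>i\<in>UNIV. (x $ i - 0 $ i) ^ \<alpha> i))) has_sum
        of_nat W * F (vemb x) + D (vemb x) (vemb (euler_vector w x))) UNIV"
      by (simp only:)
    moreover have "((\<lambda>\<alpha>. emb (c \<alpha> * (\<Prod>i\<in>UNIV. (x $ i - 0 $ i) ^ \<alpha> i))) has_sum emb (g x)) UNIV"
      by (intro has_sum_bounded_linear[OF bounded_linear_emb] c) (use x s in auto)
    ultimately have "of_nat W * F (vemb x) + D (vemb x) (vemb (euler_vector w x)) = emb (g x)"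
      by (rule has_sum_unique)
    moreover have "F (vemb x) = emb (G x)" using ext xs(2) unfolding extends_def by blast
    ultimately have "emb (of_nat W * G x + frechet_derivative G (at x) (euler_vector w x)) = emb (g x)"
      by (simp add: emb.add emb_mult emb_of_nat emb_deriv)
    then show ?thesis unfolding emb_eq_iff .
  qed
  then have "\<forall>\<^sub>F x in nhds 0. of_nat W * G x + frechet_derivative G (at x) (euler_vector w x) = g x"
    unfolding eventually_nhds using s by (intro exI[of _ "ball 0 s"]) auto
  ultimately show ?thesis by blast
qed

end

section \<open>Forms of top degree and determinants of linear maps\<close>

lemma alternating_multilinearD:
  assumes "alternating_multilinear \<alpha>"
  shows "\<alpha> (v(i := x + y)) = \<alpha> (v(i := x)) + \<alpha> (v(i := y))"
    and "\<alpha> (v(i := c *s x)) = c * \<alpha> (v(i := x))"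
    and "i \<noteq> j \<Longrightarrow> v i = v j \<Longrightarrow> \<alpha> v = 0"
proof -
  have "Vector_Spaces.linear (*s) (*) (\<lambda>u. \<alpha> (v(i := u)))" for v i
    using assms by (simp add: alternating_multilinear_def)
  then show "\<alpha> (v(i := x + y)) = \<alpha> (v(i := x)) + \<alpha> (v(i := y))"
    "\<alpha> (v(i := c *s x)) = c * \<alpha> (v(i := x))"
    unfolding Vector_Spaces.linear_iff by blast+
  show "i \<noteq> j \<Longrightarrow> v i = v j \<Longrightarrow> \<alpha> v = 0"
    using assms by (auto simp: alternating_multilinear_def)
qed

text \<open>
  The difference \<open>\<beta>\<close> of the two sides is alternating multilinear and vanishes on the standard basis. It
  vanishes on tuples of basis vectors, as these are permutations of the basis or contain a
  repetition, and then on all tuples by expanding one vector after the other.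
\<close>

lemma alternating_multilinear_eq_det:
  fixes \<alpha> :: "('n::finite \<Rightarrow> 'k::field ^ 'n) \<Rightarrow> 'k"
  assumes \<alpha>: "alternating_multilinear \<alpha>"
  shows "\<alpha> v = \<alpha> (\<lambda>i. axis i 1) * det (\<chi> i. v i)"
proof -
  define \<beta> where "\<beta> v = \<alpha> v - \<alpha> (\<lambda>i. axis i 1) * det (\<chi> i. v i)" for v
  have det_upd: "(\<chi> i. (v(k := u)) i) = (\<chi> i. if i = k then u else v i)" for v :: "'n \<Rightarrow> 'k ^ 'n" and k u
    by (simp add: vec_eq_iff)
  have add: "\<beta> (v(i := x + y)) = \<beta> (v(i := x)) + \<beta> (v(i := y))" for v i x y
    unfolding \<beta>_def det_upd det_row_add[of i "\<lambda>_. x" "\<lambda>_. y" v] alternating_multilinearD(1)[OF \<alpha>]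
    by (simp add: algebra_simps)
  have scale: "\<beta> (v(i := c *s x)) = c * \<beta> (v(i := x))" for v i c x
    unfolding \<beta>_def det_upd det_row_mul[of i c "\<lambda>_. x" v] alternating_multilinearD(2)[OF \<alpha>]
    by (simp add: algebra_simps)
  have alt: "\<beta> v = 0" if "i \<noteq> j" "v i = v j" for v i j
  proof -
    have "det (\<chi> i. v i) = 0" by (rule det_identical_rows[OF that(1)]) (simp add: row_def that(2))
    then show ?thesis using alternating_multilinearD(3)[OF \<alpha> that] by (simp add: \<beta>_def)
  qed
  have one: "\<beta> (\<lambda>i. axis i 1) = 0"
  proof -
    have "(\<chi> i. axis i 1) = (mat 1 :: 'k ^ 'n ^ 'n)" by (simp add: vec_eq_iff axis_def mat_def eq_commute)
    then show ?thesis by (simp add: \<beta>_def)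
  qed
  have swap: "\<beta> (v(i := v j, j := v i)) = - \<beta> v" if ij: "i \<noteq> j" for v i j
  proof -
    let ?v = "\<lambda>x y. v(i := x, j := y)"
    have l: "\<beta> (?v (x + x') y) = \<beta> (?v x y) + \<beta> (?v x' y)" for x x' y
      using add[of "v(j := y)" i x x'] ij by (simp add: fun_upd_twist)
    have r: "\<beta> (?v x (y + y')) = \<beta> (?v x y) + \<beta> (?v x y')" for x y y'
      by (rule add)
    have d: "\<beta> (?v x x) = 0" for x by (rule alt[OF ij]) (use ij in simp)
    have "?v (v i) (v j) = v" by simp
    then have "\<beta> v + \<beta> (?v (v j) (v i)) = 0"
      using d[of "v i + v j"] d[of "v i"] d[of "v j"] unfolding l r by (simp add: add.commute)
    then show ?thesis by (simp add: eq_neg_iff_add_eq_0 add.commute)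
  qed
  have perm: "\<beta> (\<lambda>i. axis (p i) 1) = 0" if "p permutes UNIV" for p
    using finite_class.finite_UNIV that
  proof (induction p rule: permutes_rev_induct)
    case id
    then show ?case using one by simp
  next
    case (swap a b p)
    let ?v = "\<lambda>i. axis (p i) 1 :: 'k ^ 'n"
    have "(\<lambda>i. axis ((p \<circ> Transposition.transpose a b) i) 1) = ?v(a := ?v b, b := ?v a)"
      by (auto simp: fun_eq_iff transpose_def)
    then show ?case using \<open>\<And>v i j. i \<noteq> j \<Longrightarrow> \<beta> (v(i := v j, j := v i)) = - \<beta> v\<close>[of a b ?v] swap by simp
  qed
  have basis: "\<beta> (\<lambda>i. axis (f i) 1) = 0" for f :: "'n \<Rightarrow> 'n"
  proof (cases "inj f")
    case True
    then have "bij f" by (simp add: bij_def finite_UNIV_inj_surj)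
    then have "f permutes UNIV" by (rule bij_imp_permutes) simp
    then show ?thesis by (rule perm)
  next
    case False
    then obtain i j where "i \<noteq> j" "f i = f j" by (auto simp: inj_def)
    then show ?thesis by (intro alt[of i j]) auto
  qed
  have sum: "\<beta> (v(i := \<Sum>k\<in>K. c k *s e k)) = (\<Sum>k\<in>K. c k * \<beta> (v(i := e k)))" if "finite K" for v i K c and e :: "'n \<Rightarrow> 'k ^ 'n"
    using that
  proof (induction K)
    case empty
    have "\<beta> (v(i := 0)) = 0" using scale[of v i 0 0] by simp
    then show ?case by (simp only: sum.empty)
  next
    case (insert k K)
    then show ?case by (simp only: sum.insert[OF insert.hyps] add scale)
  qed
  have "\<beta> v = 0" if "\<And>i. i \<notin> T \<Longrightarrow> \<exists>m. v i = axis m 1" "finite T" for T and v :: "'n \<Rightarrow> 'k ^ 'n"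
    using that(2,1)
  proof (induction T arbitrary: v)
    case empty
    then obtain f where "\<And>i. v i = axis (f i) 1" by (metis empty_iff)
    then have "v = (\<lambda>i. axis (f i) 1)" by auto
    then show ?case using basis by simp
  next
    case (insert j T)
    have "\<beta> (v(j := axis k 1)) = 0" for k
      by (rule insert.IH) (use insert.prems in auto)
    then have "\<beta> (v(j := \<Sum>k\<in>UNIV. v j $ k *s axis k 1)) = 0"
      by (subst sum) auto
    then show ?case unfolding vec_eq_sum_axis[symmetric] by simp
  qed
  from this[of UNIV v] show ?thesis by (simp add: \<beta>_def)
qed

text \<open>
  Rows are expanded one at a time; once a row has been replaced by \<open>b\<close>, the multiples of \<open>b\<close> in other rows do
  not change the determinant.
\<close>

lemma det_identity_plus_rank_one:
  fixes a :: "'n::finite \<Rightarrow> 'k::field" and b :: "'k ^ 'n"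
  shows "det (\<chi> i. axis i 1 + a i *s b) = 1 + (\<Sum>i\<in>UNIV. a i * b $ i)"
proof -
  let ?e = "\<lambda>i. axis i 1 :: 'k ^ 'n"
  have row_b: "det (\<chi> i. if i = j then b else if i \<in> S then ?e i + a i *s b else ?e i) = b $ j"
    if "finite S" "j \<notin> S" for S j
    using that
  proof (induction S)
    case empty
    have r: "row i (mat 1) = ?e i" for i
      by (simp add: vec_eq_iff row_def axis_def mat_def eq_commute)
    show ?case
      using cramer_lemma_transpose[of j b "mat 1 :: 'k ^ 'n ^ 'n"]
      unfolding r vec_eq_sum_axis[symmetric] by (simp cong: if_cong)
  next
    case (insert k S)
    let ?c = "\<lambda>i. if i = j then b else if i \<in> S then ?e i + a i *s b else ?e i"
    have kj: "k \<noteq> j" using insert.prems by auto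
    have "(\<chi> i. if i = j then b else if i \<in> insert k S then ?e i + a i *s b else ?e i) =
        (\<chi> i. if i = k then ?e k + a k *s b else ?c i)"
      using kj by (auto simp: vec_eq_iff)
    then have "det (\<chi> i. if i = j then b else if i \<in> insert k S then ?e i + a i *s b else ?e i) =
        det (\<chi> i. if i = k then ?e k else ?c i) + a k * det (\<chi> i. if i = k then b else ?c i)"
      by (simp only: det_row_add[of k "\<lambda>_. ?e k" "\<lambda>_. a k *s b"] det_row_mul[of k "a k" "\<lambda>_. b"])
    also have "(\<chi> i. if i = k then ?e k else ?c i) = (\<chi> i. ?c i)"
      using insert.hyps kj by (auto simp: vec_eq_iff)
    also have "det (\<chi> i. if i = k then b else ?c i) = 0"
      by (rule det_identical_rows[OF kj]) (simp add: row_def)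
    finally show ?case using insert by simp
  qed
  have "det (\<chi> i. if i \<in> S then ?e i + a i *s b else ?e i) = 1 + (\<Sum>i\<in>S. a i * b $ i)" if "finite S" for S
    using that
  proof (induction S)
    case empty
    have "(\<chi> i. ?e i) = (mat 1 :: 'k ^ 'n ^ 'n)" by (simp add: vec_eq_iff axis_def mat_def eq_commute)
    then show ?case by simp
  next
    case (insert k S)
    let ?c = "\<lambda>i. if i \<in> S then ?e i + a i *s b else ?e i"
    have "(\<chi> i. if i \<in> insert k S then ?e i + a i *s b else ?e i) = (\<chi> i. if i = k then ?e k + a k *s b else ?c i)"
      by (auto simp: vec_eq_iff)
    then have "det (\<chi> i. if i \<in> insert k S then ?e i + a i *s b else ?e i) =
        det (\<chi> i. if i = k then ?e k else ?c i) + a k * det (\<chi> i. if i = k then b else ?c i)"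
      by (simp only: det_row_add[of k "\<lambda>_. ?e k" "\<lambda>_. a k *s b"] det_row_mul[of k "a k" "\<lambda>_. b"])
    also have "(\<chi> i. if i = k then ?e k else ?c i) = (\<chi> i. ?c i)"
      using insert.hyps by (auto simp: vec_eq_iff)
    also have "det (\<chi> i. if i = k then b else ?c i) = b $ k"
      by (rule row_b[OF insert.hyps])
    finally show ?case using insert by simp
  qed
  from this[of UNIV] show ?thesis by simp
qed

text \<open>
  The determinant of a linear map. The images of the basis vectors are put into the rows, which avoids a
  transposition when a form is evaluated on a family of vectors.
\<close>

definition lin_det :: "('k::field ^ 'n \<Rightarrow> 'k ^ 'n) \<Rightarrow> 'k" where
  "lin_det A = det (\<chi> j. A (axis j 1))"

definition K_linear :: "('k::field ^ 'n \<Rightarrow> 'k ^ 'p) \<Rightarrow> bool" where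
  "K_linear A \<longleftrightarrow> (\<forall>x y. A (x + y) = A x + A y) \<and> (\<forall>c x. A (c *s x) = c *s A x)"

lemma K_linear_expand:
  assumes "K_linear A"
  shows "A v = (\<Sum>j\<in>UNIV. v $ j *s A (axis j 1))"
proof -
  have A0: "A 0 = 0"
  proof -
    have "A (0 *s 0) = 0 *s A 0" using assms unfolding K_linear_def by blast
    then show ?thesis by simp
  qed
  have "A (\<Sum>j\<in>J. v $ j *s axis j 1) = (\<Sum>j\<in>J. v $ j *s A (axis j 1))" if "finite J" for J
    using that by (induction J) (use assms A0 in \<open>auto simp: K_linear_def\<close>)
  from this[of UNIV] show ?thesis unfolding vec_eq_sum_axis[symmetric] by simp
qed

lemma det_linear_image:
  fixes A :: "'k::field ^ 'n \<Rightarrow> 'k ^ 'n"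
  assumes "K_linear A"
  shows "det (\<chi> i. A (v i)) = det (\<chi> i. v i) * lin_det A"
proof -
  have "(\<chi> i. A (v i)) = (\<chi> i. v i) ** (\<chi> j. A (axis j 1))"
    by (subst K_linear_expand[OF assms]) (simp add: vec_eq_iff matrix_matrix_mult_def sum_component)
  then show ?thesis by (simp add: det_mul lin_det_def)
qed

lemma lin_det_compose:
  fixes A B :: "'k::field ^ 'n \<Rightarrow> 'k ^ 'n"
  assumes "K_linear A"
  shows "lin_det (\<lambda>v. A (B v)) = lin_det A * lin_det B"
  using det_linear_image[OF assms, of "\<lambda>i. B (axis i 1)"] by (simp add: lin_det_def mult.commute)

lemma lin_det_id: "lin_det (\<lambda>v. v :: 'k::field ^ 'n) = 1"
proof -
  have "(\<chi> i. axis i 1) = (mat 1 :: 'k ^ 'n ^ 'n)" by (simp add: vec_eq_iff axis_def mat_def eq_commute)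
  then show ?thesis by (simp add: lin_det_def)
qed

lemma lin_det_diagonal_plus_rank_one:
  fixes l :: "'k::field ^ 'n \<Rightarrow> 'k"
  shows "lin_det (\<lambda>v. \<chi> i. d i * (v $ i + a i * l v)) = (\<Prod>i\<in>UNIV. d i) * (1 + (\<Sum>i\<in>UNIV. a i * l (axis i 1)))"
proof -
  let ?b = "\<chi> j. l (axis j 1)"
  have "(\<chi> j. (\<lambda>v. \<chi> i. d i * (v $ i + a i * l v)) (axis j 1)) = transpose (\<chi> i. d i *s (axis i 1 + a i *s ?b))"
    unfolding vec_eq_iff
  proof (intro allI)
    fix j i :: 'n
    have "axis j 1 $ i = (axis i 1 $ j :: 'k)" by (auto simp: axis_def)
    then show "(\<chi> j. (\<lambda>v. \<chi> i. d i * (v $ i + a i * l v)) (axis j 1)) $ j $ i =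
        transpose (\<chi> i. d i *s (axis i 1 + a i *s ?b)) $ j $ i"
      by (simp add: transpose_def algebra_simps)
  qed
  then have "lin_det (\<lambda>v. \<chi> i. d i * (v $ i + a i * l v)) = det (\<chi> i. d i *s (axis i 1 + a i *s ?b))"
    unfolding lin_det_def by (simp only: det_transpose)
  also have "\<dots> = (\<Prod>i\<in>UNIV. d i) * det (\<chi> i. axis i 1 + a i *s ?b)"
    by (rule det_rows_mul)
  finally show ?thesis by (simp add: det_identity_plus_rank_one)
qed

section \<open>Smooth maps and smooth families\<close>

context scalar_regularity
begin

definition smooth_map_at :: "('k ^ 'm \<Rightarrow> 'k ^ 'p) \<Rightarrow> 'k ^ 'm \<Rightarrow> bool" where
  "smooth_map_at G a \<longleftrightarrow> (\<forall>i. smooth_at (\<lambda>x. G x $ i) a)"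

lemma smooth_map_atI: "(\<And>i. smooth_at (\<lambda>x. G x $ i) a) \<Longrightarrow> smooth_map_at G a"
  by (simp add: smooth_map_at_def)

lemma smooth_map_atD: "smooth_map_at G a \<Longrightarrow> smooth_at (\<lambda>x. G x $ i) a"
  by (simp add: smooth_map_at_def)

lemma smooth_map_at_eventually:
  fixes G :: "'k ^ 'm \<Rightarrow> 'k ^ 'p"
  assumes "smooth_map_at G a"
  shows "\<forall>\<^sub>F x in nhds a. smooth_map_at G x"
  unfolding smooth_map_at_def
  by (rule eventually_all_finite) (rule smooth_at_eventually[OF smooth_map_atD[OF assms]])

lemma open_smooth_map_at:
  fixes G :: "'k ^ 'm \<Rightarrow> 'k ^ 'p"
  shows "open {x. smooth_map_at G x}"
proof -
  have "open (\<Inter>i. {x. smooth_at (\<lambda>x. G x $ i) x})" by (intro open_INT ballI open_smooth_at) auto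
  also have "(\<Inter>i. {x. smooth_at (\<lambda>x. G x $ i) x}) = {x. smooth_map_at G x}" by (auto simp: smooth_map_at_def)
  finally show ?thesis .
qed

lemma smooth_map_on_iff: "open U \<Longrightarrow> smooth_map_on reg G U \<longleftrightarrow> (\<forall>a\<in>U. smooth_map_at G a)"
  unfolding smooth_map_on_def smooth_map_at_def using smooth_on_iff_smooth_at by blast

lemma smooth_map_germ_iff:
  fixes G :: "'k ^ 'm \<Rightarrow> 'k ^ 'p"
  shows "smooth_map_germ reg G \<longleftrightarrow> smooth_map_at G 0"
proof
  assume "smooth_map_germ reg G"
  then obtain U where "open U" "0 \<in> U" "smooth_map_on reg G U" unfolding smooth_map_germ_def by blast
  then show "smooth_map_at G 0" using smooth_map_on_iff[of U G] by blast
next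
  assume "smooth_map_at G 0"
  then show "smooth_map_germ reg G"
    unfolding smooth_map_germ_def
    using smooth_map_on_iff[OF open_smooth_map_at, of G G] open_smooth_map_at[of G]
    by (intro exI[of _ "{x. smooth_map_at G x}"]) auto
qed

lemma smooth_germ_iff: "smooth_germ reg f \<longleftrightarrow> smooth_at f 0"
  unfolding smooth_germ_def smooth_at_def by blast

lemma smooth_map_at_has_derivative:
  fixes G :: "'k ^ 'm \<Rightarrow> 'k ^ 'p"
  assumes G: "smooth_map_at G a"
  shows "(G has_derivative frechet_derivative G (at a)) (at a)"
    and "frechet_derivative G (at a) v $ i = frechet_derivative (\<lambda>x. G x $ i) (at a) v"
    and "K_linear (frechet_derivative G (at a))"
proof -
  let ?D = "\<lambda>v. \<chi> i. frechet_derivative (\<lambda>x. G x $ i) (at a) v"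
  have D: "(G has_derivative ?D) (at a)"
    by (rule has_derivative_vecI) (simp add: smooth_at_has_derivative[OF smooth_map_atD[OF G]])
  note eq = frechet_derivative_at[OF D]
  show "(G has_derivative frechet_derivative G (at a)) (at a)" using D eq by simp
  show "frechet_derivative G (at a) v $ i = frechet_derivative (\<lambda>x. G x $ i) (at a) v"
    unfolding eq[symmetric] by simp
  have "?D (c *s x) = c *s ?D x" for c x
    by (simp add: vec_eq_iff smooth_at_has_derivative(2)[OF smooth_map_atD[OF G]])
  moreover have "?D (x + y) = ?D x + ?D y" for x y
    using linear_add[OF has_derivative_linear[OF D]] by blast
  ultimately show "K_linear (frechet_derivative G (at a))"
    unfolding eq[symmetric] K_linear_def by blast
qed

lemma smooth_map_at_isCont: "smooth_map_at G a \<Longrightarrow> isCont G a"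
  by (rule has_derivative_continuous[OF smooth_map_at_has_derivative(1)])

lemma smooth_at_compose_map:
  fixes G :: "'k ^ 'm \<Rightarrow> 'k ^ 'p"
  shows "smooth_at f (G a) \<Longrightarrow> smooth_map_at G a \<Longrightarrow> smooth_at (\<lambda>x. f (G x)) a"
  by (rule smooth_at_compose) (auto simp: smooth_map_at_def)

lemma smooth_map_at_compose:
  fixes G :: "'k ^ 'm \<Rightarrow> 'k ^ 'p" and F :: "'k ^ 'p \<Rightarrow> 'k ^ 'q"
  assumes "smooth_map_at F (G a)" "smooth_map_at G a"
  shows "smooth_map_at (\<lambda>x. F (G x)) a"
  by (rule smooth_map_atI, rule smooth_at_compose_map[OF smooth_map_atD[OF assms(1)] assms(2)])

lemma smooth_map_at_ident: "smooth_map_at (\<lambda>x. x) a"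
  by (intro smooth_map_atI smooth_at_nth)

lemma smooth_map_at_space_part: "smooth_map_at space_part a"
  by (intro smooth_map_atI) (simp add: smooth_at_nth)

lemma smooth_map_at_time_space:
  fixes f :: "'k ^ 'm \<Rightarrow> 'k" and g :: "'k ^ 'm \<Rightarrow> 'k ^ 'n"
  assumes "smooth_at f a" "smooth_map_at g a"
  shows "smooth_map_at (\<lambda>x. time_space (f x) (g x)) a"
proof (rule smooth_map_atI)
  show "smooth_at (\<lambda>x. time_space (f x) (g x) $ i) a" for i
    using assms smooth_map_atD[OF assms(2)] by (cases i) auto
qed

lemma smooth_at_lin_det:
  fixes G :: "'k ^ 'n \<Rightarrow> 'k ^ 'n"
  assumes G: "smooth_map_at G a"
  shows "smooth_at (\<lambda>x. lin_det (frechet_derivative G (at x))) a"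
proof -
  let ?f = "\<lambda>x. \<Sum>p\<in>{p. p permutes (UNIV :: 'n set)}. of_int (sign p) *
      (\<Prod>j\<in>UNIV. frechet_derivative (\<lambda>x. G x $ p j) (at x) (axis j 1))"
  have "smooth_at ?f a"
    by (intro smooth_at_sum smooth_at_mult smooth_at_const smooth_at_prod smooth_at_derivative smooth_map_atD[OF G])
  then show ?thesis
  proof (rule smooth_at_cong)
    show "\<forall>\<^sub>F x in nhds a. ?f x = lin_det (frechet_derivative G (at x))"
      using smooth_map_at_eventually[OF G]
      by eventually_elim (simp add: lin_det_def det_def smooth_map_at_has_derivative(2))
  qed
qed

lemma eventually_compose_isCont:
  assumes "isCont g a" "\<forall>\<^sub>F y in nhds (g a). P y"
  shows "\<forall>\<^sub>F x in nhds a. P (g x)"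
proof -
  have "filterlim g (nhds (g a)) (nhds a)"
    using assms(1) tendsto_at_iff_tendsto_nhds[of g a] by (simp add: isCont_def)
  then show ?thesis using assms(2) by (auto simp: filterlim_iff)
qed

lemma smooth_familyI:
  fixes F :: "'k ^ ('n::finite option) \<Rightarrow> 'k ^ 'p"
  assumes "\<And>t. t \<in> {0..1} \<Longrightarrow> smooth_map_at F (time_space (of_real t) 0)"
  shows "smooth_family reg (\<lambda>t x. F (time_space (of_real t) x))"
  unfolding smooth_family_def
  using assms smooth_map_on_iff[OF open_smooth_map_at, of F F] open_smooth_map_at[of F]
  by (intro exI[of _ "{q. smooth_map_at F q}"] exI[of _ F]) auto

text \<open>
  Local statements along \<open>[0,1] \<times> {0}\<close> hold on a neighbourhood of the origin that is uniform in time.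
\<close>

lemma eventually_time_tube:
  fixes P :: "'k ^ ('n::finite option) \<Rightarrow> bool"
  assumes "\<And>t. t \<in> {0..1} \<Longrightarrow> \<forall>\<^sub>F q in nhds (time_space (of_real t) 0). P q"
  shows "\<forall>\<^sub>F x in nhds 0. \<forall>t\<in>{0..1}. P (time_space (of_real t) x)"
proof -
  define S where "S = {q. eventually P (nhds q)}"
  have "open S"
    unfolding S_def
  proof (subst open_subopen, intro ballI)
    fix q assume "q \<in> {q. eventually P (nhds q)}"
    then obtain U where "open U" "q \<in> U" "\<forall>x\<in>U. P x" by (auto simp: eventually_nhds)
    then show "\<exists>T. open T \<and> q \<in> T \<and> T \<subseteq> {q. eventually P (nhds q)}"
      by (intro exI[of _ U]) (auto simp: eventually_nhds)
  qed
  then have "open ((\<lambda>(x, t). time_space (of_real t) x) -` S)"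
    by (rule open_vimage) (simp only: case_prod_beta', intro continuous_intros)
  moreover have "{0} \<times> {0..1} \<subseteq> (\<lambda>(x, t). time_space (of_real t) x) -` S"
    using assms by (auto simp: S_def)
  ultimately have "\<exists>X0. 0 \<in> X0 \<and> open X0 \<and> X0 \<times> {0..1} \<subseteq> (\<lambda>(x, t). time_space (of_real t) x) -` S"
    by (rule Elementary_Topology.tube_lemma[OF compact_Icc])
  then obtain X0 where X0: "0 \<in> X0" "open X0" "X0 \<times> {0..1} \<subseteq> (\<lambda>(x, t). time_space (of_real t) x) -` S"
    by blast
  have "P (time_space (of_real t) x)" if "x \<in> X0" "t \<in> {0..1}" for x t
  proof -
    have "time_space (of_real t) x \<in> S" using subsetD[OF X0(3), of "(x, t)"] that by simp
    then show ?thesis unfolding S_def by (auto dest: eventually_nhds_x_imp_x)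
  qed
  then show ?thesis unfolding eventually_nhds using X0 by blast
qed

end

section \<open>The flow of the Euler field\<close>

definition euler_flow :: "('n \<Rightarrow> nat) \<Rightarrow> 'k::{real_normed_field,banach} \<Rightarrow> 'k ^ 'n \<Rightarrow> 'k ^ 'n" where
  "euler_flow w \<tau> y = (\<chi> i. exp (of_nat (w i) * \<tau>) * y $ i)"

lemma euler_flow_nth [simp]: "euler_flow w \<tau> y $ i = exp (of_nat (w i) * \<tau>) * y $ i"
  by (simp add: euler_flow_def)

lemma euler_flow_zero [simp]: "euler_flow w \<tau> 0 = 0" "euler_flow w 0 y = y"
  by (simp_all add: vec_eq_iff)

lemma euler_flow_inverse: "euler_flow w (- \<tau>) (euler_flow w \<tau> y) = y"
proof -
  have "exp (of_nat (w i) * - \<tau>) * (exp (of_nat (w i) * \<tau>) * y $ i) = y $ i" for i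
    by (simp add: mult.assoc[symmetric] exp_add[symmetric])
  then show ?thesis by (simp add: vec_eq_iff)
qed

lemma euler_flow_has_vector_derivative:
  "((\<lambda>s. euler_flow w (of_real s * h) y) has_vector_derivative h *s euler_vector w (euler_flow w (of_real t * h) y)) (at t within S)"
  unfolding has_vector_derivative_def
proof (rule has_derivative_vecI)
  fix i
  have "((\<lambda>s. of_nat (w i) * (of_real s * h)) has_vector_derivative of_nat (w i) * (of_real 1 * h)) (at t within S)"
    by (intro derivative_intros)
  from field_vector_diff_chain_within[OF this DERIV_subset[OF DERIV_exp subset_UNIV]]
  have "((\<lambda>s. exp (of_nat (w i) * (of_real s * h))) has_vector_derivative
      of_nat (w i) * (of_real 1 * h) * exp (of_nat (w i) * (of_real t * h))) (at t within S)"
    by (simp add: o_def)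
  then have "((\<lambda>s. exp (of_nat (w i) * (of_real s * h)) * y $ i) has_vector_derivative
      of_nat (w i) * (of_real 1 * h) * exp (of_nat (w i) * (of_real t * h)) * y $ i) (at t within S)"
    by (rule has_vector_derivative_mult_left)
  then show "((\<lambda>s. euler_flow w (of_real s * h) y $ i) has_derivative
      (\<lambda>s. (s *\<^sub>R (h *s euler_vector w (euler_flow w (of_real t * h) y))) $ i)) (at t within S)"
    by (simp add: has_vector_derivative_def mult_ac)
qed

context scalar_regularity
begin

lemma smooth_map_at_euler_flow:
  fixes \<tau> :: "'k ^ 'm \<Rightarrow> 'k" and y :: "'k ^ 'm \<Rightarrow> 'k ^ 'n"
  assumes "smooth_at \<tau> a" "smooth_map_at y a"
  shows "smooth_map_at (\<lambda>x. euler_flow w (\<tau> x) (y x)) a"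
  by (rule smooth_map_atI)
    (simp add: smooth_at_mult smooth_at_exp smooth_at_const assms smooth_map_atD)

text \<open>
  The derivative is a diagonal map plus a map of rank one, and the rank one part has values along the
  Euler field. Therefore it maps the Euler field to a multiple of itself, and its determinant is given by
  the matrix determinant lemma.
\<close>

lemma euler_flow_graph_derivative:
  fixes h :: "'k ^ 'n \<Rightarrow> 'k" and w :: "'n \<Rightarrow> nat"
  assumes h: "smooth_at h y"
  defines "A \<equiv> frechet_derivative (\<lambda>y. euler_flow w (h y) y) (at y)" and "l \<equiv> frechet_derivative h (at y)"
  shows "A v = (\<chi> i. exp (of_nat (w i) * h y) * (v $ i + of_nat (w i) * y $ i * l v))"
    and "A (euler_vector w y) = (1 + l (euler_vector w y)) *s euler_vector w (euler_flow w (h y) y)"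
    and "lin_det A = exp (of_nat (\<Sum>i\<in>UNIV. w i) * h y) * (1 + l (euler_vector w y))"
proof -
  have A: "A v = (\<chi> i. exp (of_nat (w i) * h y) * (v $ i + of_nat (w i) * y $ i * l v))" for v
  proof -
    have "((\<lambda>y. euler_flow w (h y) y) has_derivative
        (\<lambda>v. \<chi> i. exp (of_nat (w i) * h y) * (v $ i + of_nat (w i) * y $ i * l v))) (at y)"
    proof (rule has_derivative_vecI)
      fix i
      have h': "((\<lambda>y. of_nat (w i) * h y) has_derivative (\<lambda>v. of_nat (w i) * l v)) (at y)"
        unfolding l_def by (intro has_derivative_mult_right smooth_at_has_derivative h)
      have "(exp has_derivative (*) (exp (of_nat (w i) * h y))) (at (of_nat (w i) * h y))"
        using DERIV_exp has_field_derivative_def by blast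
      from has_derivative_compose[OF h' this]
      have "((\<lambda>y. exp (of_nat (w i) * h y) * y $ i) has_derivative
          (\<lambda>v. exp (of_nat (w i) * h y) * v $ i + exp (of_nat (w i) * h y) * (of_nat (w i) * l v) * y $ i)) (at y)"
        by (intro has_derivative_mult bounded_linear.has_derivative[OF bounded_linear_vec_nth] has_derivative_ident)
      then show "((\<lambda>y. euler_flow w (h y) y $ i) has_derivative
          (\<lambda>v. (\<chi> i. exp (of_nat (w i) * h y) * (v $ i + of_nat (w i) * y $ i * l v)) $ i)) (at y)"
        by (simp add: algebra_simps)
    qed
    from fun_cong[OF frechet_derivative_at[OF this], of v] show ?thesis unfolding A_def by (rule sym)
  qed
  then show "A v = (\<chi> i. exp (of_nat (w i) * h y) * (v $ i + of_nat (w i) * y $ i * l v))" .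
  show "A (euler_vector w y) = (1 + l (euler_vector w y)) *s euler_vector w (euler_flow w (h y) y)"
    unfolding A by (simp add: vec_eq_iff algebra_simps)
  have "A = (\<lambda>v. \<chi> i. exp (of_nat (w i) * h y) * (v $ i + (of_nat (w i) * y $ i) * l v))"
    using A by blast
  then have "lin_det A = (\<Prod>i\<in>UNIV. exp (of_nat (w i) * h y)) * (1 + (\<Sum>i\<in>UNIV. (of_nat (w i) * y $ i) * l (axis i 1)))"
    by (simp only: lin_det_diagonal_plus_rank_one)
  also have "(\<Sum>i\<in>UNIV. (of_nat (w i) * y $ i) * l (axis i 1)) = l (euler_vector w y)"
    unfolding l_def using frechet_derivative_expand[OF h, of "euler_vector w y"] by simp
  also have "(\<Prod>i\<in>UNIV. exp (of_nat (w i) * h y)) = exp (of_nat (\<Sum>i\<in>UNIV. w i) * h y)"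
    by (simp add: exp_sum sum_distrib_right)
  finally show "lin_det A = exp (of_nat (\<Sum>i\<in>UNIV. w i) * h y) * (1 + l (euler_vector w y))" .
qed

text \<open>
  Differentiates \<open>e\<^bsup>W h\<^esup> (G\<^sub>1 \<circ> \<eta>) = G\<^sub>0\<close> along \<open>E\<close>, where \<open>\<eta>(y) = (e\<^bsup>w\<^sub>i h(y)\<^esup> y\<^sub>i)\<^sub>i\<close>. As the derivative of \<open>\<eta>\<close> maps
  \<open>E\<close> to \<open>(1 + E h) E\<close>, the factor \<open>e\<^bsup>W h\<^esup> (1 + E h)\<close> that comes out is the Jacobian determinant of \<open>\<eta>\<close>.
\<close>

lemma linearised_volume_equation:
  fixes h G\<^sub>0 G\<^sub>1 :: "'k ^ 'n \<Rightarrow> 'k" and w :: "'n \<Rightarrow> nat"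
  defines "W \<equiv> \<Sum>i\<in>UNIV. w i"
  assumes h: "smooth_at h y" and G1: "smooth_at G\<^sub>1 (euler_flow w (h y) y)"
    and eq: "\<forall>\<^sub>F y in nhds y. exp (of_nat W * h y) * G\<^sub>1 (euler_flow w (h y) y) = G\<^sub>0 y"
  shows "of_nat W * G\<^sub>0 y + frechet_derivative G\<^sub>0 (at y) (euler_vector w y) =
    (of_nat W * G\<^sub>1 (euler_flow w (h y) y) +
      frechet_derivative G\<^sub>1 (at (euler_flow w (h y) y)) (euler_vector w (euler_flow w (h y) y))) *
    lin_det (frechet_derivative (\<lambda>y. euler_flow w (h y) y) (at y))"
proof -
  let ?z = "euler_flow w (h y) y" and ?v = "euler_vector w y"
  let ?l = "frechet_derivative h (at y)" and ?A = "frechet_derivative (\<lambda>y. euler_flow w (h y) y) (at y)"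
  let ?D = "frechet_derivative G\<^sub>1 (at ?z)"
  have sm: "smooth_map_at (\<lambda>y. euler_flow w (h y) y) y"
    by (intro smooth_map_at_euler_flow h smooth_map_at_ident)
  have h': "((\<lambda>y. of_nat W * h y) has_derivative (\<lambda>v. of_nat W * ?l v)) (at y)"
    by (intro has_derivative_mult_right smooth_at_has_derivative h)
  have "(exp has_derivative (*) (exp (of_nat W * h y))) (at (of_nat W * h y))"
    using DERIV_exp has_field_derivative_def by blast
  note exp' = has_derivative_compose[OF h' this]
  note G1' = has_derivative_compose[OF smooth_map_at_has_derivative(1)[OF sm] smooth_at_has_derivative(1)[OF G1]]
  obtain N where N: "open N" "y \<in> N" "\<And>x. x \<in> N \<Longrightarrow> exp (of_nat W * h x) * G\<^sub>1 (euler_flow w (h x) x) = G\<^sub>0 x"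
    using eq unfolding eventually_nhds by blast
  have G0_deriv: "(G\<^sub>0 has_derivative (\<lambda>v. exp (of_nat W * h y) * ?D (?A v) + exp (of_nat W * h y) * (of_nat W * ?l v) * G\<^sub>1 ?z)) (at y)"
    by (rule has_derivative_transform_within_open[OF has_derivative_mult[OF exp' G1'] N(1,2)]) (rule N(3))
  have G0': "frechet_derivative G\<^sub>0 (at y) ?v = exp (of_nat W * h y) * ?D (?A ?v) + exp (of_nat W * h y) * (of_nat W * ?l ?v) * G\<^sub>1 ?z"
    using fun_cong[OF frechet_derivative_at[OF G0_deriv], of ?v] by (rule sym)
  have DA: "?D (?A ?v) = (1 + ?l ?v) * ?D (euler_vector w ?z)"
    unfolding euler_flow_graph_derivative(2)[OF h] smooth_at_has_derivative(2)[OF G1] ..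
  have J: "lin_det ?A = exp (of_nat W * h y) * (1 + ?l ?v)"
    unfolding W_def by (rule euler_flow_graph_derivative(3)[OF h])
  have "G\<^sub>0 y = exp (of_nat W * h y) * G\<^sub>1 ?z" using N(2,3) by simp
  then show ?thesis
    unfolding G0' DA J by (simp add: algebra_simps)
qed

end

section \<open>The isotopy of volume forms\<close>

context scalar_regularity
begin

lemma volume_form_density:
  fixes \<Omega> :: "'k ^ 'n \<Rightarrow> ('n \<Rightarrow> 'k ^ 'n) \<Rightarrow> 'k"
  assumes "volume_form_germ reg \<Omega>"
  defines "\<rho> \<equiv> \<lambda>x. \<Omega> x (\<lambda>i. axis i 1)"
  shows "smooth_at \<rho> 0" and "\<forall>\<^sub>F x in nhds 0. \<forall>v. \<Omega> x v = \<rho> x * det (\<chi> i. v i)" and "\<rho> 0 \<noteq> 0"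
proof -
  have ev: "\<forall>\<^sub>F x in nhds 0. alternating_multilinear (\<Omega> x) \<and> (\<exists>v. \<Omega> x v \<noteq> 0)"
    and sm: "\<And>v. smooth_germ reg (\<lambda>x. \<Omega> x v)"
    using assms(1) by (auto simp: volume_form_germ_def)
  show "smooth_at \<rho> 0"
    using sm[of "\<lambda>i. axis i 1"] by (simp add: \<rho>_def smooth_germ_iff)
  show den: "\<forall>\<^sub>F x in nhds 0. \<forall>v. \<Omega> x v = \<rho> x * det (\<chi> i. v i)"
    using ev by eventually_elim (simp add: \<rho>_def alternating_multilinear_eq_det[symmetric])
  obtain v where "\<Omega> 0 v \<noteq> 0" using eventually_nhds_x_imp_x[OF ev] by blast
  then show "\<rho> 0 \<noteq> 0" using eventually_nhds_x_imp_x[OF den] by auto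
qed

text \<open>
  \<open>\<phi>\<close> is the inverse of the coordinate change \<open>\<psi>\<close>. All that is used of the coordinates is collected here, in
  terms of \<open>\<phi>\<close>.
\<close>

lemma straightening:
  fixes X :: "'k ^ 'n \<Rightarrow> 'k ^ 'n"
  assumes "locally_diffeomorphic reg X Y"
  shows "\<exists>\<psi> \<phi>. smooth_map_at \<psi> 0 \<and> smooth_map_at \<phi> 0 \<and> \<psi> 0 = 0 \<and> \<phi> 0 = 0 \<and>
    (\<forall>\<^sub>F x in nhds 0. \<phi> (\<psi> x) = x) \<and>
    (\<forall>\<^sub>F y in nhds 0. smooth_map_at \<phi> y \<and> \<psi> (\<phi> y) = y \<and> frechet_derivative \<phi> (at y) (Y y) = X (\<phi> y) \<and>
      lin_det (frechet_derivative \<phi> (at y)) * lin_det (frechet_derivative \<psi> (at (\<phi> y))) = 1)"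
proof -
  obtain \<psi> where \<psi>: "diffeo_germ reg \<psi>" and X: "\<forall>\<^sub>F x in nhds 0. frechet_derivative \<psi> (at x) (X x) = Y (\<psi> x)"
    using assms unfolding locally_diffeomorphic_def by blast
  then obtain \<phi> where sm: "smooth_map_at \<psi> 0" "smooth_map_at \<phi> 0" and zero: "\<psi> 0 = 0" "\<phi> 0 = 0"
    and inv: "\<forall>\<^sub>F x in nhds 0. \<phi> (\<psi> x) = x" "\<forall>\<^sub>F y in nhds 0. \<psi> (\<phi> y) = y"
    unfolding diffeo_germ_def smooth_map_germ_iff by blast
  have inv': "\<forall>\<^sub>F x in nhds 0. \<forall>\<^sub>F x' in nhds x. \<phi> (\<psi> x') = x'"
    using inv(1) by (simp add: eventually_eventually)
  have "\<forall>\<^sub>F x in nhds (\<phi> 0). smooth_map_at \<psi> x \<and> frechet_derivative \<psi> (at x) (X x) = Y (\<psi> x) \<and> (\<forall>\<^sub>F x' in nhds x. \<phi> (\<psi> x') = x')"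
    unfolding zero(2) by (intro eventually_conj smooth_map_at_eventually[OF sm(1)] X inv')
  from eventually_compose_isCont[OF smooth_map_at_isCont[OF sm(2)] this]
  have "\<forall>\<^sub>F y in nhds 0. smooth_map_at \<phi> y \<and> \<psi> (\<phi> y) = y \<and> frechet_derivative \<phi> (at y) (Y y) = X (\<phi> y) \<and>
      lin_det (frechet_derivative \<phi> (at y)) * lin_det (frechet_derivative \<psi> (at (\<phi> y))) = 1"
    using smooth_map_at_eventually[OF sm(2)] inv(2)
  proof eventually_elim
    case (elim y)
    let ?x = "\<phi> y" and ?A = "frechet_derivative \<phi> (at y)" and ?B = "frechet_derivative \<psi> (at (\<phi> y))"
    have sm\<psi>: "smooth_map_at \<psi> ?x" and BX: "?B (X ?x) = Y (\<psi> ?x)" and ev: "\<forall>\<^sub>F x' in nhds ?x. \<phi> (\<psi> x') = x'"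
      and sm\<phi>: "smooth_map_at \<phi> y" and \<psi>\<phi>: "\<psi> (\<phi> y) = y"
      using elim by auto
    have "(\<phi> has_derivative ?A) (at (\<psi> ?x))"
      unfolding \<psi>\<phi> by (rule smooth_map_at_has_derivative(1)[OF sm\<phi>])
    from has_derivative_compose[OF smooth_map_at_has_derivative(1)[OF sm\<psi>] this]
    have comp: "((\<lambda>x. \<phi> (\<psi> x)) has_derivative (\<lambda>v. ?A (?B v))) (at ?x)" .
    obtain N where N: "open N" "?x \<in> N" "\<And>x'. x' \<in> N \<Longrightarrow> \<phi> (\<psi> x') = x'"
      using ev unfolding eventually_nhds by blast
    have "((\<lambda>x. x) has_derivative (\<lambda>v. ?A (?B v))) (at ?x)"
      by (rule has_derivative_transform_within_open[OF comp N(1,2)]) (rule N(3))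
    then have AB: "(\<lambda>v. ?A (?B v)) = (\<lambda>v. v)"
      using has_derivative_unique[OF _ has_derivative_ident] by blast
    have "?A (Y y) = X ?x" using fun_cong[OF AB, of "X ?x"] BX \<psi>\<phi> by simp
    moreover have "lin_det ?A * lin_det ?B = 1"
      using lin_det_compose[OF smooth_map_at_has_derivative(3)[OF sm\<phi>], of ?B] unfolding AB lin_det_id by simp
    ultimately show ?case using sm\<phi> \<psi>\<phi> by blast
  qed
  then show ?thesis using sm zero inv(1) by blast
qed

text \<open>
  At \<open>y = 0\<close> the flow does not move the point, so the equation in the unknown reduces to
  \<open>e\<^bsup>W u\<^esup> G\<^sub>1(0) = G\<^sub>0(0)\<close>: it is solved by \<open>u = l / W\<close>, and its slope is visibly not zero.
\<close>

lemma volume_equation_solution: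
  fixes G\<^sub>0 G\<^sub>1 :: "'k ^ 'n \<Rightarrow> 'k" and w :: "'n \<Rightarrow> nat"
  assumes G: "smooth_at G\<^sub>0 0" "smooth_at G\<^sub>1 0" "G\<^sub>1 0 \<noteq> 0" and W: "0 < W" and l: "G\<^sub>0 0 = exp l * G\<^sub>1 0"
  shows "\<exists>h. smooth_at h 0 \<and> (\<forall>\<^sub>F y in nhds 0. exp (of_nat W * h y) * G\<^sub>1 (euler_flow w (h y) y) = G\<^sub>0 y)"
proof -
  \<comment> \<open>The value of \<open>h\<close> at the origin.\<close>
  define b where "b = l / of_nat W"
  have Wb: "of_nat W * b = l" using W by (simp add: b_def)
  define F where "F q = exp (of_nat W * q $ None) * G\<^sub>1 (euler_flow w (q $ None) (space_part q)) - G\<^sub>0 (space_part q)"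
    for q :: "'k ^ ('n option)"
  have F_ts: "F (time_space u y) = exp (of_nat W * u) * G\<^sub>1 (euler_flow w u y) - G\<^sub>0 y" for u y
    by (simp add: F_def)
  have "smooth_map_at (\<lambda>q. euler_flow w (q $ None) (space_part q)) (time_space b (0 :: 'k ^ 'n))"
    by (rule smooth_map_at_euler_flow[OF smooth_at_nth smooth_map_at_space_part])
  then have G1_part: "smooth_at (\<lambda>q. G\<^sub>1 (euler_flow w (q $ None) (space_part q))) (time_space b 0)"
    by (rule smooth_at_compose_map[rotated]) (simp add: G)
  have G0_part: "smooth_at (\<lambda>q. G\<^sub>0 (space_part q)) (time_space b 0)"
    by (rule smooth_at_compose_map[OF _ smooth_map_at_space_part]) (simp add: G)
  have smF: "smooth_at F (time_space b 0)"
    unfolding F_def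
    by (rule smooth_at_diff[OF smooth_at_mult[OF smooth_at_exp[OF smooth_at_mult[OF smooth_at_const smooth_at_nth]] G1_part] G0_part])
  have "((\<lambda>u. F (time_space u 0)) has_field_derivative frechet_derivative F (at (time_space b 0)) (axis None 1)) (at b)"
    by (intro time_slice_has_field_derivative smooth_at_has_derivative smF)
  moreover have "((\<lambda>u. F (time_space u 0)) has_field_derivative of_nat W * (exp (of_nat W * b) * G\<^sub>1 0)) (at b)"
    unfolding F_ts euler_flow_zero by (auto intro!: derivative_eq_intros)
  ultimately have slope: "frechet_derivative F (at (time_space b 0)) (axis None 1) = of_nat W * (exp (of_nat W * b) * G\<^sub>1 0)"
    by (rule DERIV_unique)
  have "\<exists>V r g. open V \<and> {0} \<subseteq> V \<and> 0 < r \<and>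
    (\<forall>p\<in>V. g p \<in> cball b r \<and> F (time_space (g p) p) = 0 \<and> smooth_at g p \<and>
      (\<forall>u\<in>cball b r. F (time_space u p) = 0 \<longrightarrow> u = g p))"
  proof (rule smooth_implicit_function)
    show "F (time_space b p) = 0" if "p \<in> {0}" for p
      using that l by (simp add: F_ts Wb)
    show "of_nat W * (exp (of_nat W * b) * G\<^sub>1 0) \<noteq> 0" using W G(3) by simp
  qed (use smF slope in auto)
  then obtain V h where "open V" "0 \<in> V" "\<forall>y\<in>V. F (time_space (h y) y) = 0 \<and> smooth_at h y" by blast
  then have "smooth_at h 0" "\<forall>\<^sub>F y in nhds 0. F (time_space (h y) y) = 0"
    unfolding eventually_nhds by blast+
  then show ?thesis unfolding F_ts by auto
qed

text \<open>
  A point \<open>y\<close> reaches \<open>e\<^sub>t(y) = (e\<^bsup>w\<^sub>i t h(y)\<^esup> y\<^sub>i)\<^sub>i\<close> at time \<open>t\<close>. The value \<open>h(y)\<close> solves the equation \<open>u = h(e\<^bsup>-w\<^sub>i t u\<^esup> z\<^sub>i)\<close>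
  at \<open>z = e\<^sub>t(y)\<close>, because flowing back from \<open>z\<close> for the time \<open>t h(y)\<close> leads to \<open>y\<close>. At \<open>z = 0\<close> the equation reads
  \<open>u = h(0)\<close>, with slope 1, for every \<open>t\<close>; so it has a solution \<open>f\<close> around \<open>[0,1] \<times> {0}\<close>, and uniqueness
  identifies \<open>f(t, e\<^sub>t(y))\<close> with \<open>h(y)\<close>.
\<close>

lemma flow_time_in_target_coordinates:
  fixes h :: "'k ^ 'n \<Rightarrow> 'k" and w :: "'n \<Rightarrow> nat"
  assumes h: "smooth_at h 0"
  shows "\<exists>f. (\<forall>t\<in>{0..1}. smooth_at f (time_space (of_real t) 0)) \<and>
    (\<forall>t\<in>{0..1}. \<forall>\<^sub>F q in nhds (time_space (of_real t) 0).
      f (time_space (q $ None) (euler_flow w (q $ None * h (space_part q)) (space_part q))) = h (space_part q))"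
proof -
  \<comment> \<open>The unknown is the outer time coordinate, the parameter \<open>(t, z)\<close> is the space part.\<close>
  define F where "F q = q $ None - h (euler_flow w (- (space_part q $ None * q $ None)) (space_part (space_part q)))"
    for q :: "'k ^ ('n option option)"
  have F_ts: "F (time_space u p) = u - h (euler_flow w (- (p $ None * u)) (space_part p))" for u p
    by (simp add: F_def)
  define C where "C = (\<lambda>t. time_space (of_real t) 0 :: 'k ^ ('n option)) ` {0..1}"
  have C: "compact C"
    unfolding C_def by (intro compact_continuous_image continuous_intros compact_Icc)
  have space0: "space_part p = 0" if "p \<in> C" for p using that by (auto simp: C_def)
  have smF: "smooth_at F (time_space (h 0) p)" if p: "p \<in> C" for p
  proof -
    let ?q = "time_space (h 0) p"
    have "smooth_at (\<lambda>q. - (space_part q $ None * q $ None)) ?q"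
      by (rule smooth_at_minus[OF smooth_at_mult[OF smooth_map_atD[OF smooth_map_at_space_part] smooth_at_nth]])
    moreover have "smooth_map_at (\<lambda>q. space_part (space_part q)) ?q"
      by (rule smooth_map_at_compose[OF smooth_map_at_space_part smooth_map_at_space_part])
    ultimately have "smooth_map_at (\<lambda>q. euler_flow w (- (space_part q $ None * q $ None)) (space_part (space_part q))) ?q"
      by (rule smooth_map_at_euler_flow)
    then have "smooth_at (\<lambda>q. h (euler_flow w (- (space_part q $ None * q $ None)) (space_part (space_part q)))) ?q"
      by (rule smooth_at_compose_map[rotated]) (simp add: space0[OF p] h)
    then show ?thesis
      unfolding F_def by (rule smooth_at_diff[OF smooth_at_nth])
  qed
  have slope: "frechet_derivative F (at (time_space (h 0) p)) (axis None 1) = 1" if p: "p \<in> C" for p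
  proof (rule DERIV_unique)
    show "((\<lambda>u. F (time_space u p)) has_field_derivative frechet_derivative F (at (time_space (h 0) p)) (axis None 1)) (at (h 0))"
      by (intro time_slice_has_field_derivative smooth_at_has_derivative smF p)
    show "((\<lambda>u. F (time_space u p)) has_field_derivative 1) (at (h 0))"
      unfolding F_ts space0[OF p] euler_flow_zero by (auto intro!: derivative_eq_intros)
  qed
  have "\<exists>V r g. open V \<and> C \<subseteq> V \<and> 0 < r \<and>
    (\<forall>p\<in>V. g p \<in> cball (h 0) r \<and> F (time_space (g p) p) = 0 \<and> smooth_at g p \<and>
      (\<forall>u\<in>cball (h 0) r. F (time_space u p) = 0 \<longrightarrow> u = g p))"
    by (rule smooth_implicit_function[OF C smF _ slope]) (simp_all add: F_ts space0)
  then obtain V r f where V: "open V" "C \<subseteq> V" "0 < r"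
    and f: "\<forall>p\<in>V. smooth_at f p \<and> (\<forall>u\<in>cball (h 0) r. F (time_space u p) = 0 \<longrightarrow> u = f p)" by blast
  have "\<forall>\<^sub>F q in nhds (time_space (of_real t) 0).
      f (time_space (q $ None) (euler_flow w (q $ None * h (space_part q)) (space_part q))) = h (space_part q)"
    if t: "t \<in> {0..1}" for t
  proof -
    let ?p = "time_space (of_real t) (0 :: 'k ^ 'n)"
    let ?e = "\<lambda>q :: 'k ^ ('n option). time_space (q $ None) (euler_flow w (q $ None * h (space_part q)) (space_part q))"
    have smh: "smooth_at (\<lambda>q. h (space_part q)) ?p"
      by (rule smooth_at_compose_map[OF _ smooth_map_at_space_part]) (simp add: h)
    have "isCont ?e ?p"
      by (intro smooth_map_at_isCont smooth_map_at_time_space smooth_map_at_euler_flow smooth_at_mult smooth_at_nth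
          smh smooth_map_at_space_part)
    moreover have "\<forall>\<^sub>F p in nhds (?e ?p). p \<in> V"
      using V(1,2) t by (intro eventually_nhds_in_open) (auto simp: C_def)
    ultimately have 1: "\<forall>\<^sub>F q in nhds ?p. ?e q \<in> V" by (rule eventually_compose_isCont)
    have "\<forall>\<^sub>F u in nhds (h (space_part ?p)). u \<in> cball (h 0) r"
      using eventually_nhds_in_open[OF open_ball, of "h 0" "h 0" r] V(3) by (auto elim: eventually_mono)
    then have 2: "\<forall>\<^sub>F q in nhds ?p. h (space_part q) \<in> cball (h 0) r"
      by (rule eventually_compose_isCont[OF smooth_at_isCont[OF smh]])
    from 1 2 show ?thesis
    proof eventually_elim
      case (elim q)
      have "F (time_space (h (space_part q)) (?e q)) = 0"
        by (simp add: F_ts euler_flow_inverse)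
      then show ?case using f elim by metis
    qed
  qed
  moreover have "smooth_at f (time_space (of_real t) 0)" if "t \<in> {0..1}" for t
  proof -
    have "time_space (of_real t) 0 \<in> V" using V(2) that unfolding C_def by blast
    then show ?thesis using f by blast
  qed
  ultimately show ?thesis by blast
qed

text \<open>
  The isotopy is \<open>\<Phi>\<^sub>t = \<phi> \<circ> e\<^sub>t \<circ> \<psi>\<close> with the coordinate change \<open>\<psi>\<close>, its inverse \<open>\<phi>\<close> and \<open>e\<^sub>t\<close> as above. The last
  hypothesis says that the densities of the two forms at the origin lie on a common orbit of the
  flow, so that the equation for \<open>h\<close> can be solved there.
\<close>

theorem isotopic_if_euler_module:
  fixes X :: "'k ^ 'n \<Rightarrow> 'k ^ 'n" and w :: "'n \<Rightarrow> nat"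
  assumes LH: "is_lie_algebra_of reg LH H"
    and X: "smooth_map_germ reg X" and W: "0 < (\<Sum>i\<in>UNIV. w i)"
    and diffeo: "locally_diffeomorphic reg X (euler_vector w)"
    and module: "\<And>f. smooth_germ reg f \<Longrightarrow> germ (\<lambda>x. f x *s X x) \<in> LH"
    and vol: "volume_form_germ reg \<Omega>\<^sub>0" "volume_form_germ reg \<Omega>\<^sub>1"
    and ratio: "\<Omega>\<^sub>0 0 (\<lambda>i. axis i 1) = exp l * \<Omega>\<^sub>1 0 (\<lambda>i. axis i 1)"
  shows "isotopic reg H \<Omega>\<^sub>0 \<Omega>\<^sub>1"
proof -
  let ?W = "\<Sum>i\<in>UNIV. w i" and ?E = "euler_vector w :: 'k ^ 'n \<Rightarrow> 'k ^ 'n"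
  define \<rho>\<^sub>0 where "\<rho>\<^sub>0 x = \<Omega>\<^sub>0 x (\<lambda>i. axis i 1)" for x
  define \<rho>\<^sub>1 where "\<rho>\<^sub>1 x = \<Omega>\<^sub>1 x (\<lambda>i. axis i 1)" for x
  note \<rho>\<^sub>0 = volume_form_density[OF vol(1), folded \<rho>\<^sub>0_def]
  note \<rho>\<^sub>1 = volume_form_density[OF vol(2), folded \<rho>\<^sub>1_def]
  obtain \<psi> \<phi> where sm: "smooth_map_at \<psi> 0" "smooth_map_at \<phi> 0" and zero: "\<psi> 0 = 0" "\<phi> 0 = 0"
    and \<phi>\<psi>: "\<forall>\<^sub>F x in nhds 0. \<phi> (\<psi> x) = x"
    and \<phi>: "\<forall>\<^sub>F y in nhds 0. smooth_map_at \<phi> y \<and> \<psi> (\<phi> y) = y \<and> frechet_derivative \<phi> (at y) (?E y) = X (\<phi> y) \<and>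
      lin_det (frechet_derivative \<phi> (at y)) * lin_det (frechet_derivative \<psi> (at (\<phi> y))) = 1"
    using straightening[OF diffeo] by blast
  let ?J = "\<lambda>y. lin_det (frechet_derivative \<phi> (at y))"
  have J0: "?J 0 \<noteq> 0" using eventually_nhds_x_imp_x[OF \<phi>] by auto
  have smJ: "smooth_at ?J 0" by (rule smooth_at_lin_det[OF sm(2)])
  have g: "smooth_at (\<lambda>y. \<rho>\<^sub>0 (\<phi> y) * ?J y) 0" "smooth_at (\<lambda>y. \<rho>\<^sub>1 (\<phi> y) * ?J y) 0"
    by (intro smooth_at_mult smJ smooth_at_compose_map[OF _ sm(2)], simp add: zero \<rho>\<^sub>0(1) \<rho>\<^sub>1(1))+
  obtain G\<^sub>0 where G\<^sub>0: "smooth_at G\<^sub>0 0"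
    "\<forall>\<^sub>F y in nhds 0. of_nat ?W * G\<^sub>0 y + frechet_derivative G\<^sub>0 (at y) (?E y) = \<rho>\<^sub>0 (\<phi> y) * ?J y"
    using weighted_primitive[OF g(1) W] by blast
  obtain G\<^sub>1 where G\<^sub>1: "smooth_at G\<^sub>1 0"
    "\<forall>\<^sub>F y in nhds 0. of_nat ?W * G\<^sub>1 y + frechet_derivative G\<^sub>1 (at y) (?E y) = \<rho>\<^sub>1 (\<phi> y) * ?J y"
    using weighted_primitive[OF g(2) W] by blast
  have E0: "?E 0 = 0" by (simp add: vec_eq_iff)
  have D0: "frechet_derivative G (at 0) 0 = 0" if "smooth_at G 0" for G :: "'k ^ 'n \<Rightarrow> 'k"
    using smooth_at_has_derivative(2)[OF that, of 0 0] by simp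
  have G\<^sub>0_0: "of_nat ?W * G\<^sub>0 0 = \<rho>\<^sub>0 0 * ?J 0"
    using eventually_nhds_x_imp_x[OF G\<^sub>0(2)] D0[OF G\<^sub>0(1)] by (simp only: E0 zero add_0_right)
  have G\<^sub>1_0: "of_nat ?W * G\<^sub>1 0 = \<rho>\<^sub>1 0 * ?J 0"
    using eventually_nhds_x_imp_x[OF G\<^sub>1(2)] D0[OF G\<^sub>1(1)] by (simp only: E0 zero add_0_right)
  have W0: "of_nat ?W \<noteq> (0 :: 'k)" using W by (simp only: of_nat_eq_0_iff)
  have "of_nat ?W * G\<^sub>0 0 = of_nat ?W * (exp l * G\<^sub>1 0)"
    using ratio G\<^sub>1_0 unfolding G\<^sub>0_0 \<rho>\<^sub>0_def[symmetric] \<rho>\<^sub>1_def[symmetric] by (simp only: mult.left_commute mult.assoc)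
  then have l: "G\<^sub>0 0 = exp l * G\<^sub>1 0" using W0 by (simp only: mult_cancel_left simp_thms)
  have "G\<^sub>1 0 \<noteq> 0" using G\<^sub>1_0 \<rho>\<^sub>1(3) J0 by auto
  then obtain h where h: "smooth_at h 0"
    and h_eq: "\<forall>\<^sub>F y in nhds 0. exp (of_nat ?W * h y) * G\<^sub>1 (euler_flow w (h y) y) = G\<^sub>0 y"
    using volume_equation_solution[OF G\<^sub>0(1) G\<^sub>1(1) _ W l] by blast
  obtain f where smf: "\<And>t. t \<in> {0..1} \<Longrightarrow> smooth_at f (time_space (of_real t) 0)"
    and f: "\<And>t. t \<in> {0..1} \<Longrightarrow> \<forall>\<^sub>F q in nhds (time_space (of_real t) 0).
      f (time_space (q $ None) (euler_flow w (q $ None * h (space_part q)) (space_part q))) = h (space_part q)"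
    using flow_time_in_target_coordinates[OF h, of w] by blast

  \<comment> \<open>The isotopy in straightened coordinates as a map of time and point, the isotopy, and its generators \<open>f\<^sub>t X\<close>.\<close>
  define e where "e q = euler_flow w (q $ None * h (\<psi> (space_part q))) (\<psi> (space_part q))" for q :: "'k ^ ('n option)"
  define \<Phi> where "\<Phi> t x = \<phi> (e (time_space (of_real t) x))" for t x
  define Y where "Y t x = f (time_space (of_real t) (\<psi> x)) *s X x" for t x
  have sm_\<psi>: "smooth_map_at (\<lambda>q. \<psi> (space_part q)) (time_space t 0)" for t
    by (rule smooth_map_at_compose[OF _ smooth_map_at_space_part]) (simp add: sm)
  have sm_h: "smooth_at (\<lambda>q. h (\<psi> (space_part q))) (time_space t 0)" for t
    by (rule smooth_at_compose_map[OF _ sm_\<psi>]) (simp add: zero h)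
  have e0: "e (time_space t 0) = 0" for t by (simp add: e_def zero)
  have sm_e: "smooth_map_at e (time_space t 0)" for t
    unfolding e_def by (intro smooth_map_at_euler_flow smooth_at_mult smooth_at_nth sm_h sm_\<psi>)
  have fam_\<Phi>: "smooth_family reg \<Phi>"
    unfolding \<Phi>_def[abs_def]
    by (rule smooth_familyI, rule smooth_map_at_compose[OF _ sm_e]) (simp add: e0 sm)
  have smX: "smooth_map_at X 0" using X by (simp add: smooth_map_germ_iff)
  have "smooth_family reg (\<lambda>t x. (\<lambda>q. f (time_space (q $ None) (\<psi> (space_part q))) *s X (space_part q)) (time_space (of_real t) x))"
  proof (rule smooth_familyI, rule smooth_map_atI)
    fix t :: real and i assume t: "t \<in> {0..1}"
    have "smooth_at (\<lambda>q. f (time_space (q $ None) (\<psi> (space_part q)))) (time_space (of_real t) 0)"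
      by (rule smooth_at_compose_map[OF _ smooth_map_at_time_space[OF smooth_at_nth sm_\<psi>]]) (simp add: zero smf[OF t])
    moreover have "smooth_at (\<lambda>q. X (space_part q) $ i) (time_space (of_real t) 0)"
      by (rule smooth_at_compose_map[where f = "\<lambda>x. X x $ i", OF _ smooth_map_at_space_part])
        (simp add: smooth_map_atD[OF smX])
    ultimately show "smooth_at (\<lambda>q. (f (time_space (q $ None) (\<psi> (space_part q))) *s X (space_part q)) $ i) (time_space (of_real t) 0)"
      by (simp add: smooth_at_mult)
  qed
  then have fam_Y: "smooth_family reg Y" by (simp add: Y_def[abs_def])
  have Y_LH: "germ (Y t) \<in> LH" if t: "t \<in> {0..1}" for t
    unfolding Y_def
  proof (rule module)
    have "smooth_at (\<lambda>x. f (time_space (of_real t) (\<psi> x))) 0"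
      by (rule smooth_at_compose_map[OF _ smooth_map_at_time_space[OF smooth_at_const sm(1)]]) (simp add: zero smf[OF t])
    then show "smooth_germ reg (\<lambda>x. f (time_space (of_real t) (\<psi> x)))" by (simp add: smooth_germ_iff)
  qed
  have start: "germ (\<Phi> 0) = germ (\<lambda>x. x)"
    unfolding germ_eq_iff using \<phi>\<psi> by eventually_elim (simp add: \<Phi>_def e_def)

  \<comment> \<open>What the flow equation needs at time \<open>t\<close>, on a neighbourhood of \<open>(t, 0)\<close>.\<close>
  have near: "\<forall>\<^sub>F q in nhds (time_space (of_real t) 0). smooth_map_at \<phi> (e q) \<and> \<psi> (\<phi> (e q)) = e q \<and>
      frechet_derivative \<phi> (at (e q)) (?E (e q)) = X (\<phi> (e q)) \<and>
      f (time_space (q $ None) (e q)) = h (\<psi> (space_part q))" if t: "t \<in> {0..1}" for t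
  proof -
    let ?p = "time_space (of_real t) (0 :: 'k ^ 'n)"
    have "\<forall>\<^sub>F q in nhds ?p. smooth_map_at \<phi> (e q) \<and> \<psi> (\<phi> (e q)) = e q \<and>
        frechet_derivative \<phi> (at (e q)) (?E (e q)) = X (\<phi> (e q)) \<and>
        ?J (e q) * lin_det (frechet_derivative \<psi> (at (\<phi> (e q)))) = 1"
      by (rule eventually_compose_isCont[OF smooth_map_at_isCont[OF sm_e]]) (simp only: e0 \<phi>)
    moreover have "\<forall>\<^sub>F q in nhds ?p. f (time_space (q $ None) (e q)) = h (\<psi> (space_part q))"
    proof -
      let ?k = "\<lambda>q :: 'k ^ ('n option). time_space (q $ None) (\<psi> (space_part q))"
      have "isCont ?k ?p"
        by (intro smooth_map_at_isCont smooth_map_at_time_space smooth_at_nth sm_\<psi>)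
      moreover have "?k ?p = ?p" by (simp add: zero)
      then have "\<forall>\<^sub>F q in nhds (?k ?p). f (time_space (q $ None) (euler_flow w (q $ None * h (space_part q)) (space_part q))) = h (space_part q)"
        using f[OF t] by simp
      ultimately show ?thesis
        by (drule_tac eventually_compose_isCont) (assumption, simp add: e_def)
    qed
    ultimately show ?thesis by eventually_elim blast
  qed
  have flow: "flow_equation Y \<Phi>"
    unfolding flow_equation_def
  proof (rule eventually_mono[OF eventually_time_tube[where P = "\<lambda>q. smooth_map_at \<phi> (e q) \<and> \<psi> (\<phi> (e q)) = e q \<and>
      frechet_derivative \<phi> (at (e q)) (?E (e q)) = X (\<phi> (e q)) \<and>
      f (time_space (q $ None) (e q)) = h (\<psi> (space_part q))"]])
    fix x assume elim: "\<forall>t\<in>{0..1}. smooth_map_at \<phi> (e (time_space (of_real t) x)) \<and>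
      \<psi> (\<phi> (e (time_space (of_real t) x))) = e (time_space (of_real t) x) \<and>
      frechet_derivative \<phi> (at (e (time_space (of_real t) x))) (?E (e (time_space (of_real t) x))) =
        X (\<phi> (e (time_space (of_real t) x))) \<and>
      f (time_space (time_space (of_real t) x $ None) (e (time_space (of_real t) x))) =
        h (\<psi> (space_part (time_space (of_real t) x)))"
    show "\<forall>t\<in>{0..1}. ((\<lambda>s. \<Phi> s x) has_vector_derivative Y t (\<Phi> t x)) (at t within {0..1})"
    proof
      fix t :: real assume t: "t \<in> {0..1}"
      let ?y = "\<psi> x" and ?z = "e (time_space (of_real t) x)"
      have sm\<phi>: "smooth_map_at \<phi> ?z" and inv: "\<psi> (\<phi> ?z) = ?z"
        and dir: "frechet_derivative \<phi> (at ?z) (?E ?z) = X (\<phi> ?z)"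
        and time: "f (time_space (of_real t) ?z) = h ?y"
        using elim t by auto
      have z: "e (time_space (of_real s) x) = euler_flow w (of_real s * h ?y) ?y" for s :: real
        by (simp add: e_def)
      have "((\<lambda>s. e (time_space (of_real s) x)) has_vector_derivative h ?y *s ?E ?z) (at t within {0..1})"
        unfolding z by (rule euler_flow_has_vector_derivative)
      from has_derivative_compose[OF this[unfolded has_vector_derivative_def] smooth_map_at_has_derivative(1)[OF sm\<phi>]]
      have "((\<lambda>s. \<Phi> s x) has_derivative (\<lambda>s. frechet_derivative \<phi> (at ?z) (s *\<^sub>R (h ?y *s ?E ?z)))) (at t within {0..1})"
        by (simp add: \<Phi>_def)
      moreover have "frechet_derivative \<phi> (at ?z) (s *\<^sub>R (h ?y *s ?E ?z)) = s *\<^sub>R Y t (\<Phi> t x)" for s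
      proof -
        have "frechet_derivative \<phi> (at ?z) (s *\<^sub>R (h ?y *s ?E ?z)) = s *\<^sub>R frechet_derivative \<phi> (at ?z) (h ?y *s ?E ?z)"
          by (rule linear_scale[OF has_derivative_linear[OF smooth_map_at_has_derivative(1)[OF sm\<phi>]]])
        also have "frechet_derivative \<phi> (at ?z) (h ?y *s ?E ?z) = h ?y *s frechet_derivative \<phi> (at ?z) (?E ?z)"
          using smooth_map_at_has_derivative(3)[OF sm\<phi>] unfolding K_linear_def by blast
        also have "\<dots> = Y t (\<Phi> t x)"
          unfolding dir by (simp add: Y_def \<Phi>_def inv time)
        finally show ?thesis .
      qed
      ultimately show "((\<lambda>s. \<Phi> s x) has_vector_derivative Y t (\<Phi> t x)) (at t within {0..1})"
        unfolding has_vector_derivative_def by (simp only:)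
    qed
  qed (use near in blast)
  have in_H: "\<forall>t\<in>{0..1}. germ (\<Phi> t) \<in> H"
    using LH fam_\<Phi> start fam_Y Y_LH flow unfolding is_lie_algebra_of_def by blast

  let ?e1 = "\<lambda>y. euler_flow w (h y) y"
  have \<Phi>1: "\<Phi> 1 = (\<lambda>x. \<phi> (?e1 (\<psi> x)))" by (simp add: fun_eq_iff \<Phi>_def e_def)
  have sm_e1: "smooth_map_at ?e1 0" by (intro smooth_map_at_euler_flow h smooth_map_at_ident)
  \<comment> \<open>The volume equation in the straightened coordinates.\<close>
  have vol_eq: "\<forall>\<^sub>F y in nhds 0. smooth_map_at ?e1 y \<and> smooth_map_at \<phi> (?e1 y) \<and>
      \<rho>\<^sub>0 (\<phi> y) * ?J y = \<rho>\<^sub>1 (\<phi> (?e1 y)) * ?J (?e1 y) * lin_det (frechet_derivative ?e1 (at y)) \<and>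
      (\<forall>v. \<Omega>\<^sub>1 (\<phi> (?e1 y)) v = \<rho>\<^sub>1 (\<phi> (?e1 y)) * det (\<chi> i. v i))"
  proof -
    have "\<forall>\<^sub>F y in nhds 0. \<forall>v. \<Omega>\<^sub>1 (\<phi> y) v = \<rho>\<^sub>1 (\<phi> y) * det (\<chi> i. v i)"
      by (rule eventually_compose_isCont[OF smooth_map_at_isCont[OF sm(2)]]) (simp only: zero \<rho>\<^sub>1(2))
    then have "\<forall>\<^sub>F z in nhds 0. smooth_at G\<^sub>1 z \<and> smooth_map_at \<phi> z \<and> of_nat ?W * G\<^sub>1 z + frechet_derivative G\<^sub>1 (at z) (?E z) = \<rho>\<^sub>1 (\<phi> z) * ?J z \<and>
        (\<forall>v. \<Omega>\<^sub>1 (\<phi> z) v = \<rho>\<^sub>1 (\<phi> z) * det (\<chi> i. v i))"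
      by (intro eventually_conj smooth_at_eventually[OF G\<^sub>1(1)] smooth_map_at_eventually[OF sm(2)] G\<^sub>1(2))
    then have "\<forall>\<^sub>F y in nhds 0. smooth_at G\<^sub>1 (?e1 y) \<and> smooth_map_at \<phi> (?e1 y) \<and>
        of_nat ?W * G\<^sub>1 (?e1 y) + frechet_derivative G\<^sub>1 (at (?e1 y)) (?E (?e1 y)) = \<rho>\<^sub>1 (\<phi> (?e1 y)) * ?J (?e1 y) \<and>
        (\<forall>v. \<Omega>\<^sub>1 (\<phi> (?e1 y)) v = \<rho>\<^sub>1 (\<phi> (?e1 y)) * det (\<chi> i. v i))"
      by (intro eventually_compose_isCont[OF smooth_map_at_isCont[OF sm_e1]]) (simp only: euler_flow_zero)
    moreover have "\<forall>\<^sub>F y in nhds 0. \<forall>\<^sub>F y' in nhds y. exp (of_nat ?W * h y') * G\<^sub>1 (?e1 y') = G\<^sub>0 y'"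
      using h_eq by (simp only: eventually_eventually)
    ultimately show ?thesis
      using smooth_map_at_eventually[OF sm_e1] smooth_at_eventually[OF h] G\<^sub>0(2)
    proof eventually_elim
      case (elim y)
      then have "of_nat ?W * G\<^sub>0 y + frechet_derivative G\<^sub>0 (at y) (?E y) =
          (of_nat ?W * G\<^sub>1 (?e1 y) + frechet_derivative G\<^sub>1 (at (?e1 y)) (?E (?e1 y))) * lin_det (frechet_derivative ?e1 (at y))"
        by (intro linearised_volume_equation) blast+
      with elim show ?case by (simp only: simp_thms)
    qed
  qed
  have "\<forall>\<^sub>F x in nhds 0. smooth_map_at ?e1 (\<psi> x) \<and> smooth_map_at \<phi> (?e1 (\<psi> x)) \<and>
      \<rho>\<^sub>0 (\<phi> (\<psi> x)) * ?J (\<psi> x) = \<rho>\<^sub>1 (\<phi> (?e1 (\<psi> x))) * ?J (?e1 (\<psi> x)) * lin_det (frechet_derivative ?e1 (at (\<psi> x))) \<and>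
      (\<forall>v. \<Omega>\<^sub>1 (\<phi> (?e1 (\<psi> x))) v = \<rho>\<^sub>1 (\<phi> (?e1 (\<psi> x))) * det (\<chi> i. v i))"
    by (rule eventually_compose_isCont[OF smooth_map_at_isCont[OF sm(1)]]) (simp only: zero vol_eq)
  moreover have "\<forall>\<^sub>F x in nhds 0. ?J (\<psi> x) * lin_det (frechet_derivative \<psi> (at (\<phi> (\<psi> x)))) = 1"
  proof -
    have "\<forall>\<^sub>F y in nhds (\<psi> 0). ?J y * lin_det (frechet_derivative \<psi> (at (\<phi> y))) = 1"
      unfolding zero using \<phi> by eventually_elim blast
    then show ?thesis by (rule eventually_compose_isCont[OF smooth_map_at_isCont[OF sm(1)]])
  qed
  ultimately have "\<forall>\<^sub>F x in nhds 0. pullback_form (\<Phi> 1) \<Omega>\<^sub>1 x = \<Omega>\<^sub>0 x"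
    using \<phi>\<psi> \<rho>\<^sub>0(2) smooth_map_at_eventually[OF sm(1)]
  proof eventually_elim
    case (elim x)
    let ?y = "\<psi> x"
    let ?z = "?e1 ?y"
    let ?P = "frechet_derivative \<psi> (at x)" and ?B = "frechet_derivative ?e1 (at ?y)" and ?A = "frechet_derivative \<phi> (at ?z)"
    have sm': "smooth_map_at \<psi> x" "smooth_map_at ?e1 ?y" "smooth_map_at \<phi> ?z" and inv: "\<phi> ?y = x"
      and J: "?J ?y * lin_det ?P = 1" and vol: "\<rho>\<^sub>0 x * ?J ?y = \<rho>\<^sub>1 (\<phi> ?z) * lin_det ?A * lin_det ?B"
      and \<Omega>: "\<And>v. \<Omega>\<^sub>1 (\<phi> ?z) v = \<rho>\<^sub>1 (\<phi> ?z) * det (\<chi> i. v i)" "\<And>v. \<Omega>\<^sub>0 x v = \<rho>\<^sub>0 x * det (\<chi> i. v i)"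
      using elim by auto
    note D = sm'[THEN smooth_map_at_has_derivative(1)] and lin = sm'[THEN smooth_map_at_has_derivative(3)]
    have "(\<Phi> 1 has_derivative (\<lambda>v. ?A (?B (?P v)))) (at x)"
      unfolding \<Phi>1 by (rule has_derivative_compose[OF has_derivative_compose[OF D(1) D(2)] D(3)])
    then have D\<Phi>: "frechet_derivative (\<Phi> 1) (at x) = (\<lambda>v. ?A (?B (?P v)))"
      by (rule frechet_derivative_at[symmetric])
    have det: "det (\<chi> i. ?A (?B (?P (v i)))) = det (\<chi> i. v i) * lin_det ?P * lin_det ?B * lin_det ?A" for v
      by (simp only: det_linear_image[OF lin(3), of "\<lambda>i. ?B (?P (v i))"] det_linear_image[OF lin(2), of "\<lambda>i. ?P (v i)"]
          det_linear_image[OF lin(1)])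
    have \<Phi>1_x: "\<Phi> 1 x = \<phi> ?z" by (simp only: \<Phi>1)
    show "pullback_form (\<Phi> 1) \<Omega>\<^sub>1 x = \<Omega>\<^sub>0 x"
    proof
      fix v
      have "pullback_form (\<Phi> 1) \<Omega>\<^sub>1 x v = (\<rho>\<^sub>1 (\<phi> ?z) * lin_det ?A * lin_det ?B) * lin_det ?P * det (\<chi> i. v i)"
        by (simp only: pullback_form_def D\<Phi> \<Phi>1_x \<Omega>(1) det mult_ac)
      also have "\<dots> = (\<rho>\<^sub>0 x * ?J ?y) * lin_det ?P * det (\<chi> i. v i)"
        by (simp only: vol)
      also have "\<dots> = \<rho>\<^sub>0 x * (?J ?y * lin_det ?P) * det (\<chi> i. v i)"
        by (simp only: mult.assoc)
      finally show "pullback_form (\<Phi> 1) \<Omega>\<^sub>1 x v = \<Omega>\<^sub>0 x v" by (simp add: J \<Omega>(2))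
    qed
  qed
  then have "germ (pullback_form (\<Phi> 1) \<Omega>\<^sub>1) = germ \<Omega>\<^sub>0" by (simp only: germ_eq_iff)
  then show ?thesis
    unfolding isotopic_def using fam_\<Phi> in_H start by blast
qed

end

lemma real_scalar_regularity: "scalar_regularity reg complex_of_real Re"
  by (rule scalar_regularity.intro) (auto intro: bounded_linear_of_real bounded_linear_Re)

lemma complex_scalar_regularity: "scalar_regularity Analytic (\<lambda>z. z) (\<lambda>z. z)"
  by (rule scalar_regularity.intro) auto

lemma euler_field_eq_euler_vector:
  "(\<forall>i. 0 \<le> w i) \<Longrightarrow> euler_field w = euler_vector (\<lambda>i. nat (w i))"
  by (rule ext) (simp add: euler_field_def euler_vector_def)

lemma sum_nat_weights_pos:
  fixes w :: "'n::finite \<Rightarrow> int"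
  assumes "\<forall>i. 0 \<le> w i" "0 < (\<Sum>i\<in>UNIV. w i)"
  shows "0 < (\<Sum>i\<in>UNIV. nat (w i))"
proof -
  have "int (\<Sum>i\<in>UNIV. nat (w i)) = (\<Sum>i\<in>UNIV. w i)" using assms(1) by simp
  then show ?thesis using assms(2) by linarith
qed

text \<open>
  Testing the orientations on the standard basis and on the basis with one vector reversed shows that
  the densities have the same sign.
\<close>

lemma same_orientation_imp_density_ratio:
  fixes \<Omega>\<^sub>0 \<Omega>\<^sub>1 :: "real ^ 'n \<Rightarrow> ('n \<Rightarrow> real ^ 'n) \<Rightarrow> real"
  assumes vol: "volume_form_germ reg \<Omega>\<^sub>0" "volume_form_germ reg \<Omega>\<^sub>1" and orient: "same_orientation \<Omega>\<^sub>0 \<Omega>\<^sub>1"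
  obtains l where "\<Omega>\<^sub>0 0 (\<lambda>i. axis i 1) = exp l * \<Omega>\<^sub>1 0 (\<lambda>i. axis i 1)"
proof -
  let ?e = "\<lambda>i. axis i 1 :: real ^ 'n"
  have alt: "alternating_multilinear (\<Omega>\<^sub>0 0)" "alternating_multilinear (\<Omega>\<^sub>1 0)"
    using vol unfolding volume_form_germ_def by (auto dest: eventually_nhds_x_imp_x)
  have nz: "\<Omega>\<^sub>0 0 ?e \<noteq> 0" "\<Omega>\<^sub>1 0 ?e \<noteq> 0"
    using scalar_regularity.volume_form_density(3)[OF real_scalar_regularity vol(1)] scalar_regularity.volume_form_density(3)[OF real_scalar_regularity vol(2)] .
  have or: "0 < \<Omega>\<^sub>0 0 v \<longleftrightarrow> 0 < \<Omega>\<^sub>1 0 v" for v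
    using orient unfolding same_orientation_def by (auto dest: eventually_nhds_x_imp_x)
  obtain k :: 'n where True by blast
  have neg: "\<Omega> (?e(k := (-1) *s ?e k)) = - \<Omega> ?e" if "alternating_multilinear \<Omega>" for \<Omega> :: "('n \<Rightarrow> real ^ 'n) \<Rightarrow> real"
  proof -
    have "?e(k := ?e k) = ?e" by auto
    then show ?thesis using alternating_multilinearD(2)[OF that, of ?e k "-1" "?e k"] by simp
  qed
  have "0 < \<Omega>\<^sub>0 0 ?e / \<Omega>\<^sub>1 0 ?e"
    using or[of ?e] or[of "?e(k := (-1) *s ?e k)"] nz
    unfolding neg[OF alt(1)] neg[OF alt(2)] by (auto simp: zero_less_divide_iff)
  then have "\<Omega>\<^sub>0 0 ?e = exp (ln (\<Omega>\<^sub>0 0 ?e / \<Omega>\<^sub>1 0 ?e)) * \<Omega>\<^sub>1 0 ?e"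
    using nz by simp
  then show ?thesis by (rule that)
qed

theorem proposition2p13:
  shows
    "(\<forall>(reg :: regularity) (H :: (real ^ 'n \<Rightarrow> real ^ 'n) set set) (LH :: (real ^ 'n \<Rightarrow> real ^ 'n) set set)
        (X :: real ^ 'n \<Rightarrow> real ^ 'n) (w :: 'n \<Rightarrow> int)
        (\<Omega>\<^sub>0 :: real ^ 'n \<Rightarrow> ('n \<Rightarrow> real ^ 'n) \<Rightarrow> real) \<Omega>\<^sub>1.
        subgroup H (diffeo_group reg) \<longrightarrow>
        is_lie_algebra_of reg LH H \<longrightarrow>
        smooth_map_germ reg X \<longrightarrow>
        (\<forall>i. 0 \<le> w i) \<longrightarrow> 0 < (\<Sum>i\<in>UNIV. w i) \<longrightarrow>
        locally_diffeomorphic reg X (euler_field w) \<longrightarrow>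
        (\<forall>f. smooth_germ reg f \<longrightarrow> germ (\<lambda>x. f x *s X x) \<in> LH) \<longrightarrow>
        volume_form_germ reg \<Omega>\<^sub>0 \<longrightarrow> volume_form_germ reg \<Omega>\<^sub>1 \<longrightarrow>
        same_orientation \<Omega>\<^sub>0 \<Omega>\<^sub>1 \<longrightarrow>
        isotopic reg H \<Omega>\<^sub>0 \<Omega>\<^sub>1)
     \<and>
     (\<forall>(H :: (complex ^ 'n \<Rightarrow> complex ^ 'n) set set) (LH :: (complex ^ 'n \<Rightarrow> complex ^ 'n) set set)
        (X :: complex ^ 'n \<Rightarrow> complex ^ 'n) (w :: 'n \<Rightarrow> int)
        (\<Omega>\<^sub>0 :: complex ^ 'n \<Rightarrow> ('n \<Rightarrow> complex ^ 'n) \<Rightarrow> complex) \<Omega>\<^sub>1.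
        subgroup H (diffeo_group Analytic) \<longrightarrow>
        is_lie_algebra_of Analytic LH H \<longrightarrow>
        smooth_map_germ Analytic X \<longrightarrow>
        (\<forall>i. 0 \<le> w i) \<longrightarrow> 0 < (\<Sum>i\<in>UNIV. w i) \<longrightarrow>
        locally_diffeomorphic Analytic X (euler_field w) \<longrightarrow>
        (\<forall>f. smooth_germ Analytic f \<longrightarrow> germ (\<lambda>x. f x *s X x) \<in> LH) \<longrightarrow>
        volume_form_germ Analytic \<Omega>\<^sub>0 \<longrightarrow> volume_form_germ Analytic \<Omega>\<^sub>1 \<longrightarrow>
        isotopic Analytic H \<Omega>\<^sub>0 \<Omega>\<^sub>1)"
proof (intro conjI allI impI, goal_cases)
  case (1 reg H LH X w \<Omega>\<^sub>0 \<Omega>\<^sub>1)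
  obtain l where l: "\<Omega>\<^sub>0 0 (\<lambda>i. axis i 1) = exp l * \<Omega>\<^sub>1 0 (\<lambda>i. axis i 1)"
    by (rule same_orientation_imp_density_ratio[OF 1(8,9,10)])
  show ?case
    by (rule scalar_regularity.isotopic_if_euler_module[OF real_scalar_regularity 1(2,3) sum_nat_weights_pos[OF 1(4,5)]
          1(6)[unfolded euler_field_eq_euler_vector[OF 1(4)]] 1(7)[rule_format] 1(8,9) l])
next
  case (2 H LH X w \<Omega>\<^sub>0 \<Omega>\<^sub>1)
  have nz: "\<Omega>\<^sub>0 0 (\<lambda>i. axis i 1) \<noteq> 0" "\<Omega>\<^sub>1 0 (\<lambda>i. axis i 1) \<noteq> 0"
    using scalar_regularity.volume_form_density(3)[OF complex_scalar_regularity 2(8)] scalar_regularity.volume_form_density(3)[OF complex_scalar_regularity 2(9)] .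
  have l: "\<Omega>\<^sub>0 0 (\<lambda>i. axis i 1) = exp (Ln (\<Omega>\<^sub>0 0 (\<lambda>i. axis i 1) / \<Omega>\<^sub>1 0 (\<lambda>i. axis i 1))) * \<Omega>\<^sub>1 0 (\<lambda>i. axis i 1)"
    using nz by (simp add: exp_Ln)
  show ?case
    by (rule scalar_regularity.isotopic_if_euler_module[OF complex_scalar_regularity 2(2,3) sum_nat_weights_pos[OF 2(4,5)]
          2(6)[unfolded euler_field_eq_euler_vector[OF 2(4)]] 2(7)[rule_format] 2(8,9) l])
qed

end
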